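(* Let $(\Omega,\mathcal F,\mathbb P)$ be a probability space and let $(\mathcal F_t)_{0\le t\le T}$ be a right-continuous complete filtration on it. Let $S=(S_t)_{0\le t\le T}$ be a càdlàg submartingale of class $D$. Then $S$ can be written in a unique way in the form $$S=M+A,$$ where $M$ is a martingale and $A$ is a predictable increasing process starting at $0$.
   Context: Here $0<T<\infty$ is fixed. All processes are real-valued and indexed by $[0,T]$; martingale, submartingale, adapted, stopping time and predictable are understood with respect to $(\mathcal F_t)_{0\le t\le T}$. An adapted process $(S_t)_{0\le t\le T}$ is of class $D$ if the family of random variables $S_\tau$, where $\tau$ ranges through all stopping times (with values in $[0,T]$), is uniformly integrable. As usual, a process is predictable if, viewed as a function on $\Omega\times[0,T]$, it is measurable with respect to the $\sigma$-algebra generated by all left-continuous adapted processes. A process $A$ is increasing if its paths $t\mapsto A_t(\omega)$ are (almost surely) non-decreasing, and it starts at $0$ if $A_0=0$.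
   Formalization: The martingale M is required to be càdlàg (almost surely), and uniqueness means up to indistinguishability; without càdlàg M, uniqueness fails: for the first Poisson jump time σ, S_t=1_{σ≤t} decomposes with A_t=t∧σ and also with A_t=1_{σ<t}. *)

theory Defs
  imports "HOL-Probability.Probability"
begin

text \<open>
  The index set is the interval from \<open>0\<close> to \<open>T\<close>. Filtrations and processes are functions on all
  of \<^typ>\<open>real\<close>, but every definition below only looks at times in \<^term>\<open>{0..T}\<close>; the values at
  other times are irrelevant.
\<close>

definition filtration_on :: "'a measure \<Rightarrow> real \<Rightarrow> (real \<Rightarrow> 'a measure) \<Rightarrow> bool" where
  "filtration_on P T F \<longleftrightarrow>
     (\<forall>t\<in>{0..T}. subalgebra P (F t)) \<and>
     (\<forall>s\<in>{0..T}. \<forall>t\<in>{0..T}. s \<le> t \<longrightarrow> sets (F s) \<subseteq> sets (F t))"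

definition right_continuous_filtration :: "real \<Rightarrow> (real \<Rightarrow> 'a measure) \<Rightarrow> bool" where
  "right_continuous_filtration T F \<longleftrightarrow>
     (\<forall>t\<in>{0..<T}. sets (F t) = (\<Inter>s\<in>{t<..T}. sets (F s)))"

text \<open>As \<open>F 0\<close> is the smallest \<open>\<sigma>\<close>-algebra of the filtration, it suffices to mention that one.\<close>

definition complete_filtration :: "'a measure \<Rightarrow> (real \<Rightarrow> 'a measure) \<Rightarrow> bool" where
  "complete_filtration P F \<longleftrightarrow> complete_measure P \<and> null_sets P \<subseteq> sets (F 0)"

definition adapted_process :: "real \<Rightarrow> (real \<Rightarrow> 'a measure) \<Rightarrow> (real \<Rightarrow> 'a \<Rightarrow> real) \<Rightarrow> bool" where
  "adapted_process T F X \<longleftrightarrow> (\<forall>t\<in>{0..T}. X t \<in> borel_measurable (F t))"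

definition martingale ::
    "'a measure \<Rightarrow> real \<Rightarrow> (real \<Rightarrow> 'a measure) \<Rightarrow> (real \<Rightarrow> 'a \<Rightarrow> real) \<Rightarrow> bool" where
  "martingale P T F X \<longleftrightarrow>
     adapted_process T F X \<and>
     (\<forall>t\<in>{0..T}. integrable P (X t)) \<and>
     (\<forall>s\<in>{0..T}. \<forall>t\<in>{0..T}. s \<le> t \<longrightarrow>
        (AE \<omega> in P. real_cond_exp P (F s) (X t) \<omega> = X s \<omega>))"

definition submartingale ::
    "'a measure \<Rightarrow> real \<Rightarrow> (real \<Rightarrow> 'a measure) \<Rightarrow> (real \<Rightarrow> 'a \<Rightarrow> real) \<Rightarrow> bool" where
  "submartingale P T F X \<longleftrightarrow>
     adapted_process T F X \<and>
     (\<forall>t\<in>{0..T}. integrable P (X t)) \<and>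
     (\<forall>s\<in>{0..T}. \<forall>t\<in>{0..T}. s \<le> t \<longrightarrow>
        (AE \<omega> in P. X s \<omega> \<le> real_cond_exp P (F s) (X t) \<omega>))"

definition cadlag_path :: "real \<Rightarrow> (real \<Rightarrow> real) \<Rightarrow> bool" where
  "cadlag_path T x \<longleftrightarrow>
     (\<forall>t\<in>{0..<T}. continuous (at_right t) x) \<and>
     (\<forall>t\<in>{0<..T}. \<exists>l. (x \<longlongrightarrow> l) (at_left t))"

text \<open>As for increasing processes below, the path property is required almost surely.\<close>

definition cadlag_process :: "'a measure \<Rightarrow> real \<Rightarrow> (real \<Rightarrow> 'a \<Rightarrow> real) \<Rightarrow> bool" where
  "cadlag_process P T X \<longleftrightarrow> (AE \<omega> in P. cadlag_path T (\<lambda>t. X t \<omega>))"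

definition increasing_process :: "'a measure \<Rightarrow> real \<Rightarrow> (real \<Rightarrow> 'a \<Rightarrow> real) \<Rightarrow> bool" where
  "increasing_process P T X \<longleftrightarrow> (AE \<omega> in P. mono_on {0..T} (\<lambda>t. X t \<omega>))"

text \<open>
  The library constant \<^const>\<open>stopping_time\<close> quantifies over the whole index type; this is the
  same condition for the index set \<^term>\<open>{0..T}\<close>, for times with values in that set.
\<close>

definition stopping_time_on ::
    "'a measure \<Rightarrow> real \<Rightarrow> (real \<Rightarrow> 'a measure) \<Rightarrow> ('a \<Rightarrow> real) \<Rightarrow> bool" where
  "stopping_time_on P T F \<tau> \<longleftrightarrow>
     \<tau> \<in> space P \<rightarrow> {0..T} \<and>
     (\<forall>t\<in>{0..T}. Measurable.pred (F t) (\<lambda>\<omega>. \<tau> \<omega> \<le> t))"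

definition uniformly_integrable :: "'a measure \<Rightarrow> ('a \<Rightarrow> real) set \<Rightarrow> bool" where
  "uniformly_integrable P \<X> \<longleftrightarrow>
     (\<forall>X\<in>\<X>. integrable P X) \<and>
     (\<forall>\<epsilon>>0. \<exists>K. \<forall>X\<in>\<X>. (LINT \<omega>:{\<omega>\<in>space P. K < \<bar>X \<omega>\<bar>}|P. \<bar>X \<omega>\<bar>) \<le> \<epsilon>)"

definition class_D ::
    "'a measure \<Rightarrow> real \<Rightarrow> (real \<Rightarrow> 'a measure) \<Rightarrow> (real \<Rightarrow> 'a \<Rightarrow> real) \<Rightarrow> bool" where
  "class_D P T F X \<longleftrightarrow>
     adapted_process T F X \<and>
     uniformly_integrable P {(\<lambda>\<omega>. X (\<tau> \<omega>) \<omega>) | \<tau>. stopping_time_on P T F \<tau>}"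

text \<open>
  Left-continuity is required of every path here, not only of almost every path: otherwise
  arbitrary behaviour on a null set of scenarios would enter the predictable \<open>\<sigma>\<close>-algebra.
\<close>

definition left_continuous_process :: "'a measure \<Rightarrow> real \<Rightarrow> (real \<Rightarrow> 'a \<Rightarrow> real) \<Rightarrow> bool" where
  "left_continuous_process P T X \<longleftrightarrow>
     (\<forall>\<omega>\<in>space P. \<forall>t\<in>{0<..T}. continuous (at_left t) (\<lambda>s. X s \<omega>))"

definition predictable_algebra ::
    "'a measure \<Rightarrow> real \<Rightarrow> (real \<Rightarrow> 'a measure) \<Rightarrow> ('a \<times> real) measure" where
  "predictable_algebra P T F =
     sigma (space P \<times> {0..T})
       {(\<lambda>(\<omega>, t). X t \<omega>) -` B \<inter> (space P \<times> {0..T}) | X B.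
          adapted_process T F X \<and> left_continuous_process P T X \<and> B \<in> sets borel}"

definition predictable_process ::
    "'a measure \<Rightarrow> real \<Rightarrow> (real \<Rightarrow> 'a measure) \<Rightarrow> (real \<Rightarrow> 'a \<Rightarrow> real) \<Rightarrow> bool" where
  "predictable_process P T F X \<longleftrightarrow>
     (\<lambda>(\<omega>, t). X t \<omega>) \<in> borel_measurable (predictable_algebra P T F)"

text \<open>
  Under the usual conditions on the filtration, martingales are understood to be cadlag. Without
  this convention the decomposition is not unique: if \<open>\<tau>\<close> is the first jump time of a Poisson
  process, then \<open>S t = indicator {\<tau>..} t\<close> is its compensated process plus a continuous increasing
  process, but also the sum of \<open>A t = indicator {\<tau><..} t\<close>, which is left-continuous and hence
  predictable, and of \<open>S - A\<close>, which is a modification of \<open>0\<close> and so satisfies \<^const>\<open>martingale\<close>.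
\<close>

definition doob_meyer_decomposition ::
    "'a measure \<Rightarrow> real \<Rightarrow> (real \<Rightarrow> 'a measure) \<Rightarrow> (real \<Rightarrow> 'a \<Rightarrow> real) \<Rightarrow>
     (real \<Rightarrow> 'a \<Rightarrow> real) \<Rightarrow> (real \<Rightarrow> 'a \<Rightarrow> real) \<Rightarrow> bool" where
  "doob_meyer_decomposition P T F S M A \<longleftrightarrow>
     martingale P T F M \<and> cadlag_process P T M \<and>
     predictable_process P T F A \<and> increasing_process P T A \<and>
     (\<forall>\<omega>\<in>space P. A 0 \<omega> = 0) \<and>
     (\<forall>t\<in>{0..T}. \<forall>\<omega>\<in>space P. S t \<omega> = M t \<omega> + A t \<omega>)"

definition indistinguishable ::
    "'a measure \<Rightarrow> real \<Rightarrow> (real \<Rightarrow> 'a \<Rightarrow> real) \<Rightarrow> (real \<Rightarrow> 'a \<Rightarrow> real) \<Rightarrow> bool" where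
  "indistinguishable P T X Y \<longleftrightarrow> (AE \<omega> in P. \<forall>t\<in>{0..T}. X t \<omega> = Y t \<omega>)"

end

theory Submission
  imports Defs
begin

text \<open>
  Existence follows Beiglboeck, Schachermayer and Veliyev. The discrete Doob decompositions of \<open>S\<close>
  along dyadic grids have compensators whose terminal values are uniformly integrable because \<open>S\<close> is
  of class D, so by a lemma of Komlos type suitable convex combinations of them converge in \<open>L\<^sup>1\<close>.
  The limit determines a right-continuous increasing process \<open>C\<close> such that \<open>S - C\<close> is a martingale.
  The convex combinations of the compensators, extended to left-continuous adapted step processes, have
  \<open>C\<close> as their upper limit for all times simultaneously: at continuity points of a path of \<open>C\<close> this
  follows from monotonicity, and the jumps of \<open>C\<close> are exhausted by countably many stopping times, at
  each of which the expectations converge to that of \<open>C\<close>. Hence \<open>C\<close> agrees with a predictable process.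

  For uniqueness let \<open>N\<close> be the difference of two predictable increasing parts. It is a martingale of
  finite variation, so \<open>E \<integral> H dN = 0\<close> for bounded predictable \<open>H\<close>, first for indicators of the
  rectangles that generate the predictable algebra. As \<open>N\<close> is itself predictable, \<open>H = N + N\<^sub>-\<close> is
  admissible after localisation, and \<open>E N\<^sub>T\<^sup>2 = E \<integral> (N + N\<^sub>-) dN = 0\<close>.
\<close>

section \<open>A Komlos lemma\<close>

text \<open>The obstacle is that a limit is wanted at uncountably many times, while
  \<open>L\<^sup>1\<close> convergence controls one time up to a null set. One geometric rate at
  time \<open>T\<close> settles all dyadic times: conditional expectation contracts
  \<open>L\<^sup>1\<close>, so the same sequence converges almost surely at each of them. Two
  versions of the limit are kept apart. \<open>C\<close> is right-continuous, which suits stopping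
  arguments; \<open>A\<close> is an upper limit taken in every scenario, hence predictable by
  construction; they agree outside one null set. An upper limit is what the argument at jumps
  supports, since \<open>L\<^sup>1\<close> convergence at a stopping time gives a subsequence that
  depends on that stopping time. Right-continuity of the filtration makes \<open>C\<close> adapted,
  completeness absorbs the exceptional null sets.

  For uniqueness the Stieltjes measures of the paths must depend measurably on the scenario. They
  are images of Lebesgue measure under the inverse of the path, so the expected integral becomes an
  integral over a product space. Comparing terminal values is enough, because they determine the
  martingale parts.\<close>

lemma AE_summable_abs:
  fixes f :: "nat \<Rightarrow> 'a \<Rightarrow> real"
  assumes [measurable]: "\<And>i. integrable M (f i)"
    and "summable (\<lambda>i. \<integral>x. \<bar>f i x\<bar> \<partial>M)"
  shows "AE x in M. summable (\<lambda>i. \<bar>f i x\<bar>)"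
proof -
  have [measurable]: "\<And>i. f i \<in> borel_measurable M" using assms(1) by auto
  have "(\<integral>\<^sup>+x. (\<Sum>i. ennreal \<bar>f i x\<bar>) \<partial>M) = (\<Sum>i. \<integral>\<^sup>+x. ennreal \<bar>f i x\<bar> \<partial>M)"
    by (rule nn_integral_suminf) auto
  also have "\<dots> = (\<Sum>i. ennreal (\<integral>x. \<bar>f i x\<bar> \<partial>M))"
    using assms(1) by (intro suminf_cong nn_integral_eq_integral) auto
  also have "\<dots> = ennreal (\<Sum>i. \<integral>x. \<bar>f i x\<bar> \<partial>M)"
    by (intro suminf_ennreal2 assms(2)) auto
  finally have "(\<integral>\<^sup>+x. (\<Sum>i. ennreal \<bar>f i x\<bar>) \<partial>M) \<noteq> \<infinity>" by simp
  then have "AE x in M. (\<Sum>i. ennreal \<bar>f i x\<bar>) \<noteq> \<infinity>"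
    by (intro nn_integral_noteq_infinite) auto
  then show ?thesis
    by eventually_elim (auto intro: summable_suminf_not_top)
qed

lemma AE_tendsto_zero_geometric:
  fixes f :: "nat \<Rightarrow> 'a \<Rightarrow> real"
  assumes "\<And>i. integrable M (f i)" "\<And>i. (\<integral>x. \<bar>f i x\<bar> \<partial>M) \<le> (1/2)^i"
  shows "AE x in M. (\<lambda>i. f i x) \<longlonglongrightarrow> 0"
proof -
  have "summable (\<lambda>i. \<integral>x. \<bar>f i x\<bar> \<partial>M)"
    by (rule summable_comparison_test'[of "\<lambda>i. (1/2)^i" 0]) (auto simp: assms(2) summable_geometric)
  then have "AE x in M. summable (\<lambda>i. \<bar>f i x\<bar>)"
    using AE_summable_abs assms(1) by blast
  then show ?thesis
    by eventually_elim (metis summable_LIMSEQ_zero tendsto_rabs_zero_iff)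
qed

text \<open>The lower index \<open>n\<close> carries the asymptotics: a convex combination of terms
  beyond \<open>n\<close> keeps limits, and keeps identities that hold only for large
  \<open>k\<close>. The upper index \<open>N\<close> makes the combination a finite sum.\<close>

definition tail_weights :: "nat \<Rightarrow> nat \<Rightarrow> (nat \<Rightarrow> real) \<Rightarrow> bool" where
  "tail_weights n N w \<longleftrightarrow> (\<forall>k. 0 \<le> w k) \<and> (\<forall>k. w k \<noteq> 0 \<longrightarrow> n \<le> k \<and> k \<le> N) \<and> sum w {..N} = 1"

lemma tail_weights_sum_extend:
  assumes "tail_weights n N w" "N \<le> N'"
  shows "(\<Sum>k\<le>N'. w k * f k) = (\<Sum>k\<le>N. w k * f k)"
  using assms by (intro sum.mono_neutral_right) (auto simp: tail_weights_def)

lemma tail_weights_mono: "tail_weights n N w \<Longrightarrow> m \<le> n \<Longrightarrow> tail_weights m N w"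
  by (meson tail_weights_def le_trans)

lemma tail_weights_midpoint:
  assumes "tail_weights n N w" "tail_weights n N' w'"
  shows "tail_weights n (max N N') (\<lambda>k. (w k + w' k) / 2)"
    "(\<Sum>k\<le>max N N'. (w k + w' k) / 2 * f k) = ((\<Sum>k\<le>N. w k * f k) + (\<Sum>k\<le>N'. w' k * f k)) / 2"
proof -
  have *: "(\<Sum>k\<le>max N N'. (w k + w' k) / 2 * f k) = ((\<Sum>k\<le>N. w k * f k) + (\<Sum>k\<le>N'. w' k * f k)) / 2" for f
    using tail_weights_sum_extend[OF assms(1), of "max N N'" f]
      tail_weights_sum_extend[OF assms(2), of "max N N'" f]
    by (simp add: sum.distrib sum_divide_distrib[symmetric] distrib_right add_divide_distrib)
  show "(\<Sum>k\<le>max N N'. (w k + w' k) / 2 * f k) = ((\<Sum>k\<le>N. w k * f k) + (\<Sum>k\<le>N'. w' k * f k)) / 2"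
    by (rule *)
  have 1: "sum (\<lambda>k. (w k + w' k) / 2) {..max N N'} = 1"
    using *[of "\<lambda>_. 1"] assms by (simp add: tail_weights_def)
  have 2: "0 \<le> w k" "0 \<le> w' k" "w k \<noteq> 0 \<Longrightarrow> n \<le> k \<and> k \<le> N" "w' k \<noteq> 0 \<Longrightarrow> n \<le> k \<and> k \<le> N'" for k
    using assms by (auto simp: tail_weights_def)
  have 3: "(w k + w' k) / 2 \<noteq> 0 \<Longrightarrow> n \<le> k \<and> k \<le> max N N'" for k
    using 2(3)[of k] 2(4)[of k] by (cases "w k = 0"; cases "w' k = 0") auto
  show "tail_weights n (max N N') (\<lambda>k. (w k + w' k) / 2)"
    unfolding tail_weights_def using 1 2(1,2) 3 by (intro conjI allI impI) (auto simp: add_nonneg_nonneg)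
qed

lemma tail_weights_sum_le:
  assumes "tail_weights n N w" "\<And>k. n \<le> k \<Longrightarrow> f k \<le> c"
  shows "(\<Sum>k\<le>N. w k * f k) \<le> c"
proof -
  have "(\<Sum>k\<le>N. w k * f k) \<le> (\<Sum>k\<le>N. w k * c)"
    using assms by (intro sum_mono) (metis mult_left_mono mult_zero_left order_refl tail_weights_def)
  also have "\<dots> = c" using assms by (simp add: sum_distrib_right[symmetric] tail_weights_def)
  finally show ?thesis .
qed

lemma tail_weights_sum_ge:
  assumes "tail_weights n N w" "\<And>k. n \<le> k \<Longrightarrow> c \<le> f k"
  shows "c \<le> (\<Sum>k\<le>N. w k * f k)"
  using tail_weights_sum_le[OF assms(1), of "\<lambda>k. - f k" "- c"] assms(2)
  by (simp add: sum_negf)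

text \<open>Convexity of the positive part; it passes a uniform bound on the excess over
  \<open>c\<close> from the sequence to its convex combinations.\<close>

lemma tail_weights_positive_part:
  assumes "tail_weights n N w"
  shows "max 0 ((\<Sum>k\<le>N. w k * f k) - c) \<le> (\<Sum>k\<le>N. w k * max 0 (f k - c :: real))"
proof -
  have w: "0 \<le> w k" for k using assms by (auto simp: tail_weights_def)
  have "(\<Sum>k\<le>N. w k * f k) - c = (\<Sum>k\<le>N. w k * (f k - c))"
    using assms by (simp add: tail_weights_def right_diff_distrib sum_subtractf sum_distrib_right[symmetric])
  also have "\<dots> \<le> (\<Sum>k\<le>N. w k * max 0 (f k - c))"
    by (intro sum_mono mult_left_mono w) auto
  finally show ?thesis using w by (auto intro!: sum_nonneg mult_nonneg_nonneg)
qed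

text \<open>On \<open>{0..c}\<close> the slope of \<open>exp (-x/2)\<close> is at least
  \<open>exp (-c/2) / 2\<close> in absolute value, whence the factor \<open>2 * exp (c/2)\<close>.
  What lies above \<open>c\<close> is paid for by the two positive parts. So closeness of the
  exponentials becomes closeness of the variables themselves once these are uniformly
  integrable.\<close>

lemma exp_half_diff_bound:
  fixes x y c :: real
  assumes "0 \<le> x" "0 \<le> y" "0 \<le> c"
  shows "\<bar>x - y\<bar> \<le> 2 * exp (c/2) * \<bar>exp (-x/2) - exp (-y/2)\<bar> + max 0 (x - c) + max 0 (y - c)"
proof -
  have main: "min y c - min x c \<le> 2 * exp (c/2) * (exp (-x/2) - exp (-y/2))" if "x \<le> y" for x y :: real
  proof -
    let ?a = "min x c" and ?b = "min y c"
    have ab: "?a \<le> ?b" using that by auto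
    have "(?b - ?a)/2 \<le> exp ((?b - ?a)/2) - 1" using exp_ge_add_one_self[of "(?b - ?a)/2"] by linarith
    also have "\<dots> = exp (?b/2) * (exp (-?a/2) - exp (-?b/2))"
    proof -
      have "exp (?b/2) * exp (-?a/2) = exp ((?b - ?a)/2)" "exp (?b/2) * exp (-?b/2) = 1"
        unfolding exp_add[symmetric] by (simp_all add: diff_divide_distrib)
      then show ?thesis by (simp only: right_diff_distrib)
    qed
    also have "\<dots> \<le> exp (c/2) * (exp (-?a/2) - exp (-?b/2))"
      using ab by (intro mult_right_mono) auto
    also have "exp (-?a/2) - exp (-?b/2) \<le> exp (-x/2) - exp (-y/2)"
      using that by (cases "x \<le> c"; cases "y \<le> c") (auto simp: min_def)
    finally show ?thesis by (simp add: mult_left_mono)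
  qed
  show ?thesis
  proof (cases "x \<le> y")
    case True
    then have "exp (-y/2) \<le> exp (-x/2)" by simp
    then have "0 \<le> 2 * exp (c/2) * (exp (-x/2) - exp (-y/2))"
      "\<bar>exp (-x/2) - exp (-y/2)\<bar> = exp (-x/2) - exp (-y/2)" by simp_all
    with main[OF True] True show ?thesis by linarith
  next
    case False
    then have "exp (-x/2) \<le> exp (-y/2)" by simp
    then have "0 \<le> 2 * exp (c/2) * (exp (-y/2) - exp (-x/2))"
      "\<bar>exp (-x/2) - exp (-y/2)\<bar> = exp (-y/2) - exp (-x/2)" by simp_all
    moreover have "min x c - min y c \<le> 2 * exp (c/2) * (exp (-y/2) - exp (-x/2))"
      using main[of y x] False by linarith
    moreover have "\<bar>x - y\<bar> \<le> D + max 0 (x - c) + max 0 (y - c)" if "0 \<le> D" "min x c - min y c \<le> D" for D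
      using that False by linarith
    ultimately show ?thesis by (simp only:)
  qed
qed

text \<open>A Komlos lemma: near-minimisers of the strictly convex functional \<open>E exp(-g)\<close> over the tail
  convex hulls form a Cauchy sequence, by the parallelogram identity for \<open>exp(-g/2)\<close>.\<close>

lemma (in prob_space) komlos_cauchy:
  fixes Z :: "nat \<Rightarrow> 'a \<Rightarrow> real"
  assumes Z: "\<And>k. integrable M (Z k)" and nonneg: "\<And>k \<omega>. 0 \<le> Z k \<omega>"
    and ui: "\<And>e. e > 0 \<Longrightarrow> \<exists>c\<ge>0. \<forall>k. (\<integral>\<omega>. max 0 (Z k \<omega> - c) \<partial>M) \<le> e"
  obtains N w where "\<And>n. tail_weights n (N n) (w n)"
    "\<And>e. e > 0 \<Longrightarrow> \<exists>n0. \<forall>n\<ge>n0. \<forall>m\<ge>n0.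
       (\<integral>\<omega>. \<bar>(\<Sum>k\<le>N n. w n k * Z k \<omega>) - (\<Sum>k\<le>N m. w m k * Z k \<omega>)\<bar> \<partial>M) \<le> e"
proof -
  have [measurable]: "Z k \<in> borel_measurable M" for k using Z by auto
  define g where "g N w \<omega> = (\<Sum>k\<le>N. w k * Z k \<omega>)" for N :: nat and w :: "nat \<Rightarrow> real" and \<omega>
  have g_int: "integrable M (g N w)" for N w unfolding g_def using Z by auto
  have [measurable]: "g N w \<in> borel_measurable M" for N w using g_int by auto
  have g_nn: "0 \<le> g N w \<omega>" if "tail_weights n N w" for n N w \<omega>
    unfolding g_def using that nonneg by (auto simp: tail_weights_def intro!: sum_nonneg)
  define \<phi> where "\<phi> N w = (\<integral>\<omega>. exp (- g N w \<omega>) \<partial>M)" for N w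
  have exp_int: "integrable M (\<lambda>\<omega>. exp (- g N w \<omega>))" "integrable M (\<lambda>\<omega>. exp (- g N w \<omega> / 2))"
    if "tail_weights n N w" for n N w
    using g_nn[OF that] by (auto intro!: integrable_const_bound[where B=1])
  define I where "I n = Inf {\<phi> N w |N w. tail_weights n N w}" for n
  have ne: "{\<phi> N w |N w. tail_weights n N w} \<noteq> {}" for n
  proof -
    have "tail_weights n n (\<lambda>k. if k = n then 1 else 0)" by (auto simp: tail_weights_def)
    then show ?thesis by blast
  qed
  have \<phi>0: "0 \<le> \<phi> N w" for N w unfolding \<phi>_def by auto
  have bdd: "bdd_below {\<phi> N w |N w. tail_weights n N w}" for n
    by (rule bdd_belowI[of _ 0]) (use \<phi>0 in auto)
  have I_le: "I n \<le> \<phi> N w" if "tail_weights n N w" for n N w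
    unfolding I_def using that by (intro cInf_lower bdd) auto
  have I_mono: "I m \<le> I n" if "m \<le> n" for m n
    unfolding I_def using tail_weights_mono[OF _ that] by (intro cInf_superset_mono ne bdd) blast
  have I1: "I n \<le> 1" for n
  proof -
    obtain N w where w: "tail_weights n N w" using ne by blast
    have "\<phi> N w \<le> (\<integral>\<omega>. 1 \<partial>M)" unfolding \<phi>_def
      by (intro integral_mono exp_int[OF w]) (use g_nn[OF w] in auto)
    then show ?thesis using I_le[OF w] by (simp add: prob_space)
  qed
  have "\<exists>p. tail_weights n (fst p) (snd p) \<and> \<phi> (fst p) (snd p) < I n + 1 / real (Suc n)" for n
    using cInf_lessD[OF ne, of n "I n + 1 / real (Suc n)"] unfolding I_def by auto
  then obtain p where p: "\<And>n. tail_weights n (fst (p n)) (snd (p n))"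
      "\<And>n. \<phi> (fst (p n)) (snd (p n)) < I n + 1 / real (Suc n)"
    by metis
  define N w where "N n = fst (p n)" and "w n = snd (p n)" for n
  have w: "tail_weights n (N n) (w n)" for n using p by (auto simp: N_def w_def)
  have w_min: "\<phi> (N n) (w n) < I n + 1 / real (Suc n)" for n using p by (auto simp: N_def w_def)
  define G where "G n = g (N n) (w n)" for n
  define h where "h n \<omega> = exp (- G n \<omega> / 2)" for n \<omega>
  have [measurable]: "G n \<in> borel_measurable M" "h n \<in> borel_measurable M" for n
    unfolding G_def h_def by auto
  have G_nn: "0 \<le> G n \<omega>" for n \<omega> unfolding G_def using g_nn[OF w] .
  have h01: "0 < h n \<omega>" "h n \<omega> \<le> 1" for n \<omega> unfolding h_def using G_nn[of n \<omega>] by auto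
  have hh: "\<bar>h m \<omega> - h n \<omega>\<bar> \<le> 1" for m n \<omega>
    using h01[of m \<omega>] h01[of n \<omega>] by linarith
  have bound: "(\<integral>\<omega>. (h m \<omega> - h n \<omega>)\<^sup>2 \<partial>M) \<le> 2 * (I m + 1 / real (Suc m)) + 2 * (I n + 1 / real (Suc n)) - 4 * I k"
    if "k \<le> m" "k \<le> n" for k m n
  proof -
    have wk: "tail_weights k (N m) (w m)" "tail_weights k (N n) (w n)"
      using w tail_weights_mono that by blast+
    have mid: "g (max (N m) (N n)) (\<lambda>i. (w m i + w n i) / 2) \<omega> = (G m \<omega> + G n \<omega>) / 2" for \<omega>
      unfolding g_def G_def using tail_weights_midpoint(2)[OF wk, of "\<lambda>k. Z k \<omega>"] by simp
    \<comment> \<open>The midpoint of two admissible weights is admissible, and its value of the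
      functional is the mean of \<open>h m * h n\<close>; this is why \<open>h\<close> carries half
      of the exponent.\<close>
    have "I k \<le> \<phi> (max (N m) (N n)) (\<lambda>i. (w m i + w n i) / 2)"
      by (rule I_le[OF tail_weights_midpoint(1)[OF wk]])
    also have "\<dots> = (\<integral>\<omega>. h m \<omega> * h n \<omega> \<partial>M)"
      unfolding \<phi>_def mid h_def by (simp add: exp_add[symmetric] algebra_simps add_divide_distrib)
    finally have 1: "I k \<le> (\<integral>\<omega>. h m \<omega> * h n \<omega> \<partial>M)" .
    have sq: "(\<integral>\<omega>. (h j \<omega>)\<^sup>2 \<partial>M) = \<phi> (N j) (w j)" for j
      unfolding \<phi>_def h_def G_def by (simp add: power2_eq_square exp_add[symmetric])
    have i: "integrable M (\<lambda>\<omega>. (h j \<omega>)\<^sup>2)" "integrable M (\<lambda>\<omega>. h m \<omega> * h n \<omega>)" for j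
      using h01 by (auto intro!: integrable_const_bound[where B=1] mult_le_one simp: power_le_one less_imp_le abs_mult intro!: AE_I2)
    have "(\<integral>\<omega>. (h m \<omega> - h n \<omega>)\<^sup>2 \<partial>M) = (\<integral>\<omega>. (h m \<omega>)\<^sup>2 + (h n \<omega>)\<^sup>2 - 2 * (h m \<omega> * h n \<omega>) \<partial>M)"
      by (simp add: power2_diff algebra_simps)
    also have "\<dots> = \<phi> (N m) (w m) + \<phi> (N n) (w n) - 2 * (\<integral>\<omega>. h m \<omega> * h n \<omega> \<partial>M)"
      using i by (simp add: sq)
    also have "\<dots> \<le> 2 * (I m + 1 / real (Suc m)) + 2 * (I n + 1 / real (Suc n)) - 4 * I k"
    proof -
      have "\<phi> (N m) (w m) + \<phi> (N n) (w n) - 2 * (\<integral>\<omega>. h m \<omega> * h n \<omega> \<partial>M)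
         \<le> (I m + 1 / real (Suc m)) + (I n + 1 / real (Suc n)) - 2 * I k"
        using 1 w_min[of m] w_min[of n] by linarith
      moreover have "0 \<le> (I m + 1 / real (Suc m)) + (I n + 1 / real (Suc n)) - 2 * I k"
      proof -
        have "0 \<le> 1 / real (Suc m)" "0 \<le> 1 / real (Suc n)" by simp_all
        then show ?thesis using I_mono[OF that(1)] I_mono[OF that(2)] by linarith
      qed
      moreover have "p \<le> 2 * a + 2 * b - 4 * c" if "p \<le> a + b - 2 * c" "0 \<le> a + b - 2 * c" for a b c p :: real
        using that by linarith
      ultimately show ?thesis by blast
    qed
    finally show ?thesis .
  qed
  have cauchy: "\<exists>n0. \<forall>n\<ge>n0. \<forall>m\<ge>n0. (\<integral>\<omega>. \<bar>G n \<omega> - G m \<omega>\<bar> \<partial>M) \<le> e" if "e > 0" for e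
  proof -
    obtain c where c: "c \<ge> 0" "\<And>k. (\<integral>\<omega>. max 0 (Z k \<omega> - c) \<partial>M) \<le> e/4"
      using ui[of "e/4"] \<open>e > 0\<close> by auto
    have Gc: "(\<integral>\<omega>. max 0 (G n \<omega> - c) \<partial>M) \<le> e/4" for n
    proof -
      have "(\<integral>\<omega>. max 0 (G n \<omega> - c) \<partial>M) \<le> (\<integral>\<omega>. (\<Sum>k\<le>N n. w n k * max 0 (Z k \<omega> - c)) \<partial>M)"
        unfolding G_def g_def using Z
        by (intro integral_mono tail_weights_positive_part[OF w]) auto
      also have "\<dots> = (\<Sum>k\<le>N n. w n k * (\<integral>\<omega>. max 0 (Z k \<omega> - c) \<partial>M))"
        using Z by (subst Bochner_Integration.integral_sum) auto
      also have "\<dots> \<le> e/4" by (rule tail_weights_sum_le[OF w]) (use c in auto)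
      finally show ?thesis .
    qed
    have "(\<lambda>n. I n) \<longlonglongrightarrow> (SUP n. I n)"
      by (intro LIMSEQ_incseq_SUP bdd_aboveI2[of _ _ 1] I1) (auto simp: incseq_def I_mono)
    then have lim: "(\<lambda>n. I n + 1 / real (Suc n)) \<longlonglongrightarrow> (SUP n. I n) + 0" "(\<lambda>n. I n) \<longlonglongrightarrow> (SUP n. I n)"
      using tendsto_add[of I _ _ "\<lambda>n. 1 / real (Suc n)" 0] LIMSEQ_inverse_real_of_nat
      by (auto simp: inverse_eq_divide simp del: of_nat_Suc)
    \<comment> \<open>For indices beyond \<open>n0\<close> the estimate \<open>bound\<close> is at
      most \<open>8 * d\<close>. Jensen's inequality and a square root then leave
      \<open>e / (4 * exp (c/2))\<close>, which the factor \<open>2 * exp (c/2)\<close> turns into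
      \<open>e/2\<close>; the two excesses contribute \<open>e/4\<close> each.\<close>
    define d where "d = (e / (4 * exp (c/2)))\<^sup>2 / 8"
    have "d > 0" unfolding d_def using \<open>e>0\<close> by simp
    obtain n1 n2 where n12: "\<forall>n\<ge>n1. \<bar>I n + 1 / real (Suc n) - (SUP n. I n)\<bar> < d"
        "\<forall>n\<ge>n2. \<bar>I n - (SUP n. I n)\<bar> < d"
      using LIMSEQ_D[OF lim(1) \<open>d>0\<close>] LIMSEQ_D[OF lim(2) \<open>d>0\<close>] by auto
    define n0 where "n0 = max n1 n2"
    have n0: "\<bar>I n + 1 / real (Suc n) - (SUP n. I n)\<bar> < d" "\<bar>I n - (SUP n. I n)\<bar> < d" if "n \<ge> n0" for n
      using n12 that by (auto simp: n0_def)
    show ?thesis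
    proof (intro exI allI impI)
      fix n m assume nm: "n0 \<le> n" "n0 \<le> m"
      have sqi: "integrable M (\<lambda>\<omega>. (h n \<omega> - h m \<omega>)\<^sup>2)"
        using hh by (auto intro!: integrable_const_bound[where B=1] simp: abs_square_le_1)
      have hi: "integrable M (\<lambda>\<omega>. \<bar>h n \<omega> - h m \<omega>\<bar>)"
        using hh by (auto intro!: integrable_const_bound[where B=1])
      have sq: "(\<integral>\<omega>. (h n \<omega> - h m \<omega>)\<^sup>2 \<partial>M) \<le> 8 * d"
        using bound[OF nm] n0(1)[OF nm(1)] n0(1)[OF nm(2)] n0(2)[of n0] by simp
      have "(\<integral>\<omega>. \<bar>h n \<omega> - h m \<omega>\<bar> \<partial>M)\<^sup>2 \<le> (\<integral>\<omega>. \<bar>h n \<omega> - h m \<omega>\<bar>\<^sup>2 \<partial>M)"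
        by (rule jensens_inequality[where I=UNIV and q="\<lambda>x. x\<^sup>2"]) (use hi sqi in \<open>auto intro: convex_power2\<close>)
      also have "\<dots> \<le> (e / (4 * exp (c/2)))\<^sup>2" using sq by (simp add: d_def)
      finally have h1: "(\<integral>\<omega>. \<bar>h n \<omega> - h m \<omega>\<bar> \<partial>M) \<le> e / (4 * exp (c/2))"
        by (rule power2_le_imp_le) (use \<open>e>0\<close> in auto)
      have Gi: "integrable M (G j)" for j unfolding G_def by (rule g_int)
      have "(\<integral>\<omega>. \<bar>G n \<omega> - G m \<omega>\<bar> \<partial>M) \<le>
         (\<integral>\<omega>. 2 * exp (c/2) * \<bar>h n \<omega> - h m \<omega>\<bar> + max 0 (G n \<omega> - c) + max 0 (G m \<omega> - c) \<partial>M)"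
      proof (rule integral_mono)
        show "\<bar>G n \<omega> - G m \<omega>\<bar> \<le> 2 * exp (c/2) * \<bar>h n \<omega> - h m \<omega>\<bar> + max 0 (G n \<omega> - c) + max 0 (G m \<omega> - c)" for \<omega>
          unfolding h_def by (rule exp_half_diff_bound[OF G_nn G_nn c(1)])
      qed (use hi Gi in auto)
      also have "\<dots> = 2 * exp (c/2) * (\<integral>\<omega>. \<bar>h n \<omega> - h m \<omega>\<bar> \<partial>M) + (\<integral>\<omega>. max 0 (G n \<omega> - c) \<partial>M) + (\<integral>\<omega>. max 0 (G m \<omega> - c) \<partial>M)"
        using hi Gi by simp
      also have "\<dots> \<le> 2 * exp (c/2) * (e / (4 * exp (c/2))) + e/4 + e/4"
        by (intro add_mono mult_left_mono h1 Gc) auto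
      also have "\<dots> = e" by simp
      finally show "(\<integral>\<omega>. \<bar>G n \<omega> - G m \<omega>\<bar> \<partial>M) \<le> e" .
    qed
  qed
  show thesis by (rule that[OF w]) (use cauchy in \<open>auto simp: G_def g_def\<close>)
qed

text \<open>The Cauchy sequence of \<open>komlos_cauchy\<close> is thinned until consecutive terms
  are geometrically close, and the limit is a telescoping series. The explicit rate is what later
  yields almost sure convergence at all dyadic times along one sequence.\<close>

lemma (in prob_space) komlos:
  fixes Z :: "nat \<Rightarrow> 'a \<Rightarrow> real"
  assumes Z: "\<And>k. integrable M (Z k)" and nonneg: "\<And>k \<omega>. 0 \<le> Z k \<omega>"
    and ui: "\<And>e. e > 0 \<Longrightarrow> \<exists>c\<ge>0. \<forall>k. (\<integral>\<omega>. max 0 (Z k \<omega> - c) \<partial>M) \<le> e"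
  obtains N w X where "\<And>n. tail_weights n (N n) (w n)" "integrable M X"
    "\<And>n. (\<integral>\<omega>. \<bar>(\<Sum>k\<le>N n. w n k * Z k \<omega>) - X \<omega>\<bar> \<partial>M) \<le> (1/2)^n"
proof -
  obtain N w where w: "\<And>n. tail_weights n (N n) (w n)"
    and cau: "\<And>e. e > 0 \<Longrightarrow> \<exists>n0. \<forall>n\<ge>n0. \<forall>m\<ge>n0.
       (\<integral>\<omega>. \<bar>(\<Sum>k\<le>N n. w n k * Z k \<omega>) - (\<Sum>k\<le>N m. w m k * Z k \<omega>)\<bar> \<partial>M) \<le> e"
    using komlos_cauchy[OF assms] by blast
  define G where "G n \<omega> = (\<Sum>k\<le>N n. w n k * Z k \<omega>)" for n \<omega>
  have G: "integrable M (G n)" for n unfolding G_def using Z by auto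
  have [measurable]: "G n \<in> borel_measurable M" for n using G by auto
  \<comment> \<open>The exponent \<open>Suc j\<close> lets the tail of the series from
    \<open>n\<close> on sum to exactly \<open>(1/2)^n\<close>; the demand \<open>n0 \<ge> j\<close>
    keeps the support of the thinned weights beyond \<open>n\<close>.\<close>
  have "\<exists>n0\<ge>j. \<forall>n\<ge>n0. \<forall>m\<ge>n0. (\<integral>\<omega>. \<bar>G n \<omega> - G m \<omega>\<bar> \<partial>M) \<le> (1/2)^Suc j" for j
  proof -
    obtain n0 where "\<forall>n\<ge>n0. \<forall>m\<ge>n0. (\<integral>\<omega>. \<bar>G n \<omega> - G m \<omega>\<bar> \<partial>M) \<le> (1/2)^Suc j"
      using cau[of "(1/2)^Suc j"] unfolding G_def by auto
    then show ?thesis by (intro exI[of _ "max j n0"]) auto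
  qed
  then obtain q where q: "\<And>j. q j \<ge> j" "\<And>j n m. n \<ge> q j \<Longrightarrow> m \<ge> q j \<Longrightarrow> (\<integral>\<omega>. \<bar>G n \<omega> - G m \<omega>\<bar> \<partial>M) \<le> (1/2)^Suc j"
    by metis
  \<comment> \<open>Summing the thresholds gives a nondecreasing sequence that still dominates each
    \<open>q j\<close>.\<close>
  define r where "r j = (\<Sum>i\<le>j. q i)" for j
  have rq: "q j \<le> r j" for j unfolding r_def by (cases j) auto
  have rmono: "r j \<le> r (Suc j)" for j unfolding r_def by simp
  define f where "f j \<omega> = G (r (Suc j)) \<omega> - G (r j) \<omega>" for j \<omega>
  have f: "integrable M (f j)" for j unfolding f_def using G by auto
  have fb: "(\<integral>\<omega>. \<bar>f j \<omega>\<bar> \<partial>M) \<le> (1/2)^Suc j" for j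
    unfolding f_def by (rule q(2)) (use rq rmono order_trans in blast)+
  have geo: "summable (\<lambda>j. (1/2::real)^Suc (j + n))" for n
    using summable_mult2[OF summable_geometric[of "1/2::real"], of "(1/2)^Suc n"]
    by (simp add: power_add mult.assoc mult.commute)
  have fsum: "summable (\<lambda>j. \<integral>\<omega>. \<bar>f j \<omega>\<bar> \<partial>M)"
    by (rule summable_comparison_test'[OF geo[of 0], of 0]) (use fb in auto)
  have ae: "AE \<omega> in M. summable (\<lambda>j. \<bar>f j \<omega>\<bar>)" by (rule AE_summable_abs[OF f fsum])
  define X where "X \<omega> = G (r 0) \<omega> + (\<Sum>j. f j \<omega>)" for \<omega>
  have X: "integrable M X" unfolding X_def
    by (intro Bochner_Integration.integrable_add G integrable_suminf f) (use ae fsum in auto)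
  have tail: "(\<integral>\<omega>. \<bar>G (r n) \<omega> - X \<omega>\<bar> \<partial>M) \<le> (1/2)^n" for n
  proof -
    have fs: "summable (\<lambda>j. \<integral>\<omega>. \<bar>f (j + n) \<omega>\<bar> \<partial>M)" using summable_ignore_initial_segment[OF fsum] .
    have ae2: "AE \<omega> in M. summable (\<lambda>j. \<bar>f (j + n) \<omega>\<bar>)"
      using ae by eventually_elim (rule summable_ignore_initial_segment)
    have tele: "G (r n) \<omega> = G (r 0) \<omega> + (\<Sum>j<n. f j \<omega>)" for \<omega>
      by (induction n) (auto simp: f_def)
    have "(\<integral>\<omega>. \<bar>G (r n) \<omega> - X \<omega>\<bar> \<partial>M) \<le> (\<integral>\<omega>. (\<Sum>j. \<bar>f (j + n) \<omega>\<bar>) \<partial>M)"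
    proof (intro integral_mono_AE)
      show "integrable M (\<lambda>\<omega>. \<bar>G (r n) \<omega> - X \<omega>\<bar>)" using G X by auto
      show "integrable M (\<lambda>\<omega>. (\<Sum>j. \<bar>f (j + n) \<omega>\<bar>))"
        by (intro integrable_suminf) (use f fs ae2 in auto)
      show "AE \<omega> in M. \<bar>G (r n) \<omega> - X \<omega>\<bar> \<le> (\<Sum>j. \<bar>f (j + n) \<omega>\<bar>)"
        using ae
      proof eventually_elim
        case (elim \<omega>)
        then have s: "summable (\<lambda>j. f j \<omega>)" by (rule summable_rabs_cancel)
        have "X \<omega> - G (r n) \<omega> = (\<Sum>j. f (j + n) \<omega>)"
          unfolding tele[of \<omega>] X_def using suminf_split_initial_segment[OF s, of n] by simp
        moreover have "\<bar>\<Sum>j. f (j + n) \<omega>\<bar> \<le> (\<Sum>j. \<bar>f (j + n) \<omega>\<bar>)"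
          by (rule summable_rabs) (use summable_ignore_initial_segment[OF elim] in simp)
        ultimately show ?case by (simp add: abs_minus_commute)
      qed
    qed
    also have "\<dots> = (\<Sum>j. \<integral>\<omega>. \<bar>f (j + n) \<omega>\<bar> \<partial>M)"
      by (intro integral_suminf) (use f fs ae2 in auto)
    also have "\<dots> \<le> (\<Sum>j. (1/2)^Suc (j + n))"
      by (intro suminf_le fb fs geo)
    also have "\<dots> = (1/2)^n"
    proof -
      have "(\<lambda>j. (1/2::real)^Suc (j + n)) = (\<lambda>j. (1/2)^Suc n * (1/2)^j)"
        by (auto simp: power_add algebra_simps)
      then show ?thesis using suminf_mult[OF summable_geometric[of "1/2::real"], of "(1/2)^Suc n"]
        by (simp add: suminf_geometric)
    qed
    finally show ?thesis .
  qed
  show thesis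
  proof (rule that[of "\<lambda>n. N (r n)" "\<lambda>n. w (r n)" X])
    show "tail_weights n (N (r n)) (w (r n))" for n
      using w[of "r n"] tail_weights_mono[of "r n" _ _ n] q(1)[of n] rq[of n] by (meson le_trans)
    show "integrable M X" by (rule X)
    show "(\<integral>\<omega>. \<bar>(\<Sum>k\<le>N (r n). w (r n) k * Z k \<omega>) - X \<omega>\<bar> \<partial>M) \<le> (1/2)^n" for n
      using tail[of n] unfolding G_def .
  qed
qed

section \<open>Uniformly integrable families and discrete compensators\<close>

lemma integrable_indicator_mult:
  fixes X :: "'a \<Rightarrow> real"
  assumes "B \<in> sets M" "integrable M X"
  shows "integrable M (\<lambda>\<omega>. indicator B \<omega> * X \<omega>)"
  using integrable_mult_indicator[OF assms] by (simp only: real_scaleR_def)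

text \<open>The excess \<open>max 0 (\<bar>X \<omega>\<bar> - K)\<close> is the error made by
  truncating at level \<open>K\<close>, and it is dominated by the tail integral of the definition.
  In this form it combines directly with estimates for the bounded part.\<close>

lemma uniformly_integrable_bound:
  assumes "uniformly_integrable P \<X>" "0 < \<epsilon>"
  obtains K where "0 \<le> K" "\<And>X. X \<in> \<X> \<Longrightarrow> (\<integral>\<omega>. max 0 (\<bar>X \<omega>\<bar> - K) \<partial>P) \<le> \<epsilon>"
    "\<And>X. X \<in> \<X> \<Longrightarrow> integrable P X"
proof -
  obtain K where K: "\<And>X. X \<in> \<X> \<Longrightarrow> (LINT \<omega>:{\<omega>\<in>space P. K < \<bar>X \<omega>\<bar>}|P. \<bar>X \<omega>\<bar>) \<le> \<epsilon>"
    and int: "\<And>X. X \<in> \<X> \<Longrightarrow> integrable P X"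
    using assms unfolding uniformly_integrable_def by metis
  show thesis
  proof (rule that[of "max K 0"])
    fix X assume X: "X \<in> \<X>"
    have [measurable]: "X \<in> borel_measurable P" using int[OF X] by auto
    have iX: "integrable P (\<lambda>\<omega>. \<bar>X \<omega>\<bar> * indicator {\<omega>\<in>space P. K < \<bar>X \<omega>\<bar>} \<omega>)"
      by (rule integrable_real_mult_indicator) (use int[OF X] in auto)
    have "(\<integral>\<omega>. max 0 (\<bar>X \<omega>\<bar> - max K 0) \<partial>P) \<le> (\<integral>\<omega>. \<bar>X \<omega>\<bar> * indicator {\<omega>\<in>space P. K < \<bar>X \<omega>\<bar>} \<omega> \<partial>P)"
    proof (rule integral_mono'[OF iX])
      show "max 0 (\<bar>X \<omega>\<bar> - max K 0) \<le> \<bar>X \<omega>\<bar> * indicator {\<omega>\<in>space P. K < \<bar>X \<omega>\<bar>} \<omega>" if "\<omega> \<in> space P" for \<omega>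
        using that by (auto simp: indicator_def)
    qed auto
    also have "\<dots> \<le> \<epsilon>" using K[OF X] by (simp add: set_lebesgue_integral_def mult.commute)
    finally show "(\<integral>\<omega>. max 0 (\<bar>X \<omega>\<bar> - max K 0) \<partial>P) \<le> \<epsilon>" .
    show "integrable P X" by (rule int[OF X])
  qed auto
qed

text \<open>Truncated at level \<open>K\<close> the variables are bounded and dominated convergence
  applies; the two truncation errors cost at most \<open>e/4\<close> each.\<close>

lemma (in prob_space) vitali_convergence:
  fixes X :: "nat \<Rightarrow> 'a \<Rightarrow> real"
  assumes ui: "uniformly_integrable M \<X>" and X: "\<And>n. X n \<in> \<X>" "Y \<in> \<X>"
    and lim: "AE \<omega> in M. (\<lambda>n. X n \<omega>) \<longlonglongrightarrow> Y \<omega>"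
  shows "(\<lambda>n. \<integral>\<omega>. \<bar>X n \<omega> - Y \<omega>\<bar> \<partial>M) \<longlonglongrightarrow> 0"
proof (rule LIMSEQ_I)
  fix e :: real assume "0 < e"
  then obtain K where K: "0 \<le> K" "\<And>X. X \<in> \<X> \<Longrightarrow> (\<integral>\<omega>. max 0 (\<bar>X \<omega>\<bar> - K) \<partial>M) \<le> e/4"
    "\<And>X. X \<in> \<X> \<Longrightarrow> integrable M X"
    using uniformly_integrable_bound[OF ui, of "e/4"] by auto
  define \<phi> where "\<phi> x = max (-K) (min K x)" for x :: real
  have int: "integrable M (X n)" "integrable M Y" for n using K X by auto
  have [measurable]: "X n \<in> borel_measurable M" "Y \<in> borel_measurable M" for n using int by auto
  have [measurable]: "\<phi> \<in> borel_measurable borel" unfolding \<phi>_def by measurable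
  have \<phi>b: "\<bar>\<phi> x\<bar> \<le> K" for x unfolding \<phi>_def using K(1) by auto
  have \<phi>i: "integrable M (\<lambda>\<omega>. \<phi> (f \<omega>))" if [measurable]: "f \<in> borel_measurable M" for f
    by (rule integrable_const_bound[where B=K]) (use \<phi>b in auto)
  have "(\<lambda>n. \<integral>\<omega>. \<bar>\<phi> (X n \<omega>) - \<phi> (Y \<omega>)\<bar> \<partial>M) \<longlonglongrightarrow> (\<integral>\<omega>. 0 \<partial>M)"
  proof (rule integral_dominated_convergence[where w="\<lambda>_. 2 * K"])
    show "AE \<omega> in M. (\<lambda>n. \<bar>\<phi> (X n \<omega>) - \<phi> (Y \<omega>)\<bar>) \<longlonglongrightarrow> 0"
      using lim
    proof eventually_elim
      case (elim \<omega>)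
      have "(\<lambda>n. \<bar>\<phi> (X n \<omega>) - \<phi> (Y \<omega>)\<bar>) \<longlonglongrightarrow> \<bar>\<phi> (Y \<omega>) - \<phi> (Y \<omega>)\<bar>"
        unfolding \<phi>_def by (intro tendsto_intros elim)
      then show ?case by simp
    qed
    show "AE \<omega> in M. norm \<bar>\<phi> (X n \<omega>) - \<phi> (Y \<omega>)\<bar> \<le> 2 * K" for n
    proof (rule AE_I2)
      fix \<omega> show "norm \<bar>\<phi> (X n \<omega>) - \<phi> (Y \<omega>)\<bar> \<le> 2 * K"
        using \<phi>b[of "X n \<omega>"] \<phi>b[of "Y \<omega>"] by simp
    qed
  qed auto
  then have "eventually (\<lambda>n. (\<integral>\<omega>. \<bar>\<phi> (X n \<omega>) - \<phi> (Y \<omega>)\<bar> \<partial>M) < e/2) sequentially"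
    using order_tendstoD(2)[of _ "0::real" sequentially "e/2"] \<open>0 < e\<close> by simp
  then obtain n0 where n0: "\<And>n. n \<ge> n0 \<Longrightarrow> (\<integral>\<omega>. \<bar>\<phi> (X n \<omega>) - \<phi> (Y \<omega>)\<bar> \<partial>M) < e/2"
    by (auto simp: eventually_sequentially)
  show "\<exists>no. \<forall>n\<ge>no. norm ((\<integral>\<omega>. \<bar>X n \<omega> - Y \<omega>\<bar> \<partial>M) - 0) < e"
  proof (intro exI allI impI)
    fix n assume "n0 \<le> n"
    have "(\<integral>\<omega>. \<bar>X n \<omega> - Y \<omega>\<bar> \<partial>M) \<le> (\<integral>\<omega>. \<bar>\<phi> (X n \<omega>) - \<phi> (Y \<omega>)\<bar> + max 0 (\<bar>X n \<omega>\<bar> - K) + max 0 (\<bar>Y \<omega>\<bar> - K) \<partial>M)"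
    proof (rule integral_mono)
      show "\<bar>X n \<omega> - Y \<omega>\<bar> \<le> \<bar>\<phi> (X n \<omega>) - \<phi> (Y \<omega>)\<bar> + max 0 (\<bar>X n \<omega>\<bar> - K) + max 0 (\<bar>Y \<omega>\<bar> - K)" for \<omega>
      proof -
        have "\<bar>x - \<phi> x\<bar> \<le> max 0 (\<bar>x\<bar> - K)" for x unfolding \<phi>_def using K(1) by auto
        from this[of "X n \<omega>"] this[of "Y \<omega>"] show ?thesis by linarith
      qed
    qed (use int \<phi>i in auto)
    also have "\<dots> = (\<integral>\<omega>. \<bar>\<phi> (X n \<omega>) - \<phi> (Y \<omega>)\<bar> \<partial>M) + (\<integral>\<omega>. max 0 (\<bar>X n \<omega>\<bar> - K) \<partial>M) + (\<integral>\<omega>. max 0 (\<bar>Y \<omega>\<bar> - K) \<partial>M)"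
      using int \<phi>i by simp
    also have "\<dots> < e" using n0[OF \<open>n0 \<le> n\<close>] K(2)[OF X(1)[of n]] K(2)[OF X(2)] by linarith
    finally show "norm ((\<integral>\<omega>. \<bar>X n \<omega> - Y \<omega>\<bar> \<partial>M) - 0) < e" by simp
  qed
qed

lemma tendsto_set_integral_L1:
  fixes X :: "nat \<Rightarrow> 'a \<Rightarrow> real"
  assumes "\<And>n. integrable M (X n)" "integrable M Y" "B \<in> sets M"
    and "(\<lambda>n. \<integral>\<omega>. \<bar>X n \<omega> - Y \<omega>\<bar> \<partial>M) \<longlonglongrightarrow> 0"
  shows "(\<lambda>n. \<integral>\<omega>. indicator B \<omega> * X n \<omega> \<partial>M) \<longlonglongrightarrow> (\<integral>\<omega>. indicator B \<omega> * Y \<omega> \<partial>M)"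
proof -
  have i: "integrable M (\<lambda>\<omega>. indicator B \<omega> * X n \<omega>)" "integrable M (\<lambda>\<omega>. indicator B \<omega> * Y \<omega>)" for n
    using integrable_indicator_mult[OF assms(3)] assms(1,2) by blast+
  have "(\<lambda>n. (\<integral>\<omega>. indicator B \<omega> * X n \<omega> \<partial>M) - (\<integral>\<omega>. indicator B \<omega> * Y \<omega> \<partial>M)) \<longlonglongrightarrow> 0"
  proof (rule Lim_null_comparison[OF _ assms(4)], rule always_eventually, rule allI)
    fix n
    have "(\<integral>\<omega>. indicator B \<omega> * X n \<omega> \<partial>M) - (\<integral>\<omega>. indicator B \<omega> * Y \<omega> \<partial>M)
        = (\<integral>\<omega>. indicator B \<omega> * X n \<omega> - indicator B \<omega> * Y \<omega> \<partial>M)" using i by simp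
    also have "norm \<dots> \<le> (\<integral>\<omega>. norm (indicator B \<omega> * X n \<omega> - indicator B \<omega> * Y \<omega>) \<partial>M)"
      by (rule integral_norm_bound)
    also have "\<dots> \<le> (\<integral>\<omega>. \<bar>X n \<omega> - Y \<omega>\<bar> \<partial>M)"
      by (rule integral_mono) (use i assms in \<open>auto simp: indicator_def\<close>)
    finally show "norm ((\<integral>\<omega>. indicator B \<omega> * X n \<omega> \<partial>M) - (\<integral>\<omega>. indicator B \<omega> * Y \<omega> \<partial>M)) \<le> (\<integral>\<omega>. \<bar>X n \<omega> - Y \<omega>\<bar> \<partial>M)" .
  qed
  then show ?thesis by (rule LIM_zero_cancel)
qed

lemma cadlag_path_tendsto_right:
  assumes "cadlag_path T x" "t \<in> {0..T}" "\<And>n. s n \<in> {t..T}" "s \<longlonglongrightarrow> t"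
  shows "(\<lambda>n. x (s n)) \<longlonglongrightarrow> x t"
proof (cases "t = T")
  case True
  then have "s = (\<lambda>n. T)" using assms(3) by (auto simp: fun_eq_iff)
  then show ?thesis using True by simp
next
  case False
  then have "continuous (at t within {t..}) x"
    using assms(1,2) unfolding at_within_Ici_at_right by (auto simp: cadlag_path_def)
  then show ?thesis
    using assms(3,4) unfolding continuous_within_sequentially by (auto simp: o_def)
qed

lemma stopping_time_range: "stopping_time_on P T F \<tau> \<Longrightarrow> \<omega> \<in> space P \<Longrightarrow> \<tau> \<omega> \<in> {0..T}"
  unfolding stopping_time_on_def by blast

text \<open>Completeness enters in the form that every subset of a null set belongs to
  \<open>G\<close>. The algebra is left general because it is taken both from the filtration and to
  be \<open>P\<close> itself.\<close>

lemma measurable_cong_AE_null: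
  fixes X Y :: "'a \<Rightarrow> real"
  assumes sp: "space G = space P" and null: "\<And>N N'. N \<in> null_sets P \<Longrightarrow> N' \<subseteq> N \<Longrightarrow> N' \<in> sets G"
    and X: "X \<in> borel_measurable G" and ae: "AE \<omega> in P. X \<omega> = Y \<omega>"
  shows "Y \<in> borel_measurable G"
proof (rule measurableI)
  obtain N where N: "N \<in> null_sets P" "\<And>\<omega>. \<omega> \<in> space P - N \<Longrightarrow> X \<omega> = Y \<omega>"
    using AE_E3[OF ae] by blast
  fix B :: "real set" assume B: "B \<in> sets borel"
  have "Y -` B \<inter> space G = ((X -` B \<inter> space G) - N) \<union> (Y -` B \<inter> space P \<inter> N)"
    using N(2) sp by auto
  moreover have "Y -` B \<inter> space P \<inter> N \<in> sets G" by (rule null[OF N(1)]) auto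
  ultimately show "Y -` B \<inter> space G \<in> sets G"
    using measurable_sets[OF X B] null[OF N(1) order_refl] by auto
qed auto

section \<open>The usual conditions, and stopping at finitely many times\<close>

locale usual_conditions = prob_space P for P :: "'a measure" +
  fixes T :: real and F :: "real \<Rightarrow> 'a measure"
  assumes T_pos: "0 < T" and filtration: "filtration_on P T F"
    and right_continuous: "right_continuous_filtration T F"
    and complete: "complete_filtration P F"
begin

lemma subalgebra_F: "t \<in> {0..T} \<Longrightarrow> subalgebra P (F t)"
  using filtration by (auto simp: filtration_on_def)

lemma space_F: "t \<in> {0..T} \<Longrightarrow> space (F t) = space P"
  using subalgebra_F by (auto simp: subalgebra_def)

lemma sets_F: "t \<in> {0..T} \<Longrightarrow> sets (F t) \<subseteq> sets P"
  using subalgebra_F by (auto simp: subalgebra_def)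

lemma sets_F_mono: "s \<in> {0..T} \<Longrightarrow> t \<in> {0..T} \<Longrightarrow> s \<le> t \<Longrightarrow> sets (F s) \<subseteq> sets (F t)"
  using filtration by (auto simp: filtration_on_def)

lemma subalgebra_F_mono: "s \<in> {0..T} \<Longrightarrow> t \<in> {0..T} \<Longrightarrow> s \<le> t \<Longrightarrow> subalgebra (F t) (F s)"
  using sets_F_mono space_F by (auto simp: subalgebra_def)

lemma measurable_F_mono:
  "X \<in> borel_measurable (F s) \<Longrightarrow> s \<in> {0..T} \<Longrightarrow> t \<in> {0..T} \<Longrightarrow> s \<le> t \<Longrightarrow> X \<in> borel_measurable (F t)"
  using measurable_from_subalg[OF subalgebra_F_mono] by blast

lemma measurable_F_P: "X \<in> borel_measurable (F s) \<Longrightarrow> s \<in> {0..T} \<Longrightarrow> X \<in> borel_measurable P"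
  using measurable_from_subalg[OF subalgebra_F] by blast

lemma sigma_finite_subalgebra_F:
  assumes "t \<in> {0..T}" shows "sigma_finite_subalgebra P (F t)"
proof -
  interpret finite_measure_subalgebra P "F t"
    by unfold_locales (use subalgebra_F[OF assms] in auto)
  show ?thesis by unfold_locales
qed

lemma null_sets_F:
  assumes "t \<in> {0..T}" "N \<in> null_sets P" shows "N \<in> sets (F t)"
  using complete sets_F_mono[of 0 t] assms T_pos by (auto simp: complete_filtration_def)

lemma null_subset_F:
  assumes "t \<in> {0..T}" "N \<in> null_sets P" "N' \<subseteq> N" shows "N' \<in> sets (F t)"
proof -
  have "complete_measure P" using complete by (simp add: complete_filtration_def)
  then have "N' \<in> sets P" using complete_measure.complete[of P N' N] assms by blast
  then have "N' \<in> null_sets P" using null_sets_subset assms by blast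
  then show ?thesis by (rule null_sets_F[OF assms(1)])
qed

lemma measurable_F_cong_AE:
  fixes X Y :: "'a \<Rightarrow> real"
  assumes t: "t \<in> {0..T}" and "X \<in> borel_measurable (F t)" "AE \<omega> in P. X \<omega> = Y \<omega>"
  shows "Y \<in> borel_measurable (F t)"
  by (rule measurable_cong_AE_null[OF space_F[OF t] null_subset_F[OF t] assms(2,3)])

lemma measurable_F_right_continuous:
  fixes X :: "'a \<Rightarrow> real"
  assumes t: "t \<in> {0..<T}" and X: "\<And>s. s \<in> {t<..T} \<Longrightarrow> X \<in> borel_measurable (F s)"
  shows "X \<in> borel_measurable (F t)"
proof (rule measurableI)
  fix B :: "real set" assume B: "B \<in> sets borel"
  have "X -` B \<inter> space P \<in> sets (F s)" if "s \<in> {t<..T}" for s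
    using measurable_sets[OF X[OF that] B] space_F[of s] that t by auto
  then show "X -` B \<inter> space (F t) \<in> sets (F t)"
    using right_continuous t space_F[of t] by (auto simp: right_continuous_filtration_def)
qed auto

end

text \<open>Optional stopping for a time with finitely many values: on the event that
  \<open>J\<close> equals \<open>j\<close>, which lies in \<open>F (t j)\<close>, only
  \<open>Y j\<close> and \<open>Z j\<close> matter. The hypothesis on integrals says that these two
  have the same conditional expectation given \<open>F (t j)\<close>.\<close>

lemma (in usual_conditions) stopped_integral_eq:
  fixes Y Z :: "nat \<Rightarrow> 'a \<Rightarrow> real"
  assumes t: "\<And>j. t j \<in> {0..T}" and t_mono: "mono t"
    and J: "\<And>j. {\<omega>\<in>space P. J \<omega> \<le> j} \<in> sets (F (t j))" and N: "\<And>\<omega>. \<omega> \<in> space P \<Longrightarrow> J \<omega> \<le> N"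
    and int: "\<And>j. integrable P (Y j)" "\<And>j. integrable P (Z j)"
    and eq: "\<And>j B. j \<le> N \<Longrightarrow> B \<in> sets (F (t j)) \<Longrightarrow> (\<integral>\<omega>. indicator B \<omega> * Y j \<omega> \<partial>P) = (\<integral>\<omega>. indicator B \<omega> * Z j \<omega> \<partial>P)"
  shows "integrable P (\<lambda>\<omega>. Y (J \<omega>) \<omega>)" "(\<integral>\<omega>. Y (J \<omega>) \<omega> \<partial>P) = (\<integral>\<omega>. Z (J \<omega>) \<omega> \<partial>P)"
proof -
  \<comment> \<open>Built from the events \<open>J \<omega> \<le> i\<close>, the ones that are
    assumed to be measurable; the earlier ones lie in \<open>F (t j)\<close> by monotonicity of the
    filtration.\<close>
  define B where "B j = {\<omega>\<in>space P. J \<omega> \<le> j} - (\<Union>i<j. {\<omega>\<in>space P. J \<omega> \<le> i})" for j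
  have B_eq: "\<omega> \<in> B j \<longleftrightarrow> \<omega> \<in> space P \<and> J \<omega> = j" for \<omega> j
  proof -
    have "\<omega> \<in> B j \<longleftrightarrow> \<omega> \<in> space P \<and> J \<omega> \<le> j \<and> \<not> J \<omega> < j" unfolding B_def by auto
    then show ?thesis by auto
  qed
  have BF: "B j \<in> sets (F (t j))" for j
    unfolding B_def using J sets_F_mono[OF t t monoD[OF t_mono]]
    by (intro sets.Diff sets.finite_UN) (auto intro: less_imp_le)
  have BP: "B j \<in> sets P" for j using BF sets_F t by blast
  have i: "integrable P (\<lambda>\<omega>. indicator (B j) \<omega> * U \<omega>)" if "integrable P U" for j and U :: "'a \<Rightarrow> real"
    by (rule integrable_indicator_mult[OF BP that])
  have dec: "U (J \<omega>) \<omega> = (\<Sum>j\<le>N. indicator (B j) \<omega> * U j \<omega>)" if "\<omega> \<in> space P" for U :: "nat \<Rightarrow> 'a \<Rightarrow> real" and \<omega>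
  proof -
    have "(\<Sum>j\<le>N. indicator (B j) \<omega> * U j \<omega>) = (\<Sum>j\<le>N. if j = J \<omega> then U j \<omega> else 0)"
      by (rule sum.cong) (use that in \<open>auto simp: B_eq indicator_def\<close>)
    also have "\<dots> = U (J \<omega>) \<omega>" using N[OF that] by simp
    finally show ?thesis by simp
  qed
  show "integrable P (\<lambda>\<omega>. Y (J \<omega>) \<omega>)"
  proof (rule iffD2[OF Bochner_Integration.integrable_cong[OF refl dec]])
    show "integrable P (\<lambda>\<omega>. \<Sum>j\<le>N. indicator (B j) \<omega> * Y j \<omega>)"
      by (intro Bochner_Integration.integrable_sum i int)
  qed
  have I: "(\<integral>\<omega>. U (J \<omega>) \<omega> \<partial>P) = (\<Sum>j\<le>N. \<integral>\<omega>. indicator (B j) \<omega> * U j \<omega> \<partial>P)" if U: "\<And>j. integrable P (U j)" for U :: "nat \<Rightarrow> 'a \<Rightarrow> real"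
  proof -
    have "(\<integral>\<omega>. U (J \<omega>) \<omega> \<partial>P) = (\<integral>\<omega>. (\<Sum>j\<le>N. indicator (B j) \<omega> * U j \<omega>) \<partial>P)"
      by (rule Bochner_Integration.integral_cong[OF refl dec[of _ U]])
    also have "\<dots> = (\<Sum>j\<le>N. \<integral>\<omega>. indicator (B j) \<omega> * U j \<omega> \<partial>P)"
      by (intro Bochner_Integration.integral_sum i U)
    finally show ?thesis .
  qed
  show "(\<integral>\<omega>. Y (J \<omega>) \<omega> \<partial>P) = (\<integral>\<omega>. Z (J \<omega>) \<omega> \<partial>P)"
    unfolding I[of Y, OF int(1)] I[of Z, OF int(2)] using eq[OF _ BF] by simp
qed

section \<open>Discrete compensators of a class D submartingale\<close>

locale class_D_submartingale = usual_conditions P T F for P :: "'a measure" and T F +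
  fixes S :: "real \<Rightarrow> 'a \<Rightarrow> real"
  assumes submartingale: "submartingale P T F S"
    and cadlag: "cadlag_process P T S" and class_D: "class_D P T F S"
begin

lemma S_measurable_F: "t \<in> {0..T} \<Longrightarrow> S t \<in> borel_measurable (F t)"
  using submartingale by (auto simp: submartingale_def adapted_process_def)

lemma S_integrable: "t \<in> {0..T} \<Longrightarrow> integrable P (S t)"
  using submartingale by (auto simp: submartingale_def)

abbreviation "stopped \<equiv> {(\<lambda>\<omega>. S (\<tau> \<omega>) \<omega>) | \<tau>. stopping_time_on P T F \<tau>}"

lemma stopped_ui: "uniformly_integrable P stopped"
  using class_D by (simp add: class_D_def)

lemma stopped_integrable: "stopping_time_on P T F \<tau> \<Longrightarrow> integrable P (\<lambda>\<omega>. S (\<tau> \<omega>) \<omega>)"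
  using stopped_ui by (auto simp: uniformly_integrable_def)

text \<open>Class D gives uniform integrability, and right-continuity of almost every path gives
  pointwise convergence, so Vitali's theorem applies. The approximation has to come from the right:
  from the left, left limits of \<open>S\<close> would appear.\<close>

lemma stopped_tendsto_L1:
  assumes \<tau>: "stopping_time_on P T F \<tau>" "\<And>n. stopping_time_on P T F (\<sigma> n)"
    and ge: "\<And>n \<omega>. \<omega> \<in> space P \<Longrightarrow> \<tau> \<omega> \<le> \<sigma> n \<omega>"
    and lim: "\<And>\<omega>. \<omega> \<in> space P \<Longrightarrow> (\<lambda>n. \<sigma> n \<omega>) \<longlonglongrightarrow> \<tau> \<omega>"
  shows "(\<lambda>n. \<integral>\<omega>. \<bar>S (\<sigma> n \<omega>) \<omega> - S (\<tau> \<omega>) \<omega>\<bar> \<partial>P) \<longlonglongrightarrow> 0"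
proof (rule vitali_convergence[OF stopped_ui])
  show "(\<lambda>\<omega>. S (\<sigma> n \<omega>) \<omega>) \<in> stopped" for n using \<tau>(2)[of n] by blast
  show "(\<lambda>\<omega>. S (\<tau> \<omega>) \<omega>) \<in> stopped" using \<tau>(1) by blast
  show "AE \<omega> in P. (\<lambda>n. S (\<sigma> n \<omega>) \<omega>) \<longlonglongrightarrow> S (\<tau> \<omega>) \<omega>"
    using cadlag[unfolded cadlag_process_def] AE_space
  proof eventually_elim
    case (elim \<omega>)
    have r: "\<tau> \<omega> \<in> {0..T}" "\<And>n. \<sigma> n \<omega> \<in> {0..T}"
      by (rule stopping_time_range[OF \<tau>(1) elim(2)], rule stopping_time_range[OF \<tau>(2) elim(2)])
    show ?case
    proof (rule cadlag_path_tendsto_right[OF elim(1) r(1) _ lim[OF elim(2)]])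
      show "\<sigma> n \<omega> \<in> {\<tau> \<omega>..T}" for n using r(2)[of n] ge[OF elim(2), of n] by simp
    qed
  qed
qed

lemma stopping_time_const: "t \<in> {0..T} \<Longrightarrow> stopping_time_on P T F (\<lambda>_. t)"
  by (auto simp: stopping_time_on_def)

text \<open>The submartingale property makes the conditional expectation nonnegative only almost surely;
  \<open>max 0\<close> makes the compensator monotone in every scenario.\<close>

definition incr :: "(nat \<Rightarrow> real) \<Rightarrow> nat \<Rightarrow> 'a \<Rightarrow> real" where
  "incr t j \<omega> = max 0 (real_cond_exp P (F (t j)) (\<lambda>\<omega>. S (t (Suc j)) \<omega> - S (t j) \<omega>) \<omega>)"

definition comp :: "(nat \<Rightarrow> real) \<Rightarrow> nat \<Rightarrow> 'a \<Rightarrow> real" where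
  "comp t j \<omega> = (\<Sum>i<j. incr t i \<omega>)"

context
  fixes t :: "nat \<Rightarrow> real"
  assumes t: "\<And>j. t j \<in> {0..T}" and t_mono: "mono t"
begin

lemma incr_nonneg: "0 \<le> incr t j \<omega>" by (simp add: incr_def)

lemma incr_measurable: "incr t j \<in> borel_measurable (F (t j))"
  unfolding incr_def by measurable

lemma incr_AE_eq: "AE \<omega> in P. incr t j \<omega> = real_cond_exp P (F (t j)) (\<lambda>\<omega>. S (t (Suc j)) \<omega> - S (t j) \<omega>) \<omega>"
proof -
  interpret sigma_finite_subalgebra P "F (t j)" by (rule sigma_finite_subalgebra_F[OF t])
  have "AE \<omega> in P. real_cond_exp P (F (t j)) (\<lambda>\<omega>. S (t (Suc j)) \<omega> - S (t j) \<omega>) \<omega>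
      = real_cond_exp P (F (t j)) (S (t (Suc j))) \<omega> - real_cond_exp P (F (t j)) (S (t j)) \<omega>"
    by (rule real_cond_exp_diff) (use S_integrable t in auto)
  moreover have "AE \<omega> in P. real_cond_exp P (F (t j)) (S (t j)) \<omega> = S (t j) \<omega>"
    by (rule real_cond_exp_F_meas) (use S_integrable S_measurable_F t in auto)
  moreover have "AE \<omega> in P. S (t j) \<omega> \<le> real_cond_exp P (F (t j)) (S (t (Suc j))) \<omega>"
    using submartingale t[of j] t[of "Suc j"] monoD[OF t_mono, of j "Suc j"] by (simp add: submartingale_def)
  ultimately show ?thesis by eventually_elim (simp add: incr_def)
qed

lemma incr_integrable: "integrable P (incr t j)"
proof -
  interpret sigma_finite_subalgebra P "F (t j)" by (rule sigma_finite_subalgebra_F[OF t])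
  have "integrable P (real_cond_exp P (F (t j)) (\<lambda>\<omega>. S (t (Suc j)) \<omega> - S (t j) \<omega>))"
    by (rule real_cond_exp_int(1)) (use S_integrable t in auto)
  moreover have "AE \<omega> in P. real_cond_exp P (F (t j)) (\<lambda>\<omega>. S (t (Suc j)) \<omega> - S (t j) \<omega>) \<omega> = incr t j \<omega>"
    using incr_AE_eq[of j] by eventually_elim simp
  ultimately show ?thesis
    using integrable_cong_AE_imp measurable_F_P[OF incr_measurable t] by blast
qed

lemma incr_integral:
  assumes "B \<in> sets (F (t j))"
  shows "(\<integral>\<omega>. indicator B \<omega> * incr t j \<omega> \<partial>P) = (\<integral>\<omega>. indicator B \<omega> * (S (t (Suc j)) \<omega> - S (t j) \<omega>) \<partial>P)"
proof -
  interpret sigma_finite_subalgebra P "F (t j)" by (rule sigma_finite_subalgebra_F[OF t])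
  have B[measurable]: "B \<in> sets P" using assms sets_F t by blast
  have [measurable]: "incr t j \<in> borel_measurable P" by (rule measurable_F_P[OF incr_measurable t])
  have "(\<integral>\<omega>. indicator B \<omega> * incr t j \<omega> \<partial>P)
      = (\<integral>\<omega>. indicator B \<omega> * real_cond_exp P (F (t j)) (\<lambda>\<omega>. S (t (Suc j)) \<omega> - S (t j) \<omega>) \<omega> \<partial>P)"
    by (rule integral_cong_AE) (use incr_AE_eq[of j] in auto)
  also have "\<dots> = (\<integral>\<omega>. indicator B \<omega> * (S (t (Suc j)) \<omega> - S (t j) \<omega>) \<partial>P)"
    using real_cond_exp_intA[OF Bochner_Integration.integrable_diff[OF S_integrable S_integrable, OF t t] assms, of "Suc j" j]
    by (simp add: set_lebesgue_integral_def)
  finally show ?thesis .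
qed

lemma comp_mono: "i \<le> j \<Longrightarrow> comp t i \<omega> \<le> comp t j \<omega>"
  unfolding comp_def by (intro sum_mono2) (auto simp: incr_nonneg)

lemma comp_nonneg: "0 \<le> comp t j \<omega>"
  unfolding comp_def by (intro sum_nonneg) (auto simp: incr_nonneg)

lemma comp_integrable: "integrable P (comp t j)"
  unfolding comp_def using incr_integrable by auto

text \<open>Predictability in discrete time: the compensator at the next index is known one step
  earlier. It allows stopping before a level is exceeded, and it makes the left-continuous extension
  \<open>approx\<close> adapted.\<close>

lemma comp_Suc_measurable: "comp t (Suc j) \<in> borel_measurable (F (t j))"
  unfolding comp_def
  by (intro borel_measurable_sum measurable_F_mono[OF incr_measurable t t] monoD[OF t_mono]) auto

text \<open>The integrated form of the statement that \<open>S\<close> minus its compensator is a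
  martingale along the grid. Increments are added one at a time, \<open>B\<close> being known at
  every later grid time.\<close>

lemma comp_integral:
  assumes "B \<in> sets (F (t j))" "j \<le> N"
  shows "(\<integral>\<omega>. indicator B \<omega> * (comp t N \<omega> - comp t j \<omega>) \<partial>P) = (\<integral>\<omega>. indicator B \<omega> * (S (t N) \<omega> - S (t j) \<omega>) \<partial>P)"
  using \<open>j \<le> N\<close>
proof (induction N rule: dec_induct)
  case base show ?case by simp
next
  case (step n)
  have B: "B \<in> sets P" "B \<in> sets (F (t n))"
    using assms(1) sets_F[OF t] sets_F_mono[OF t t, of j n] monoD[OF t_mono] step by auto
  have i: "integrable P (\<lambda>\<omega>. indicator B \<omega> * X \<omega>)" if "integrable P X" for X :: "'a \<Rightarrow> real"
    by (rule integrable_indicator_mult[OF B(1) that])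
  have "(\<integral>\<omega>. indicator B \<omega> * (comp t (Suc n) \<omega> - comp t j \<omega>) \<partial>P)
      = (\<integral>\<omega>. indicator B \<omega> * (comp t n \<omega> - comp t j \<omega>) + indicator B \<omega> * incr t n \<omega> \<partial>P)"
    by (simp add: comp_def algebra_simps)
  also have "\<dots> = (\<integral>\<omega>. indicator B \<omega> * (S (t n) \<omega> - S (t j) \<omega>) \<partial>P) + (\<integral>\<omega>. indicator B \<omega> * (S (t (Suc n)) \<omega> - S (t n) \<omega>) \<partial>P)"
    using step.IH incr_integral[OF B(2)] by (simp add: i comp_integrable incr_integrable)
  also have "\<dots> = (\<integral>\<omega>. indicator B \<omega> * (S (t n) \<omega> - S (t j) \<omega>) + indicator B \<omega> * (S (t (Suc n)) \<omega> - S (t n) \<omega>) \<partial>P)"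
    by (intro Bochner_Integration.integral_add[symmetric] i Bochner_Integration.integrable_diff S_integrable t)
  also have "\<dots> = (\<integral>\<omega>. indicator B \<omega> * (S (t (Suc n)) \<omega> - S (t j) \<omega>) \<partial>P)"
    by (simp add: algebra_simps)
  finally show ?case .
qed

text \<open>A grid may become constant, so infinitely many indices can satisfy
  \<open>t j \<le> s\<close>. The event is therefore a countable union of events on which
  \<open>J\<close> takes a single value.\<close>

lemma stopping_time_grid:
  assumes "\<And>j. {\<omega>\<in>space P. J \<omega> \<le> j} \<in> sets (F (t j))"
  shows "stopping_time_on P T F (\<lambda>\<omega>. t (J \<omega>))"
  unfolding stopping_time_on_def
proof (intro conjI ballI)
  show "(\<lambda>\<omega>. t (J \<omega>)) \<in> space P \<rightarrow> {0..T}" using t by auto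
  fix s assume s: "s \<in> {0..T}"
  have eq: "{\<omega>\<in>space P. J \<omega> = j} \<in> sets (F s)" if "t j \<le> s" for j
  proof -
    have "{\<omega>\<in>space P. J \<omega> \<le> i} \<in> sets (F s)" if "i \<le> j" for i
      using assms[of i] sets_F_mono[OF t s, of i] monoD[OF t_mono that] \<open>t j \<le> s\<close> by auto
    note * = this
    have "{\<omega>\<in>space P. J \<omega> = j} = {\<omega>\<in>space P. J \<omega> \<le> j} - (\<Union>i<j. {\<omega>\<in>space P. J \<omega> \<le> i})"
    proof (intro equalityI subsetI)
      fix \<omega> assume "\<omega> \<in> {\<omega>\<in>space P. J \<omega> \<le> j} - (\<Union>i<j. {\<omega>\<in>space P. J \<omega> \<le> i})"
      then have "\<omega> \<in> space P" "J \<omega> \<le> j" "\<not> J \<omega> < j" by auto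
      then show "\<omega> \<in> {\<omega>\<in>space P. J \<omega> = j}" by simp
    qed auto
    also have "\<dots> \<in> sets (F s)" using * by (intro sets.Diff sets.finite_UN) auto
    finally show ?thesis .
  qed
  have "{\<omega>\<in>space (F s). t (J \<omega>) \<le> s} = (\<Union>j\<in>{j. t j \<le> s}. {\<omega>\<in>space P. J \<omega> = j})"
    using space_F[OF s] by auto
  also have "\<dots> \<in> sets (F s)" using eq by (intro sets.countable_UN') auto
  finally show "Measurable.pred (F s) (\<lambda>\<omega>. t (J \<omega>) \<le> s)" by (simp add: pred_def)
qed

text \<open>Given \<open>F (t j)\<close>, the variable
  \<open>comp t N \<omega> - S (t N) \<omega> + S (t j) \<omega>\<close> has conditional expectation
  \<open>comp t j\<close>. Replacing the compensator by it under the stopped integral leaves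
  \<open>S\<close> at the stopping time and constants.\<close>

lemma comp_stopped_integral:
  assumes J: "\<And>j. {\<omega>\<in>space P. J \<omega> \<le> j} \<in> sets (F (t j))" and N: "\<And>\<omega>. \<omega> \<in> space P \<Longrightarrow> J \<omega> \<le> N"
  shows "integrable P (\<lambda>\<omega>. comp t (J \<omega>) \<omega>)"
    "(\<integral>\<omega>. comp t (J \<omega>) \<omega> \<partial>P) = (\<integral>\<omega>. S (t (J \<omega>)) \<omega> \<partial>P) - (\<integral>\<omega>. S (t 0) \<omega> \<partial>P)"
proof -
  have eq: "(\<integral>\<omega>. indicator B \<omega> * comp t j \<omega> \<partial>P) = (\<integral>\<omega>. indicator B \<omega> * (comp t N \<omega> - S (t N) \<omega> + S (t j) \<omega>) \<partial>P)"
    if "j \<le> N" and B: "B \<in> sets (F (t j))" for j B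
  proof -
    have BP: "B \<in> sets P" using B sets_F[OF t] by blast
    have i: "integrable P (\<lambda>\<omega>. indicator B \<omega> * comp t j \<omega>)"
      "integrable P (\<lambda>\<omega>. indicator B \<omega> * (comp t N \<omega> - comp t j \<omega>))"
      "integrable P (\<lambda>\<omega>. indicator B \<omega> * (S (t N) \<omega> - S (t j) \<omega>))"
      by (intro integrable_indicator_mult[OF BP] Bochner_Integration.integrable_diff comp_integrable S_integrable t)+
    have "(\<integral>\<omega>. indicator B \<omega> * (comp t N \<omega> - S (t N) \<omega> + S (t j) \<omega>) \<partial>P)
        = (\<integral>\<omega>. indicator B \<omega> * comp t j \<omega> + indicator B \<omega> * (comp t N \<omega> - comp t j \<omega>)
            - indicator B \<omega> * (S (t N) \<omega> - S (t j) \<omega>) \<partial>P)"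
      by (simp add: algebra_simps)
    then show ?thesis using i comp_integral[OF B \<open>j \<le> N\<close>] by simp
  qed
  have Zi: "integrable P (\<lambda>\<omega>. comp t N \<omega> - S (t N) \<omega> + S (t j) \<omega>)" for j
    by (intro Bochner_Integration.integrable_add Bochner_Integration.integrable_diff comp_integrable S_integrable t)
  note * = stopped_integral_eq[where Y="comp t" and Z="\<lambda>j \<omega>. comp t N \<omega> - S (t N) \<omega> + S (t j) \<omega>",
      OF t t_mono J N comp_integrable Zi eq]
  show "integrable P (\<lambda>\<omega>. comp t (J \<omega>) \<omega>)" by (rule *(1))
  have ind: "(\<integral>\<omega>. indicator (space P) \<omega> * f \<omega> \<partial>P) = (\<integral>\<omega>. f \<omega> \<partial>P)" for f :: "'a \<Rightarrow> real"
    by (rule Bochner_Integration.integral_cong) auto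
  have "space P \<in> sets (F (t 0))" using sets.top[of "F (t 0)"] space_F[OF t] by simp
  from comp_integral[OF this, of N]
  have N0: "(\<integral>\<omega>. comp t N \<omega> \<partial>P) = (\<integral>\<omega>. S (t N) \<omega> \<partial>P) - (\<integral>\<omega>. S (t 0) \<omega> \<partial>P)"
    using Bochner_Integration.integral_diff[OF S_integrable[OF t] S_integrable[OF t], of N 0]
    unfolding ind by (simp add: comp_def)
  have "(\<integral>\<omega>. comp t (J \<omega>) \<omega> \<partial>P) = (\<integral>\<omega>. comp t N \<omega> - S (t N) \<omega> + S (t (J \<omega>)) \<omega> \<partial>P)" by (rule *(2))
  also have "\<dots> = (\<integral>\<omega>. S (t (J \<omega>)) \<omega> \<partial>P) - (\<integral>\<omega>. S (t 0) \<omega> \<partial>P)"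
    using stopped_integrable[OF stopping_time_grid[OF J]] comp_integrable[of N] S_integrable[OF t, of N]
    by (simp add: N0)
  finally show "(\<integral>\<omega>. comp t (J \<omega>) \<omega> \<partial>P) = (\<integral>\<omega>. S (t (J \<omega>)) \<omega> \<partial>P) - (\<integral>\<omega>. S (t 0) \<omega> \<partial>P)" .
qed

end

text \<open>Stopping at the last grid time \<open>\<tau>\<close> before the predictable compensator exceeds \<open>c\<close> bounds the
  excess over \<open>c\<close> by \<open>E(S\<^sub>T - S\<^sub>\<tau>)\<close>, an integral over an event of probability \<open>O(1/c)\<close>.\<close>

lemma comp_uniformly_integrable:
  assumes "0 < e"
  shows "\<exists>c\<ge>0. \<forall>t N. (\<forall>j. t j \<in> {0..T}) \<longrightarrow> mono t \<longrightarrow> t 0 = 0 \<longrightarrow> t N = T \<longrightarrow>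
           (\<integral>\<omega>. max 0 (comp t N \<omega> - c) \<partial>P) \<le> e"
proof -
  obtain K where K: "0 \<le> K" "\<And>X. X \<in> stopped \<Longrightarrow> (\<integral>\<omega>. max 0 (\<bar>X \<omega>\<bar> - K) \<partial>P) \<le> e/4"
    by (rule uniformly_integrable_bound[OF stopped_ui, of "e/4"]) (use assms in auto)
  define d where "d = (\<integral>\<omega>. S T \<omega> \<partial>P) - (\<integral>\<omega>. S 0 \<omega> \<partial>P)"
  \<comment> \<open>Chosen so that \<open>K * (d / c) \<le> e/4\<close>, where \<open>d / c\<close>
    will bound the probability of exceeding \<open>c\<close>. The summand \<open>1\<close> keeps
    \<open>c\<close> positive when \<open>K\<close> or \<open>d\<close> vanishes.\<close>
  define c where "c = 4 * K * \<bar>d\<bar> / e + 1"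
  have "0 \<le> 4 * K * \<bar>d\<bar> / e" using K(1) assms by simp
  then have c: "0 < c" unfolding c_def by linarith
  have "e * (4 * K * \<bar>d\<bar> / e) = 4 * K * \<bar>d\<bar>" using assms by simp
  then have c2: "4 * K * \<bar>d\<bar> \<le> e * c" unfolding c_def distrib_left using assms by linarith
  have "(\<integral>\<omega>. max 0 (comp t N \<omega> - c) \<partial>P) \<le> e"
    if t: "\<And>j. t j \<in> {0..T}" and m: "mono t" and t0: "t 0 = 0" and tN: "t N = T" for t N
  proof -
    \<comment> \<open>The successor matters: \<open>comp t (Suc j)\<close> is already known at
      \<open>t j\<close>, so the rule stops while the compensator is still at most \<open>c\<close>.
      The alternative \<open>j = N\<close> is the default when the level is never exceeded.\<close>
    define J where "J \<omega> = (LEAST j. j = N \<or> c < comp t (Suc j) \<omega>)" for \<omega>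
    have JN: "J \<omega> \<le> N" for \<omega> unfolding J_def by (rule Least_le) simp
    have J_le: "J \<omega> \<le> j \<longleftrightarrow> (\<exists>i\<le>j. i = N \<or> c < comp t (Suc i) \<omega>)" for j \<omega>
    proof
      assume "J \<omega> \<le> j"
      moreover have "J \<omega> = N \<or> c < comp t (Suc (J \<omega>)) \<omega>"
        unfolding J_def by (rule LeastI_ex) auto
      ultimately show "\<exists>i\<le>j. i = N \<or> c < comp t (Suc i) \<omega>" by blast
    next
      assume "\<exists>i\<le>j. i = N \<or> c < comp t (Suc i) \<omega>"
      then obtain i where "i \<le> j" "i = N \<or> c < comp t (Suc i) \<omega>" by blast
      moreover have "J \<omega> \<le> i" unfolding J_def by (rule Least_le) fact
      ultimately show "J \<omega> \<le> j" by simp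
    qed
    have J: "{\<omega>\<in>space P. J \<omega> \<le> j} \<in> sets (F (t j))" for j
    proof -
      have "comp t (Suc i) \<in> borel_measurable (F (t j))" if "i \<le> j" for i
        by (rule measurable_F_mono[OF comp_Suc_measurable[OF t m] t t monoD[OF m that]])
      note cm = this
      have 1: "{\<omega>\<in>space P. c < comp t (Suc i) \<omega>} \<in> sets (F (t j))" if "i \<le> j" for i
        unfolding space_F[OF t, of j, symmetric] by (intro borel_measurable_less borel_measurable_const cm that)
      have 2: "{\<omega>\<in>space P. i = N \<or> c < comp t (Suc i) \<omega>} \<in> sets (F (t j))" if "i \<le> j" for i
      proof (cases "i = N")
        case True
        then have "{\<omega>\<in>space P. i = N \<or> c < comp t (Suc i) \<omega>} = space (F (t j))"
          unfolding space_F[OF t, of j] by blast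
        then show ?thesis by (simp only: sets.top)
      next
        case False
        then show ?thesis using 1[OF that] by (simp only: simp_thms)
      qed
      have 3: "{\<omega>\<in>space P. J \<omega> \<le> j} = (\<Union>i\<in>{..j}. {\<omega>\<in>space P. i = N \<or> c < comp t (Suc i) \<omega>})"
        unfolding J_le by blast
      show ?thesis
        unfolding 3 by (rule sets.finite_UN) (use 2 in blast)+
    qed
    have st: "stopping_time_on P T F (\<lambda>\<omega>. t (J \<omega>))" by (rule stopping_time_grid[OF t m J])
    \<comment> \<open>Off \<open>B\<close> the grid time is \<open>t N = T\<close>, so
      \<open>S T \<omega> - S (t (J \<omega>)) \<omega>\<close> vanishes there; on \<open>B\<close>
      Markov's inequality applies, because the final compensator is above \<open>c\<close>.\<close>
    define B where "B = {\<omega>\<in>space P. J \<omega> < N}"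
    have "B = space P - (space P - (\<Union>j<N. {\<omega>\<in>space P. J \<omega> \<le> j}))"
      unfolding B_def by auto
    moreover have "\<dots> \<in> sets P" using J sets_F[OF t] by (intro sets.Diff sets.finite_UN) auto
    ultimately have B[measurable]: "B \<in> sets P" by simp
    have ci: "integrable P (comp t N)" by (rule comp_integrable[OF t m])
    have [measurable]: "comp t N \<in> borel_measurable P" using ci by auto
    have "{\<omega>\<in>space P. N \<le> j} \<in> sets (F (t j))" for j
      unfolding space_F[OF t, of j, symmetric] by (rule sets.sets_Collect_const)
    from comp_stopped_integral(2)[OF t m this, of N]
    have cN: "(\<integral>\<omega>. comp t N \<omega> \<partial>P) = d"
      by (simp add: t0 tN d_def)
    have cJ: "integrable P (\<lambda>\<omega>. comp t (J \<omega>) \<omega>)" "(\<integral>\<omega>. comp t (J \<omega>) \<omega> \<partial>P) = (\<integral>\<omega>. S (t (J \<omega>)) \<omega> \<partial>P) - (\<integral>\<omega>. S (t 0) \<omega> \<partial>P)"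
      by (rule comp_stopped_integral[OF t m J JN])+
    have Jc: "comp t (J \<omega>) \<omega> \<le> c" for \<omega>
    proof (cases "J \<omega>")
      case 0 then show ?thesis using c by (simp add: comp_def)
    next
      case (Suc i)
      then have "\<not> J \<omega> \<le> i" by simp
      then show ?thesis using Suc unfolding J_le by (metis le_refl not_le)
    qed
    have "prob B \<le> prob {\<omega>\<in>space P. c \<le> comp t N \<omega>}"
    proof (rule finite_measure_mono)
      show "B \<subseteq> {\<omega> \<in> space P. c \<le> comp t N \<omega>}"
      proof
        fix \<omega> assume "\<omega> \<in> B"
        then have *: "J \<omega> < N" "\<omega> \<in> space P" by (auto simp: B_def)
        have "J \<omega> = N \<or> c < comp t (Suc (J \<omega>)) \<omega>"
          unfolding J_def by (rule LeastI_ex) auto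
        then show "\<omega> \<in> {\<omega> \<in> space P. c \<le> comp t N \<omega>}"
          using * comp_mono[OF t m, of "Suc (J \<omega>)" N \<omega>] by auto
      qed
    qed measurable
    also have "\<dots> \<le> d / c"
      using integral_Markov_inequality_measure[OF ci, of "{}" c] comp_nonneg[OF t m] c cN
      by simp
    finally have pB: "prob B \<le> d / c" .
    have small: "(\<integral>\<omega>. indicator B \<omega> * \<bar>X \<omega>\<bar> \<partial>P) \<le> e/2" if X: "X \<in> stopped" for X
    proof -
      have Xi: "integrable P X" using X stopped_ui unfolding uniformly_integrable_def by blast
      have "(\<integral>\<omega>. indicator B \<omega> * \<bar>X \<omega>\<bar> \<partial>P) \<le> (\<integral>\<omega>. K * indicator B \<omega> + max 0 (\<bar>X \<omega>\<bar> - K) \<partial>P)"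
      proof (rule integral_mono)
        show "integrable P (\<lambda>\<omega>. indicator B \<omega> * \<bar>X \<omega>\<bar>)"
          by (rule integrable_indicator_mult[OF B integrable_abs[OF Xi]])
        show "integrable P (\<lambda>\<omega>. K * indicator B \<omega> + max 0 (\<bar>X \<omega>\<bar> - K))" using Xi by (simp add: emeasure_eq_measure)
      qed (auto simp: indicator_def K(1))
      also have "\<dots> = K * prob B + (\<integral>\<omega>. max 0 (\<bar>X \<omega>\<bar> - K) \<partial>P)" using Xi by (simp add: emeasure_eq_measure)
      also have "\<dots> \<le> K * (d / c) + e/4" by (intro add_mono mult_left_mono pB K)  (use X in auto)
      also have "K * (d / c) \<le> e/4"
      proof -
        have "4 * K * d \<le> e * c" using c2 K(1) by (smt (verit, best) mult_left_mono)
        then show ?thesis using c by (simp add: field_simps)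
      qed
      finally show ?thesis by simp
    qed
    have Si: "integrable P (S T)" "integrable P (\<lambda>\<omega>. S (t (J \<omega>)) \<omega>)"
      using stopped_integrable[OF st] S_integrable T_pos by auto
    have mi: "integrable P (\<lambda>\<omega>. indicator B \<omega> * X \<omega>)" if "integrable P X" for X :: "'a \<Rightarrow> real"
      by (rule integrable_indicator_mult[OF B that])
    have "(\<integral>\<omega>. max 0 (comp t N \<omega> - c) \<partial>P) \<le> (\<integral>\<omega>. comp t N \<omega> - comp t (J \<omega>) \<omega> \<partial>P)"
    proof (rule integral_mono)
      show "max 0 (comp t N \<omega> - c) \<le> comp t N \<omega> - comp t (J \<omega>) \<omega>" for \<omega>
        using Jc[of \<omega>] comp_mono[OF t m JN, of \<omega> \<omega>] by auto
    qed (use ci cJ(1) in auto)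
    also have "\<dots> = (\<integral>\<omega>. S T \<omega> - S (t (J \<omega>)) \<omega> \<partial>P)"
      using ci cJ cN t0 Si by (simp add: d_def)
    also have "\<dots> \<le> (\<integral>\<omega>. indicator B \<omega> * \<bar>S T \<omega>\<bar> + indicator B \<omega> * \<bar>S (t (J \<omega>)) \<omega>\<bar> \<partial>P)"
    proof (rule integral_mono)
      fix \<omega> assume \<omega>: "\<omega> \<in> space P"
      show "S T \<omega> - S (t (J \<omega>)) \<omega> \<le> indicator B \<omega> * \<bar>S T \<omega>\<bar> + indicator B \<omega> * \<bar>S (t (J \<omega>)) \<omega>\<bar>"
      proof (cases "J \<omega> < N")
        case True then show ?thesis using \<omega> by (simp add: B_def)
      next
        case False then show ?thesis using JN[of \<omega>] tN by (simp add: B_def)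
      qed
    qed (use Si mi in auto)
    also have "\<dots> = (\<integral>\<omega>. indicator B \<omega> * \<bar>S T \<omega>\<bar> \<partial>P) + (\<integral>\<omega>. indicator B \<omega> * \<bar>S (t (J \<omega>)) \<omega>\<bar> \<partial>P)"
      using Si mi by simp
    also have "\<dots> \<le> e/2 + e/2"
      using st stopping_time_const[of T] T_pos by (intro add_mono small) auto
    finally show ?thesis by simp
  qed
  then show ?thesis using c by (intro exI[of _ c]) auto
qed

end

section \<open>Dyadic grids and monotone limits\<close>

context usual_conditions
begin

text \<open>The minimum turns the finite dyadic grid into a sequence on all naturals that stays at
  \<open>T\<close>, the shape that \<open>comp\<close> and its lemmas ask for.\<close>

definition grid :: "nat \<Rightarrow> nat \<Rightarrow> real" where
  "grid k j = T * min 1 (real j / 2 ^ k)"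

text \<open>For \<open>0 < t \<le> T\<close>, \<open>t\<close> lies in the grid cell that is open at \<open>grid k (ix k t - 1)\<close> and closed
  at \<open>grid k (ix k t)\<close>.\<close>

definition ix :: "nat \<Rightarrow> real \<Rightarrow> nat" where
  "ix k t = nat \<lceil>t * 2 ^ k / T\<rceil>"

text \<open>A dyadic time strictly after \<open>t\<close> when \<open>t < T\<close>: floor and
  successor also move the grid points themselves, whereas the ceiling in \<open>ix\<close> leaves
  them fixed. Strictness is what a right limit along dyadic times requires.\<close>

definition grid_after :: "nat \<Rightarrow> real \<Rightarrow> real" where
  "grid_after k t = grid k (Suc (nat \<lfloor>t * 2 ^ k / T\<rfloor>))"

definition dyadics :: "real set" where
  "dyadics = (\<Union>k. range (grid k))"

lemma grid_range: "grid k j \<in> {0..T}"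
proof -
  have "T * min 1 (real j / 2 ^ k) \<le> T * 1" using T_pos by (intro mult_left_mono) auto
  then show ?thesis using T_pos by (auto simp: grid_def)
qed

lemma grid_le: "grid k j \<le> T * (real j / 2 ^ k)"
  unfolding grid_def using T_pos by (intro mult_left_mono min.cobounded2) simp

lemma grid_mono: "mono (grid k)"
  using T_pos by (auto simp: grid_def mono_def min_def divide_right_mono intro!: mult_left_mono)

lemma grid_0 [simp]: "grid k 0 = 0" by (simp add: grid_def)

lemma grid_eq_T [simp]: "2 ^ k \<le> j \<Longrightarrow> grid k j = T"
proof -
  assume "2 ^ k \<le> j"
  then have "real (2 ^ k) \<le> real j" by (simp only: of_nat_le_iff)
  then show "grid k j = T" by (simp add: grid_def min_def divide_simps)
qed

lemma countable_dyadics: "countable dyadics"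
  unfolding dyadics_def by auto

lemma dyadics_range: "s \<in> dyadics \<Longrightarrow> s \<in> {0..T}"
  using grid_range by (auto simp: dyadics_def)

text \<open>The adjunction of the ceiling. With \<open>T * real j / 2 ^ k\<close> in place of
  \<open>grid k j\<close> it holds for all \<open>t\<close> and \<open>j\<close>, including those
  beyond the end of the grid.\<close>

lemma ix_le_iff: "ix k t \<le> j \<longleftrightarrow> t \<le> T * real j / 2 ^ k"
  unfolding ix_def nat_ceiling_le_eq using T_pos by (simp add: field_simps)

lemma ix_le: "t \<le> T \<Longrightarrow> ix k t \<le> 2 ^ k"
  unfolding ix_le_iff by simp

lemma ix_mono: "s \<le> t \<Longrightarrow> ix k s \<le> ix k t"
  using ix_le_iff[of k t "ix k t"] ix_le_iff[of k s "ix k t"] by simp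

lemma ix_0 [simp]: "ix k 0 = 0" by (simp add: ix_def)

lemma ix_T [simp]: "ix k T = 2 ^ k"
  using T_pos by (simp add: ix_def)

lemma le_grid_ix: "t \<in> {0..T} \<Longrightarrow> t \<le> grid k (ix k t)"
  using ix_le_iff[of k t "ix k t"] T_pos by (auto simp: grid_def min_def)

lemma ix_eq_SucD:
  assumes "ix k t = Suc j" "t \<in> {0..T}" shows "grid k j < t" "grid k j = T * real j / 2 ^ k"
proof -
  have 1: "T * real j / 2 ^ k < t" using assms(1) ix_le_iff[of k t j] by simp
  have "j \<le> 2 ^ k" using ix_le[of t k] assms by simp
  then have "real j / 2 ^ k \<le> 1" by simp
  then show "grid k j = T * real j / 2 ^ k" unfolding grid_def by (simp add: min_absorb2)
  with 1 show "grid k j < t" by simp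
qed

lemma grid_ix_le: "t \<in> {0..T} \<Longrightarrow> grid k (ix k t) \<le> t + T / 2 ^ k"
proof (cases "ix k t")
  case 0
  assume "t \<in> {0..T}"
  then have "0 \<le> t" "0 \<le> T / 2 ^ k" using T_pos by simp_all
  then have "0 \<le> t + T / 2 ^ k" by (rule add_nonneg_nonneg)
  then show ?thesis unfolding 0 grid_0 .
next
  case (Suc j)
  assume t: "t \<in> {0..T}"
  have "grid k (Suc j) \<le> T * (real (Suc j) / 2 ^ k)" by (rule grid_le)
  also have "\<dots> = grid k j + T / 2 ^ k" using ix_eq_SucD(2)[OF Suc t] by (simp add: field_simps)
  finally show ?thesis using ix_eq_SucD(1)[OF Suc t] Suc by simp
qed

lemma tendsto_add_grid_step: "(\<lambda>k. t + T / 2 ^ k) \<longlonglongrightarrow> t"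
proof -
  have "(\<lambda>k. t + T * (1/2) ^ k) \<longlonglongrightarrow> t + T * 0"
    by (intro tendsto_intros LIMSEQ_power_zero) auto
  then show ?thesis by (simp add: power_one_over)
qed

lemma grid_ix_tendsto: "t \<in> {0..T} \<Longrightarrow> (\<lambda>k. grid k (ix k t)) \<longlonglongrightarrow> t"
  by (rule tendsto_sandwich[OF _ _ tendsto_const tendsto_add_grid_step[of t]]) (auto simp: le_grid_ix grid_ix_le)

lemma grid_after_greater: "t \<in> {0..<T} \<Longrightarrow> t < grid_after k t"
proof -
  assume t: "t \<in> {0..<T}"
  let ?j = "nat \<lfloor>t * 2 ^ k / T\<rfloor>"
  have "t * 2 ^ k / T < real (Suc ?j)" by linarith
  then have "t < T * (real (Suc ?j) / 2 ^ k)" using T_pos by (simp add: field_simps)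
  then show ?thesis unfolding grid_after_def grid_def using t by (auto simp: min_def simp del: of_nat_Suc)
qed

lemma grid_after_le: "t \<in> {0..<T} \<Longrightarrow> grid_after k t \<le> t + T / 2 ^ k"
proof -
  assume t: "t \<in> {0..<T}"
  let ?j = "nat \<lfloor>t * 2 ^ k / T\<rfloor>"
  have "real ?j \<le> t * 2 ^ k / T" using t T_pos by simp
  then have "T * (real (Suc ?j) / 2 ^ k) \<le> t + T / 2 ^ k" using T_pos by (simp add: field_simps)
  moreover have "grid_after k t \<le> T * (real (Suc ?j) / 2 ^ k)"  unfolding grid_after_def by (rule grid_le)
  ultimately show ?thesis by simp
qed

lemma grid_after_tendsto: "t \<in> {0..<T} \<Longrightarrow> (\<lambda>k. grid_after k t) \<longlonglongrightarrow> t"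
  by (rule tendsto_sandwich[OF _ _ tendsto_const tendsto_add_grid_step[of t]])
     (auto simp: grid_after_greater less_imp_le grid_after_le)

lemma grid_after_dyadics: "grid_after k t \<in> dyadics"
  by (auto simp: grid_after_def dyadics_def)

lemma dyadics_0: "0 \<in> dyadics" and dyadics_T: "T \<in> dyadics"
  using rangeI[of "grid 0" 0] rangeI[of "grid 0" 1] unfolding dyadics_def by auto

lemma dyadics_dense:
  assumes "0 \<le> t" "t < r" "r \<le> T" obtains s where "s \<in> dyadics" "t < s" "s < r"
proof -
  have t: "t \<in> {0..<T}" using assms by auto
  have "eventually (\<lambda>k. grid_after k t < r) sequentially"
    by (rule order_tendstoD(2)[OF grid_after_tendsto[OF t] assms(2)])
  then obtain k where "grid_after k t < r" by (auto simp: eventually_sequentially)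
  then show thesis using that grid_after_dyadics grid_after_greater[OF t] by blast
qed

text \<open>Dyadic grids are nested, so from its first appearance on a dyadic time is fixed by
  rounding up. Combinations with weights far enough out then see it as a grid point of every grid
  involved.\<close>

lemma dyadics_eq_grid_ix:
  assumes "s \<in> dyadics"
  obtains k0 where "\<And>k. k0 \<le> k \<Longrightarrow> s = grid k (ix k s)"
proof -
  obtain k0 j0 where s: "s = grid k0 j0" using assms by (auto simp: dyadics_def)
  have s': "s = T * real (min j0 (2 ^ k0)) / 2 ^ k0"
    unfolding s grid_def by (simp add: min_def divide_simps)
  show thesis
  proof (rule that)
    fix k assume "k0 \<le> k"
    let ?i = "min j0 (2 ^ k0) * 2 ^ (k - k0)"
    have p: "(2::real) ^ k = 2 ^ k0 * 2 ^ (k - k0)" using \<open>k0 \<le> k\<close> by (simp add: power_add[symmetric])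
    have "s = T * real ?i / 2 ^ k" unfolding s' p by simp
    then have "ix k s \<le> ?i" unfolding ix_le_iff by simp
    then have "real (ix k s) \<le> real ?i" by (simp only: of_nat_le_iff)
    then have "T * (real (ix k s) / 2 ^ k) \<le> T * (real ?i / 2 ^ k)"
      using T_pos by (intro mult_left_mono divide_right_mono) auto
    also have "\<dots> = s" using \<open>s = T * real ?i / 2 ^ k\<close> by simp
    finally have "T * (real (ix k s) / 2 ^ k) \<le> s" .
    moreover have "grid k (ix k s) \<le> T * (real (ix k s) / 2 ^ k)" by (rule grid_le)
    moreover have "s \<le> grid k (ix k s)" using le_grid_ix s grid_range by blast
    ultimately show "s = grid k (ix k s)" by simp
  qed
qed

text \<open>Cells are open on the left and closed on the right. Any process that depends on
  \<open>t\<close> only through the cell is therefore left-continuous.\<close>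

lemma eventually_ix_const:
  assumes "t \<in> {0<..T}"
  shows "eventually (\<lambda>s. ix k s = ix k t) (at_left t)"
proof (cases "ix k t")
  case 0
  then show ?thesis using assms ix_le_iff[of k t 0] by auto
next
  case (Suc j)
  have t: "t \<in> {0..T}" using assms by auto
  have j: "grid k j < t" "grid k j = T * real j / 2 ^ k" by (rule ix_eq_SucD[OF Suc t])+
  have "eventually (\<lambda>s. s \<in> {grid k j<..<t}) (at_left t)"
    by (rule eventually_at_leftI[OF _ j(1)])
  then show ?thesis
  proof eventually_elim
    case (elim s)
    have "\<not> ix k s \<le> j" unfolding ix_le_iff using elim j(2) by auto
    moreover have "ix k s \<le> ix k t" using elim by (intro ix_mono) auto
    ultimately show ?case using Suc by simp
  qed
qed

text \<open>Rounding up only delays: \<open>ix k (\<tau> \<omega>) \<le> j\<close> says that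
  \<open>\<tau>\<close> has occurred by the \<open>j\<close>-th grid time. Indices from
  \<open>2 ^ k\<close> on are separated because \<open>grid\<close> is cut off at
  \<open>T\<close>.\<close>

lemma stopped_ix:
  assumes "stopping_time_on P T F \<tau>"
  shows "{\<omega>\<in>space P. ix k (\<tau> \<omega>) \<le> j} \<in> sets (F (grid k j))"
proof (cases "2 ^ k \<le> j")
  case True
  have "ix k (\<tau> \<omega>) \<le> j" if "\<omega> \<in> space P" for \<omega>
    using ix_le[of "\<tau> \<omega>" k] stopping_time_range[OF assms that] True by simp
  then have "{\<omega>\<in>space P. ix k (\<tau> \<omega>) \<le> j} = space (F (grid k j))" unfolding space_F[OF grid_range] by blast
  then show ?thesis by (simp only: sets.top)
next
  case False
  then have "real j < real (2 ^ k)" by (simp only: of_nat_less_iff)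
  then have g: "grid k j = T * real j / 2 ^ k" by (simp add: grid_def min_def divide_simps)
  have "{\<omega>\<in>space P. ix k (\<tau> \<omega>) \<le> j} = {\<omega>\<in>space (F (grid k j)). \<tau> \<omega> \<le> grid k j}"
    unfolding ix_le_iff g space_F[OF grid_range[of k j], unfolded g] by simp
  moreover have "Measurable.pred (F (grid k j)) (\<lambda>\<omega>. \<tau> \<omega> \<le> grid k j)"
    using assms grid_range[of k j] unfolding stopping_time_on_def by blast
  ultimately show ?thesis by (simp only: pred_def)
qed

lemma left_continuous_adapted_predictable:
  assumes "adapted_process T F X" "left_continuous_process P T X"
  shows "(\<lambda>(\<omega>, t). X t \<omega>) \<in> borel_measurable (predictable_algebra P T F)"
proof (rule measurableI)
  fix B :: "real set" assume "B \<in> sets borel"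
  then show "(\<lambda>(\<omega>, t). X t \<omega>) -` B \<inter> space (predictable_algebra P T F) \<in> sets (predictable_algebra P T F)"
    unfolding predictable_algebra_def using assms by (auto intro!: sigma_sets.Basic simp: sets_measure_of_conv space_measure_of_conv)
qed auto

end

text \<open>The pathwise part of the convergence argument: \<open>f n\<close> are the approximating paths, \<open>a\<close> their
  limit on the dense set \<open>D\<close> and \<open>c\<close> the right-continuous version of \<open>a\<close>. Convergence at jumps of
  \<open>c\<close> is not automatic, it is assumed at the times \<open>\<tau> q\<close> that exhaust the jumps.\<close>

locale monotone_limit =
  fixes T :: real and D :: "real set" and f :: "nat \<Rightarrow> real \<Rightarrow> real" and a c :: "real \<Rightarrow> real"
  assumes T_pos: "0 < T" and D: "D \<subseteq> {0..T}" "0 \<in> D" "T \<in> D"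
    and dense: "\<And>t r. 0 \<le> t \<Longrightarrow> t < r \<Longrightarrow> r \<le> T \<Longrightarrow> \<exists>s\<in>D. t < s \<and> s < r"
    and mono: "\<And>n s t. 0 \<le> s \<Longrightarrow> s \<le> t \<Longrightarrow> t \<le> T \<Longrightarrow> f n s \<le> f n t"
    and lim: "\<And>s. s \<in> D \<Longrightarrow> (\<lambda>n. f n s) \<longlonglongrightarrow> a s"
    and f0: "\<And>n. f n 0 = 0"
    and c_T: "c T = a T"
    and c: "\<And>t. 0 \<le> t \<Longrightarrow> t < T \<Longrightarrow> \<exists>u. (\<forall>k. u k \<in> D \<and> t < u k) \<and> u \<longlonglongrightarrow> t \<and> c t = lim (\<lambda>k. a (u k))"
begin

lemma a_mono: "s \<in> D \<Longrightarrow> t \<in> D \<Longrightarrow> s \<le> t \<Longrightarrow> a s \<le> a t"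
proof -
  assume st: "s \<in> D" "t \<in> D" "s \<le> t"
  then have "0 \<le> s" "t \<le> T" using D by auto
  then have "\<forall>n. f n s \<le> f n t" using mono[OF _ st(3)] by blast
  then show ?thesis by (intro LIMSEQ_le[OF lim[OF st(1)] lim[OF st(2)]]) blast
qed

lemma a_0: "a 0 = 0"
  using lim[OF D(2)] by (simp add: f0 LIMSEQ_const_iff)

text \<open>By monotonicity of \<open>a\<close> the right limit is an infimum, the same for every
  approximating sequence. This frees \<open>c\<close> from the particular sequence through which the
  locale assumption specifies it.\<close>

lemma c_limit:
  assumes t: "0 \<le> t" "t < T" and u: "\<And>k. u k \<in> D \<and> t < u k" "u \<longlonglongrightarrow> t"
  shows "(\<lambda>k. a (u k)) \<longlonglongrightarrow> Inf (a ` {s\<in>D. t < s})"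
proof -
  let ?I = "Inf (a ` {s\<in>D. t < s})"
  have bdd: "bdd_below (a ` {s\<in>D. t < s})"
    using a_mono[OF D(2)] D by (auto intro!: bdd_belowI2[of _ "a 0"])
  show ?thesis
  proof (rule LIMSEQ_I)
    fix e :: real assume "0 < e"
    have "a ` {s\<in>D. t < s} \<noteq> {}" using D(3) t by auto
    from cInf_lessD[OF this, of "?I + e"] obtain s where s: "s \<in> D" "t < s" "a s < ?I + e" using \<open>0 < e\<close> by auto
    obtain k0 where k0: "\<And>k. k \<ge> k0 \<Longrightarrow> u k < s"
      using order_tendstoD(2)[OF u(2) s(2)] by (auto simp: eventually_sequentially)
    show "\<exists>no. \<forall>k\<ge>no. norm (a (u k) - ?I) < e"
    proof (intro exI allI impI)
      fix k assume "k0 \<le> k"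
      then have "a (u k) \<le> a s" using k0[of k] u(1)[of k] s by (intro a_mono) auto
      moreover have "?I \<le> a (u k)" using u(1)[of k] bdd by (intro cInf_lower) auto
      ultimately show "norm (a (u k) - ?I) < e" using s(3) by simp
    qed
  qed
qed

lemma c_eq: "0 \<le> t \<Longrightarrow> t < T \<Longrightarrow> c t = Inf (a ` {s\<in>D. t < s})"
proof -
  assume t: "0 \<le> t" "t < T"
  then obtain u where u: "\<And>k. u k \<in> D \<and> t < u k" "u \<longlonglongrightarrow> t" "c t = lim (\<lambda>k. a (u k))" using c by blast
  show ?thesis unfolding u(3) by (rule limI[OF c_limit[OF t u(1,2)]])
qed

lemma c_tendsto:
  "0 \<le> t \<Longrightarrow> t < T \<Longrightarrow> (\<And>k. u k \<in> D \<and> t < u k) \<Longrightarrow> u \<longlonglongrightarrow> t \<Longrightarrow> (\<lambda>k. a (u k)) \<longlonglongrightarrow> c t"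
  using c_limit c_eq by simp

lemma c_le: assumes "0 \<le> t" "t < s" "s \<in> D" shows "c t \<le> a s"
proof -
  have "t < T" using assms D by auto
  then show ?thesis unfolding c_eq[OF assms(1) \<open>t < T\<close>]
    using assms a_mono[OF D(2)] D by (intro cInf_lower bdd_belowI2[of _ "a 0"]) auto
qed

lemma c_ge: assumes "r \<in> D" "r \<le> t" "t \<le> T" shows "a r \<le> c t"
proof (cases "t = T")
  case True then show ?thesis using c_T a_mono[of r T] D assms by auto
next
  case False
  then have t: "0 \<le> t" "t < T" using assms D by auto
  show ?thesis unfolding c_eq[OF t]
    using D t assms by (intro cInf_greatest) (auto intro!: a_mono)
qed

lemma c_approx: assumes "0 \<le> t" "t < T" "0 < e" obtains s where "s \<in> D" "t < s" "a s < c t + e"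
proof -
  have "a ` {s\<in>D. t < s} \<noteq> {}" using D(3) assms by auto
  from cInf_lessD[OF this, of "c t + e"] show thesis using that c_eq[OF assms(1,2)] assms(3) by auto
qed

lemma c_mono: assumes "0 \<le> r" "r \<le> t" "t \<le> T" shows "c r \<le> c t"
proof (cases "r = t")
  case False
  then obtain s where "s \<in> D" "r < s" "s < t" using dense[of r t] assms by auto
  then show ?thesis using c_le[of r s] c_ge[of s t] assms by auto
qed auto

lemma c_nonneg: "0 \<le> t \<Longrightarrow> t \<le> T \<Longrightarrow> 0 \<le> c t"
  using c_ge[OF D(2)] a_0 by simp

lemma c_right_continuous: assumes "0 \<le> t" "t < T" shows "(c \<longlongrightarrow> c t) (at_right t)"
proof (rule order_tendstoI)
  fix y assume "y < c t"
  then show "eventually (\<lambda>x. y < c x) (at_right t)"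
    by (intro eventually_at_rightI[OF _ assms(2)]) (use c_mono[OF assms(1)] in \<open>fastforce intro: less_le_trans\<close>)
next
  fix y assume "c t < y"
  then obtain s where s: "s \<in> D" "t < s" "a s < y" using c_approx[OF assms, of "y - c t"] by auto
  show "eventually (\<lambda>x. c x < y) (at_right t)"
  proof (rule eventually_at_rightI[OF _ s(2)])
    fix x assume "x \<in> {t<..<s}"
    then show "c x < y" using c_le[OF _ _ s(1), of x] s(3) assms by auto
  qed
qed

lemma c_left_limit: assumes "0 < t" "t \<le> T" shows "\<exists>l. (c \<longlongrightarrow> l) (at_left t)"
proof
  let ?l = "Sup (c ` {0..<t})"
  have bdd: "bdd_above (c ` {0..<t})" using c_mono assms by (auto intro!: bdd_aboveI2[of _ _ "c t"])
  have ne: "c ` {0..<t} \<noteq> {}" using assms by auto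
  show "(c \<longlongrightarrow> ?l) (at_left t)"
  proof (rule order_tendstoI)
    fix y assume "y < ?l"
    then have "\<exists>x\<in>c ` {0..<t}. y < x" using less_cSupD[OF ne] by blast
    then obtain r where r: "0 \<le> r" "r < t" "y < c r" by auto
    show "eventually (\<lambda>x. y < c x) (at_left t)"
      by (rule eventually_at_leftI[OF _ r(2)]) (use c_mono[OF r(1)] r assms in \<open>fastforce intro: less_le_trans\<close>)
  next
    fix y assume y: "?l < y"
    show "eventually (\<lambda>x. c x < y) (at_left t)"
    proof (rule eventually_at_leftI[OF _ assms(1)])
      fix x assume "x \<in> {0<..<t}"
      then have "c x \<le> ?l" by (intro cSup_upper bdd) auto
      then show "c x < y" using y by simp
    qed
  qed
qed

lemma cadlag_c: "cadlag_path T c"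
  unfolding cadlag_path_def continuous_within using c_right_continuous c_left_limit by auto

text \<open>A level strictly inside a jump of \<open>c\<close> is reached exactly at the time of the
  jump, so the rational levels exhaust the jumps. The added \<open>T\<close> is the default for
  levels that are never reached.\<close>

definition hit :: "real \<Rightarrow> real" where
  "hit q = Inf ({t\<in>{0..T}. q \<le> c t} \<union> {T})"

text \<open>Right-continuity makes the infimum attained. The time \<open>T\<close> is excluded,
  since there the default of \<open>hit\<close> would make the left side true for every
  level.\<close>

lemma hit_le_iff: assumes "0 \<le> t" "t < T" shows "hit q \<le> t \<longleftrightarrow> q \<le> c t"
proof
  have bdd: "bdd_below ({t\<in>{0..T}. q \<le> c t} \<union> {T})" using T_pos by (intro bdd_belowI[of _ 0]) auto
  assume "q \<le> c t"
  then show "hit q \<le> t" unfolding hit_def using assms bdd by (intro cInf_lower) auto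
next
  assume h: "hit q \<le> t"
  show "q \<le> c t"
  proof (rule field_le_epsilon)
    fix e :: real assume "0 < e"
    then obtain s where s: "s \<in> D" "t < s" "a s < c t + e" using c_approx[OF assms] by auto
    then have sT: "s \<le> T" using D by auto
    obtain x where x: "x \<in> {t\<in>{0..T}. q \<le> c t} \<union> {T}" "x < s"
      using cInf_lessD[of "{t\<in>{0..T}. q \<le> c t} \<union> {T}" s] h s(2) unfolding hit_def by auto
    then have "0 \<le> x" "q \<le> c x" using sT by auto
    then have "q \<le> a s" using c_le[OF _ x(2) s(1)] by auto
    then show "q \<le> c t + e" using s by simp
  qed
qed

text \<open>A point of \<open>D\<close> slightly to the right of \<open>t\<close> bounds
  \<open>f n t\<close> by monotonicity, and there the paths converge. The estimate therefore covers
  jump times as well.\<close>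

lemma upper:
  assumes "0 \<le> t" "t \<le> T" "0 < e" shows "eventually (\<lambda>n. f n t < c t + e) sequentially"
proof (cases "t = T")
  case True then show ?thesis using order_tendstoD(2)[OF lim[OF D(3)], of "c T + e"] c_T assms by simp
next
  case False
  then obtain s where s: "s \<in> D" "t < s" "a s < c t + e" using c_approx[of t e] assms by auto
  have "eventually (\<lambda>n. f n s < c t + e) sequentially" by (rule order_tendstoD(2)[OF lim[OF s(1)] s(3)])
  then show ?thesis
  proof eventually_elim
    case (elim n)
    then show ?case using mono[of t s n] assms s D by (auto simp: subset_iff intro: le_less_trans)
  qed
qed

text \<open>The lower estimate is assumed only infinitely often, with indices that may depend on the
  level \<open>q\<close>; this suffices for an upper limit.\<close>

lemma limsup_eq:
  assumes hit: "\<And>q e. q \<in> \<rat> \<Longrightarrow> 0 < e \<Longrightarrow> frequently (\<lambda>n. c (hit q) - e < f n (hit q)) sequentially"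
    and t: "0 \<le> t" "t \<le> T"
  shows "limsup (\<lambda>n. ereal (f n t)) = ereal (c t)"
proof (rule antisym)
  show "limsup (\<lambda>n. ereal (f n t)) \<le> ereal (c t)"
  proof (rule ereal_le_epsilon2)
    fix e :: real assume "0 < e"
    then have "limsup (\<lambda>n. ereal (f n t)) \<le> ereal (c t + e)"
      using upper[OF t \<open>0 < e\<close>] by (intro Limsup_bounded) (auto elim!: eventually_mono)
    then show "limsup (\<lambda>n. ereal (f n t)) \<le> ereal (c t) + ereal e" by simp
  qed
  \<comment> \<open>Either \<open>c\<close> comes within \<open>e\<close> of \<open>c t\<close>
    before \<open>t\<close>, and a point of \<open>D\<close> in between gives the bound by
    monotonicity, or every earlier value is at least \<open>e\<close> lower. In the second case a
    rational level in the gap has \<open>hit q = t\<close>; the time \<open>0\<close>, with no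
    earlier values, also falls here.\<close>
  have low: "frequently (\<lambda>n. c t - e < f n t) sequentially" if "0 < e" for e
  proof (cases "\<exists>r. 0 \<le> r \<and> r < t \<and> c t - e < c r")
    case True
    then obtain r where r: "0 \<le> r" "r < t" "c t - e < c r" by blast
    then obtain s where s: "s \<in> D" "r < s" "s < t" using dense[of r t] t by auto
    have "c t - e < a s" using c_le[OF r(1) s(2,1)] r by simp
    then have "eventually (\<lambda>n. c t - e < f n s) sequentially" by (rule order_tendstoD(1)[OF lim[OF s(1)]])
    then have "eventually (\<lambda>n. c t - e < f n t) sequentially"
    proof eventually_elim
      case (elim n)
      then show ?case using mono[of s t n] s t D by (auto simp: subset_iff intro: less_le_trans)
    qed
    then show ?thesis by (simp add: eventually_frequently)
  next
    case False
    then have F: "c r \<le> c t - e" if "0 \<le> r" "r < t" for r using that by fastforce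
    have "c t - e < c t" using that by simp
    then obtain q where q: "q \<in> \<rat>" "c t - e < q" "q < c t" using Rats_dense_in_real by blast
    have "hit q = t" unfolding hit_def
    proof (rule cInf_eq_minimum)
      show "t \<in> {t\<in>{0..T}. q \<le> c t} \<union> {T}" using t q by auto
      fix x assume "x \<in> {t\<in>{0..T}. q \<le> c t} \<union> {T}"
      then show "t \<le> x" using F[of x] q t by force
    qed
    then show ?thesis using hit[OF q(1) that] by simp
  qed
  show "ereal (c t) \<le> limsup (\<lambda>n. ereal (f n t))"
  proof (rule ereal_le_epsilon2)
    fix e :: real assume "0 < e"
    have "ereal (c t - e) \<le> limsup (\<lambda>n. ereal (f n t))"
    proof (rule ccontr)
      assume "\<not> ?thesis"
      then have "limsup (\<lambda>n. ereal (f n t)) < ereal (c t - e)" by simp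
      then have "eventually (\<lambda>n. ereal (f n t) < ereal (c t - e)) sequentially" by (rule Limsup_lessD)
      then show False using low[OF \<open>0 < e\<close>] unfolding frequently_def
        by (auto elim!: notE eventually_mono)
    qed
    then have "ereal (c t - e) + ereal e \<le> limsup (\<lambda>n. ereal (f n t)) + ereal e" by (rule add_right_mono)
    then show "ereal (c t) \<le> limsup (\<lambda>n. ereal (f n t)) + ereal e" by simp
  qed
qed

end

section \<open>The limit of the convex combinations\<close>

lemma tail_weights_tendsto:
  assumes "\<And>n. tail_weights n (N n) (w n)" "x \<longlonglongrightarrow> (l::real)"
  shows "(\<lambda>n. \<Sum>k\<le>N n. w n k * x k) \<longlonglongrightarrow> l"
proof (rule LIMSEQ_I)
  fix e :: real assume "0 < e"
  then obtain n0 where n0: "\<And>k. k \<ge> n0 \<Longrightarrow> \<bar>x k - l\<bar> < e/2"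
    using LIMSEQ_D[OF assms(2), of "e/2"] by auto
  show "\<exists>no. \<forall>n\<ge>no. norm ((\<Sum>k\<le>N n. w n k * x k) - l) < e"
  proof (intro exI allI impI)
    fix n assume n: "n0 \<le> n"
    have "x k \<le> l + e/2" "l - e/2 \<le> x k" if "n \<le> k" for k using n0[of k] that n by linarith+
    then have "(\<Sum>k\<le>N n. w n k * x k) \<le> l + e/2" "l - e/2 \<le> (\<Sum>k\<le>N n. w n k * x k)"
      using tail_weights_sum_le[OF assms(1)] tail_weights_sum_ge[OF assms(1)] by blast+
    then show "norm ((\<Sum>k\<le>N n. w n k * x k) - l) < e" using \<open>0 < e\<close> by simp
  qed
qed

text \<open>Convergence of the means turns an asymptotic pointwise upper bound into \<open>L\<^sup>1\<close> convergence,
  as in Scheffe's lemma.\<close>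

lemma tendsto_L1_of_upper_bound:
  fixes Y W :: "nat \<Rightarrow> 'a \<Rightarrow> real"
  assumes int: "\<And>n. integrable M (Y n)" "integrable M Y'" "\<And>n. integrable M (W n)" "integrable M W'"
    and W: "(\<lambda>n. \<integral>x. \<bar>W n x - W' x\<bar> \<partial>M) \<longlonglongrightarrow> 0"
    and Y: "AE x in M. 0 \<le> Y' x" "\<And>n. AE x in M. Y n x \<le> W n x"
    and upper: "AE x in M. \<forall>e>0. eventually (\<lambda>n. Y n x < Y' x + e) sequentially"
    and lim: "(\<lambda>n. \<integral>x. Y n x \<partial>M) \<longlonglongrightarrow> (\<integral>x. Y' x \<partial>M)"
  shows "(\<lambda>n. \<integral>x. \<bar>Y n x - Y' x\<bar> \<partial>M) \<longlonglongrightarrow> 0"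
proof -
  have [measurable]: "Y n \<in> borel_measurable M" "Y' \<in> borel_measurable M" "W n \<in> borel_measurable M" "W' \<in> borel_measurable M" for n
    using int by auto
  define p where "p n x = max 0 (Y n x - Y' x)" for n x
  have [measurable]: "p n \<in> borel_measurable M" for n unfolding p_def by measurable
  have pi: "integrable M (p n)" for n unfolding p_def using int by auto
  have mi: "integrable M (\<lambda>x. min (p n x) \<bar>W' x\<bar>)" for n using pi int by auto
  have "(\<lambda>n. \<integral>x. min (p n x) \<bar>W' x\<bar> \<partial>M) \<longlonglongrightarrow> (\<integral>x. 0 \<partial>M)"
  proof (rule integral_dominated_convergence[where w="\<lambda>x. \<bar>W' x\<bar>"])
    show "AE x in M. norm (min (p n x) \<bar>W' x\<bar>) \<le> \<bar>W' x\<bar>" for n unfolding p_def by (intro AE_I2) auto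
    show "AE x in M. (\<lambda>n. min (p n x) \<bar>W' x\<bar>) \<longlonglongrightarrow> 0"
      using upper
    proof eventually_elim
      case (elim x)
      show ?case
      proof (rule order_tendstoI)
        fix a :: real assume "a < 0"
        then have "a < min (p n x) \<bar>W' x\<bar>" for n unfolding p_def by auto
        then show "eventually (\<lambda>n. a < min (p n x) \<bar>W' x\<bar>) sequentially" by simp
      next
        fix a :: real assume "0 < a"
        then have "eventually (\<lambda>n. Y n x < Y' x + a) sequentially" using elim by blast
        then show "eventually (\<lambda>n. min (p n x) \<bar>W' x\<bar> < a) sequentially"
          by eventually_elim (use \<open>0 < a\<close> in \<open>auto simp: p_def\<close>)
      qed
    qed
  qed (use int in auto)
  then have 1: "(\<lambda>n. (\<integral>x. \<bar>W n x - W' x\<bar> \<partial>M) + (\<integral>x. min (p n x) \<bar>W' x\<bar> \<partial>M)) \<longlonglongrightarrow> 0 + 0"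
    using W by (intro tendsto_add) auto
  \<comment> \<open>As \<open>0 \<le> Y' x\<close>, the positive part is at most
    \<open>\<bar>W' x\<bar> + \<bar>W n x - W' x\<bar>\<close>. What exceeds
    \<open>\<bar>W' x\<bar>\<close> is thus controlled by the convergence of \<open>W\<close>, and
    the rest is dominated by a fixed integrable function.\<close>
  have pb: "(\<integral>x. p n x \<partial>M) \<le> (\<integral>x. \<bar>W n x - W' x\<bar> \<partial>M) + (\<integral>x. min (p n x) \<bar>W' x\<bar> \<partial>M)" for n
  proof -
    have "(\<integral>x. p n x \<partial>M) \<le> (\<integral>x. \<bar>W n x - W' x\<bar> + min (p n x) \<bar>W' x\<bar> \<partial>M)"
    proof (rule integral_mono_AE)
      show "AE x in M. p n x \<le> \<bar>W n x - W' x\<bar> + min (p n x) \<bar>W' x\<bar>"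
        using Y(1) Y(2)[of n] by eventually_elim (auto simp: p_def)
    qed (use int pi mi in auto)
    also have "\<dots> = (\<integral>x. \<bar>W n x - W' x\<bar> \<partial>M) + (\<integral>x. min (p n x) \<bar>W' x\<bar> \<partial>M)"
      using int mi by simp
    finally show ?thesis .
  qed
  have p0: "(\<lambda>n. \<integral>x. p n x \<partial>M) \<longlonglongrightarrow> 0"
  proof (rule tendsto_sandwich[OF _ _ tendsto_const 1[unfolded add_0]])
    show "eventually (\<lambda>n. 0 \<le> (\<integral>x. p n x \<partial>M)) sequentially" by (simp add: p_def)
    show "eventually (\<lambda>n. (\<integral>x. p n x \<partial>M) \<le> (\<integral>x. \<bar>W n x - W' x\<bar> \<partial>M) + (\<integral>x. min (p n x) \<bar>W' x\<bar> \<partial>M)) sequentially"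
      using pb by simp
  qed
  have "(\<lambda>n. 2 * (\<integral>x. p n x \<partial>M) - ((\<integral>x. Y n x \<partial>M) - (\<integral>x. Y' x \<partial>M))) \<longlonglongrightarrow> 2 * 0 - ((\<integral>x. Y' x \<partial>M) - (\<integral>x. Y' x \<partial>M))"
    by (intro tendsto_intros p0 lim)
  \<comment> \<open>The identity \<open>\<bar>u\<bar> = 2 * max 0 u - u\<close> trades the negative
    part, for which no bound is at hand, for the difference of the means.\<close>
  moreover have "(\<integral>x. \<bar>Y n x - Y' x\<bar> \<partial>M) = 2 * (\<integral>x. p n x \<partial>M) - ((\<integral>x. Y n x \<partial>M) - (\<integral>x. Y' x \<partial>M))" for n
  proof -
    have "(\<integral>x. \<bar>Y n x - Y' x\<bar> \<partial>M) = (\<integral>x. 2 * p n x - (Y n x - Y' x) \<partial>M)"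
      by (rule Bochner_Integration.integral_cong) (auto simp: p_def max_def)
    then show ?thesis using int pi by simp
  qed
  ultimately show ?thesis by simp
qed

text \<open>An almost surely convergent subsequence satisfies the inequality eventually, hence the
  whole sequence satisfies it infinitely often.\<close>

lemma tendsto_L1_AE_frequently:
  fixes Y :: "nat \<Rightarrow> 'a \<Rightarrow> real"
  assumes "\<And>n. integrable M (Y n)" "integrable M Y'" "(\<lambda>n. \<integral>x. \<bar>Y n x - Y' x\<bar> \<partial>M) \<longlonglongrightarrow> 0"
  shows "AE x in M. \<forall>e>0. frequently (\<lambda>n. Y' x - e < Y n x) sequentially"
proof -
  have "\<exists>r::nat\<Rightarrow>nat. strict_mono r \<and> (AE x in M. (\<lambda>n. Y (r n) x - Y' x) \<longlonglongrightarrow> 0)"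
    using tendsto_L1_AE_subseq[of M "\<lambda>n x. Y n x - Y' x"] assms by auto
  then obtain r where r: "strict_mono r" "AE x in M. (\<lambda>n. Y (r n) x - Y' x) \<longlonglongrightarrow> 0" by blast
  show ?thesis using r(2)
  proof eventually_elim
    case (elim x)
    show ?case
    proof (intro allI impI)
      fix e :: real assume "0 < e"
      then obtain n0 where n0: "\<And>n. n \<ge> n0 \<Longrightarrow> \<bar>Y (r n) x - Y' x\<bar> < e" using LIMSEQ_D[OF elim, of e] by auto
      show "frequently (\<lambda>n. Y' x - e < Y n x) sequentially" unfolding frequently_sequentially
      proof
        fix m
        have "m \<le> r (max m n0)" using seq_suble[OF r(1), of "max m n0"] by simp
        moreover have "Y' x - e < Y (r (max m n0)) x" using n0[of "max m n0"] by auto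
        ultimately show "\<exists>n\<ge>m. Y' x - e < Y n x" by blast
      qed
    qed
  qed
qed

locale komlos_limit = class_D_submartingale P T F S for P :: "'a measure" and T F S +
  fixes N :: "nat \<Rightarrow> nat" and w :: "nat \<Rightarrow> nat \<Rightarrow> real" and X :: "'a \<Rightarrow> real"
  assumes weights: "\<And>n. tail_weights n (N n) (w n)" and X: "integrable P X"
    and X_approx: "\<And>n. (\<integral>\<omega>. \<bar>(\<Sum>k\<le>N n. w n k * comp (grid k) (2 ^ k) \<omega>) - X \<omega>\<bar> \<partial>P) \<le> (1/2)^n"
begin

text \<open>Each compensator is extended to a cell by its value at the right end, which
  \<open>comp_Suc_measurable\<close> makes known at the left end. This choice gives left-continuity
  and adaptedness together.\<close>

definition approx :: "nat \<Rightarrow> real \<Rightarrow> 'a \<Rightarrow> real" where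
  "approx n t \<omega> = (\<Sum>k\<le>N n. w n k * comp (grid k) (ix k t) \<omega>)"

lemmas comp_grid_integrable = comp_integrable[OF grid_range grid_mono]
lemmas comp_grid_mono = comp_mono[OF grid_range grid_mono]

lemma w_nonneg: "0 \<le> w n k" using weights[of n] by (auto simp: tail_weights_def)

lemma approx_0: "approx n 0 \<omega> = 0"
  unfolding approx_def by (simp add: comp_def)

lemma approx_mono: "s \<le> t \<Longrightarrow> approx n s \<omega> \<le> approx n t \<omega>"
  unfolding approx_def by (intro sum_mono mult_left_mono comp_grid_mono ix_mono w_nonneg)

lemma approx_integrable: "integrable P (approx n t)"
  unfolding approx_def using comp_grid_integrable by auto

lemma approx_T: "approx n T \<omega> = (\<Sum>k\<le>N n. w n k * comp (grid k) (2 ^ k) \<omega>)"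
  by (simp add: approx_def)

lemma approx_adapted: assumes "t \<in> {0..T}" shows "approx n t \<in> borel_measurable (F t)"
proof -
  have "comp (grid k) (ix k t) \<in> borel_measurable (F t)" for k
  proof (cases "ix k t")
    case 0
    have "comp (grid k) 0 = (\<lambda>\<omega>. 0)" by (simp add: comp_def fun_eq_iff)
    then show ?thesis by (simp add: 0)
  next
    case (Suc j)
    show ?thesis unfolding Suc
      by (rule measurable_F_mono[OF comp_Suc_measurable[OF grid_range grid_mono] grid_range assms])
         (use ix_eq_SucD(1)[OF Suc assms] in simp)
  qed
  then show ?thesis unfolding approx_def by measurable
qed

lemma approx_left_continuous: "left_continuous_process P T (approx n)"
  unfolding left_continuous_process_def continuous_within
proof (intro ballI)
  fix \<omega> t assume t: "t \<in> {0<..T}"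
  have "eventually (\<lambda>s. \<forall>k\<in>{..N n}. ix k s = ix k t) (at_left t)"
    using eventually_ix_const[OF t] by (intro eventually_ball_finite) auto
  then have "eventually (\<lambda>s. approx n s \<omega> = approx n t \<omega>) (at_left t)"
    by eventually_elim (auto simp: approx_def intro!: sum.cong)
  then show "((\<lambda>s. approx n s \<omega>) \<longlongrightarrow> approx n t \<omega>) (at_left t)"
    by (rule tendsto_eventually)
qed

lemma approx_predictable: "(\<lambda>(\<omega>, t). approx n t \<omega>) \<in> borel_measurable (predictable_algebra P T F)"
  by (rule left_continuous_adapted_predictable)
     (auto simp: adapted_process_def approx_adapted approx_left_continuous)

text \<open>For \<open>n \<ge> k0\<close> every grid with a nonzero weight contains
  \<open>s\<close>, so the martingale identity holds for each of them with the same right side, and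
  the weights sum to one.\<close>

lemma approx_integral:
  assumes s: "s \<in> {0..T}" and k0: "\<And>k. k0 \<le> k \<Longrightarrow> s = grid k (ix k s)" and n: "k0 \<le> n"
    and B: "B \<in> sets (F s)"
  shows "(\<integral>\<omega>. indicator B \<omega> * (approx n T \<omega> - approx n s \<omega>) \<partial>P) = (\<integral>\<omega>. indicator B \<omega> * (S T \<omega> - S s \<omega>) \<partial>P)"
proof -
  have BP: "B \<in> sets P" using B sets_F s by blast
  let ?I = "\<integral>\<omega>. indicator B \<omega> * (S T \<omega> - S s \<omega>) \<partial>P"
  let ?d = "\<lambda>k \<omega>. comp (grid k) (2 ^ k) \<omega> - comp (grid k) (ix k s) \<omega>"
  have eq: "(\<integral>\<omega>. indicator B \<omega> * ?d k \<omega> \<partial>P) = ?I" if "k0 \<le> k" for k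
    using comp_integral[OF grid_range grid_mono, of B k "ix k s" "2 ^ k"] ix_le[of s k] s B k0[OF that]
    by simp
  have "(\<integral>\<omega>. indicator B \<omega> * (approx n T \<omega> - approx n s \<omega>) \<partial>P) = (\<integral>\<omega>. (\<Sum>k\<le>N n. w n k * (indicator B \<omega> * ?d k \<omega>)) \<partial>P)"
    by (simp add: approx_def sum_subtractf[symmetric] sum_distrib_left algebra_simps)
  also have "\<dots> = (\<Sum>k\<le>N n. \<integral>\<omega>. w n k * (indicator B \<omega> * ?d k \<omega>) \<partial>P)"
    by (intro Bochner_Integration.integral_sum integrable_mult_right integrable_indicator_mult[OF BP]
        Bochner_Integration.integrable_diff comp_grid_integrable)
  also have "\<dots> = (\<Sum>k\<le>N n. w n k * (\<integral>\<omega>. indicator B \<omega> * ?d k \<omega> \<partial>P))"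
    by simp
  also have "\<dots> = (\<Sum>k\<le>N n. w n k * ?I)"
  proof (rule sum.cong[OF refl])
    fix k
    show "w n k * (\<integral>\<omega>. indicator B \<omega> * ?d k \<omega> \<partial>P) = w n k * ?I"
    proof (cases "w n k = 0")
      case False
      then have "n \<le> k" using weights[of n] unfolding tail_weights_def by blast
      then show ?thesis using eq[of k] n by simp
    qed simp
  qed
  also have "\<dots> = ?I" using weights[of n] by (simp add: sum_distrib_right[symmetric] tail_weights_def)
  finally show ?thesis .
qed

text \<open>At dyadic times \<open>al\<close> is the limit of \<open>approx\<close>, since both differ from a martingale by \<open>S\<close>;
  \<open>C\<close> below is its right-continuous version.\<close>

definition al :: "real \<Rightarrow> 'a \<Rightarrow> real" where
  "al t = real_cond_exp P (F t) (\<lambda>\<omega>. X \<omega> - S T \<omega> + S t \<omega>)"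

lemma T_range: "T \<in> {0..T}" "0 \<in> {0..T}" using T_pos by auto

lemma shifted_integrable: "t \<in> {0..T} \<Longrightarrow> integrable P (\<lambda>\<omega>. X \<omega> - S T \<omega> + S t \<omega>)"
  using X S_integrable T_range by auto

lemma al_measurable: "al t \<in> borel_measurable (F t)"
  unfolding al_def by simp

lemma al_integrable: assumes "t \<in> {0..T}" shows "integrable P (al t)"
proof -
  interpret sigma_finite_subalgebra P "F t" by (rule sigma_finite_subalgebra_F[OF assms])
  show ?thesis unfolding al_def by (rule real_cond_exp_int(1)[OF shifted_integrable[OF assms]])
qed

lemma al_integral:
  assumes t: "t \<in> {0..T}" and B: "B \<in> sets (F t)"
  shows "(\<integral>\<omega>. indicator B \<omega> * al t \<omega> \<partial>P) = (\<integral>\<omega>. indicator B \<omega> * (X \<omega> - S T \<omega> + S t \<omega>) \<partial>P)"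
proof -
  interpret sigma_finite_subalgebra P "F t" by (rule sigma_finite_subalgebra_F[OF t])
  show ?thesis using real_cond_exp_intA[OF shifted_integrable[OF t] B]
    by (simp add: al_def set_lebesgue_integral_def)
qed

text \<open>For large \<open>n\<close>, \<open>approx n s\<close> and \<open>al s\<close> are
  conditional expectations of variables that differ by \<open>approx n T - X\<close>. Contraction in
  \<open>L\<^sup>1\<close> passes the rate \<open>(1/2)^n\<close> on to time \<open>s\<close>, and a
  geometric rate forces almost sure convergence of the whole sequence.\<close>

lemma approx_tendsto_al:
  assumes s: "s \<in> dyadics"
  shows "AE \<omega> in P. (\<lambda>n. approx n s \<omega>) \<longlonglongrightarrow> al s \<omega>"
proof -
  obtain k0 where k0: "\<And>k. k0 \<le> k \<Longrightarrow> s = grid k (ix k s)" using dyadics_eq_grid_ix[OF s] by blast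
  have sT: "s \<in> {0..T}" by (rule dyadics_range[OF s])
  interpret sigma_finite_subalgebra P "F s" by (rule sigma_finite_subalgebra_F[OF sT])
  have d: "(\<integral>\<omega>. \<bar>approx n s \<omega> - al s \<omega>\<bar> \<partial>P) \<le> (1/2)^n" if n: "k0 \<le> n" for n
  proof -
    let ?Z = "\<lambda>\<omega>. approx n T \<omega> - S T \<omega> + S s \<omega>"
    have Zi: "integrable P ?Z" using approx_integrable S_integrable T_range sT by auto
    have Xi: "integrable P (\<lambda>\<omega>. X \<omega> - S T \<omega> + S s \<omega>)" by (rule shifted_integrable[OF sT])
    have Di: "integrable P (\<lambda>\<omega>. approx n T \<omega> - X \<omega>)" using approx_integrable X by auto
    have 1: "AE \<omega> in P. real_cond_exp P (F s) ?Z \<omega> = approx n s \<omega>"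
    proof (rule real_cond_exp_charact[OF _ Zi approx_integrable approx_adapted[OF sT]])
      fix B assume B: "B \<in> sets (F s)"
      then have BP: "B \<in> sets P" using sets_F sT by blast
      have i: "integrable P (\<lambda>\<omega>. indicator B \<omega> * (approx n T \<omega> - approx n s \<omega>))"
        "integrable P (\<lambda>\<omega>. indicator B \<omega> * (S T \<omega> - S s \<omega>))"
        "integrable P (\<lambda>\<omega>. indicator B \<omega> * approx n s \<omega>)"
        using approx_integrable S_integrable T_range sT by (auto intro!: integrable_indicator_mult[OF BP])
      have "(\<integral>\<omega>. indicator B \<omega> * ?Z \<omega> \<partial>P) = (\<integral>\<omega>. indicator B \<omega> * (approx n T \<omega> - approx n s \<omega>)
          - indicator B \<omega> * (S T \<omega> - S s \<omega>) + indicator B \<omega> * approx n s \<omega> \<partial>P)"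
        by (simp add: algebra_simps)
      also have "\<dots> = (\<integral>\<omega>. indicator B \<omega> * approx n s \<omega> \<partial>P)"
        using i approx_integral[OF sT k0 n B] by simp
      finally show "(LINT \<omega>:B|P. ?Z \<omega>) = (LINT \<omega>:B|P. approx n s \<omega>)"
        by (simp add: set_lebesgue_integral_def)
    qed
    have 2: "AE \<omega> in P. real_cond_exp P (F s) (\<lambda>\<omega>. ?Z \<omega> - (X \<omega> - S T \<omega> + S s \<omega>)) \<omega> = real_cond_exp P (F s) ?Z \<omega> - al s \<omega>"
      unfolding al_def by (rule real_cond_exp_diff[OF Zi Xi])
    let ?E = "real_cond_exp P (F s) (\<lambda>\<omega>. approx n T \<omega> - X \<omega>)"
    let ?A = "real_cond_exp P (F s) (\<lambda>\<omega>. \<bar>approx n T \<omega> - X \<omega>\<bar>)"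
    have 3: "AE \<omega> in P. approx n s \<omega> - al s \<omega> = ?E \<omega>"
      using 1 2 by eventually_elim simp
    have 4: "AE \<omega> in P. ?E \<omega> \<le> ?A \<omega>" by (rule real_cond_exp_mono) (use Di in auto)
    have 5: "AE \<omega> in P. real_cond_exp P (F s) (\<lambda>\<omega>. - \<bar>approx n T \<omega> - X \<omega>\<bar>) \<omega> \<le> ?E \<omega>"
      by (rule real_cond_exp_mono) (use Di in auto)
    have 6: "AE \<omega> in P. real_cond_exp P (F s) (\<lambda>\<omega>. - 1 * \<bar>approx n T \<omega> - X \<omega>\<bar>) \<omega> = - 1 * ?A \<omega>"
      by (rule real_cond_exp_cmult) (use Di in auto)
    have "AE \<omega> in P. \<bar>approx n s \<omega> - al s \<omega>\<bar> \<le> ?A \<omega>"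
      using 3 4 5 6 by eventually_elim auto
    then have "(\<integral>\<omega>. \<bar>approx n s \<omega> - al s \<omega>\<bar> \<partial>P) \<le> (\<integral>\<omega>. ?A \<omega> \<partial>P)"
      using approx_integrable al_integrable[OF sT] real_cond_exp_int(1)[of "\<lambda>\<omega>. \<bar>approx n T \<omega> - X \<omega>\<bar>"] Di
      by (intro integral_mono_AE) auto
    also have "\<dots> = (\<integral>\<omega>. \<bar>approx n T \<omega> - X \<omega>\<bar> \<partial>P)"
      by (rule real_cond_exp_int(2)) (use Di in auto)
    also have "\<dots> \<le> (1/2)^n" using X_approx[of n] unfolding approx_T .
    finally show ?thesis .
  qed
  have "AE \<omega> in P. (\<lambda>n. approx (n + k0) s \<omega> - al s \<omega>) \<longlonglongrightarrow> 0"
  proof (rule AE_tendsto_zero_geometric)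
    show "integrable P (\<lambda>\<omega>. approx (i + k0) s \<omega> - al s \<omega>)" for i
      using approx_integrable al_integrable[OF sT] by auto
    show "(\<integral>\<omega>. \<bar>approx (i + k0) s \<omega> - al s \<omega>\<bar> \<partial>P) \<le> (1/2)^i" for i
    proof -
      have "(1/2::real)^(i + k0) \<le> (1/2)^i" by (rule power_decreasing) auto
      with d[of "i + k0"] show ?thesis by (meson le_add2 order_trans)
    qed
  qed
  then show ?thesis
  proof eventually_elim
    case (elim \<omega>)
    have "(\<lambda>n. approx (n + k0) s \<omega>) \<longlonglongrightarrow> al s \<omega>" by (rule LIM_zero_cancel[OF elim])
    then show ?case by (rule LIMSEQ_offset)
  qed
qed

definition C :: "real \<Rightarrow> 'a \<Rightarrow> real" where
  "C t \<omega> = (if t < T then lim (\<lambda>k. al (grid_after k t) \<omega>) else al T \<omega>)"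

text \<open>The dyadic times are countable, so a single null set suffices. Off it, all facts about
  paths come from the deterministic locale.\<close>

lemma AE_monotone_limit:
  "AE \<omega> in P. monotone_limit T dyadics (\<lambda>n t. approx n t \<omega>) (\<lambda>s. al s \<omega>) (\<lambda>t. C t \<omega>)"
proof -
  have "AE \<omega> in P. \<forall>s\<in>dyadics. (\<lambda>n. approx n s \<omega>) \<longlonglongrightarrow> al s \<omega>"
    using approx_tendsto_al by (simp add: AE_ball_countable[OF countable_dyadics])
  then show ?thesis
  proof eventually_elim
    case (elim \<omega>)
    show ?case
    proof unfold_locales
      show "dyadics \<subseteq> {0..T}" using dyadics_range by blast
      show "\<exists>s\<in>dyadics. t < s \<and> s < r" if "0 \<le> t" "t < r" "r \<le> T" for t r
        using dyadics_dense[OF that] by blast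
      show "\<exists>u. (\<forall>k. u k \<in> dyadics \<and> t < u k) \<and> u \<longlonglongrightarrow> t \<and> C t \<omega> = lim (\<lambda>k. al (u k) \<omega>)"
        if "0 \<le> t" "t < T" for t
        using that grid_after_dyadics grid_after_greater[of t] grid_after_tendsto[of t]
        by (intro exI[of _ "\<lambda>k. grid_after k t"]) (simp add: C_def)
    qed (use T_pos elim approx_mono approx_0 dyadics_0 dyadics_T in \<open>auto simp: C_def\<close>)
  qed
qed

text \<open>The limit depends only on a tail of the sequence, and for any \<open>r > t\<close> some
  tail lies before \<open>r\<close>. Measurability in every such \<open>F r\<close> gives it in
  \<open>F t\<close> by right-continuity of the filtration.\<close>

lemma C_measurable: assumes t: "t \<in> {0..T}" shows "C t \<in> borel_measurable (F t)"
proof (cases "t < T")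
  case False
  then have "t = T" using t by simp
  then show ?thesis using al_measurable[of T] unfolding C_def by simp
next
  case True
  then have t': "t \<in> {0..<T}" using t by simp
  show ?thesis
  proof (rule measurable_F_right_continuous[OF t'])
    fix r assume r: "r \<in> {t<..T}"
    obtain K where K: "\<And>k. K \<le> k \<Longrightarrow> grid_after k t < r"
      using order_tendstoD(2)[OF grid_after_tendsto[OF t'], of r] r by (auto simp: eventually_sequentially)
    have "f \<longlonglongrightarrow> L \<longleftrightarrow> (\<lambda>k. f (k + K)) \<longlonglongrightarrow> L" for f :: "nat \<Rightarrow> real" and L
      by (rule iffI, erule LIMSEQ_ignore_initial_segment, erule LIMSEQ_offset)
    then have shift: "lim f = lim (\<lambda>k. f (k + K))" for f :: "nat \<Rightarrow> real"
      unfolding lim_def by (simp only:)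
    have "(\<lambda>\<omega>. lim (\<lambda>k. al (grid_after (k + K) t) \<omega>)) \<in> borel_measurable (F r)"
    proof (rule borel_measurable_lim_metric)
      fix k
      show "al (grid_after (k + K) t) \<in> borel_measurable (F r)"
        by (rule measurable_F_mono[OF al_measurable])
           (use K[of "k + K"] r t dyadics_range[OF grid_after_dyadics, of "k + K" t] in simp_all)
    qed
    moreover have "C t = (\<lambda>\<omega>. lim (\<lambda>k. al (grid_after (k + K) t) \<omega>))"
      unfolding C_def if_P[OF True] by (rule ext) (rule shift)
    ultimately show "C t \<in> borel_measurable (F r)" by simp
  qed
qed

lemma AE_al_bound: "s \<in> dyadics \<Longrightarrow> AE \<omega> in P. 0 \<le> al s \<omega> \<and> al s \<omega> \<le> al T \<omega>"
  using AE_monotone_limit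
proof eventually_elim
  case (elim \<omega>)
  interpret monotone_limit T dyadics "\<lambda>n t. approx n t \<omega>" "\<lambda>s. al s \<omega>" "\<lambda>t. C t \<omega>" by fact
  show ?case using a_mono[OF D(2) elim(1)] a_mono[OF elim(1) D(3)] a_0 dyadics_range[OF elim(1)] by auto
qed

lemma AE_C_bound: "AE \<omega> in P. \<forall>t\<in>{0..T}. 0 \<le> C t \<omega> \<and> C t \<omega> \<le> al T \<omega>"
  using AE_monotone_limit
proof eventually_elim
  case (elim \<omega>)
  interpret monotone_limit T dyadics "\<lambda>n t. approx n t \<omega>" "\<lambda>s. al s \<omega>" "\<lambda>t. C t \<omega>" by fact
  show ?case using c_nonneg c_mono[of _ T] c_T by auto
qed

lemma C_integrable: assumes t: "t \<in> {0..T}" shows "integrable P (C t)"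
proof (rule Bochner_Integration.integrable_bound[OF al_integrable[OF T_range(1)]])
  show "C t \<in> borel_measurable P" by (rule measurable_F_P[OF C_measurable[OF t] t])
  show "AE \<omega> in P. norm (C t \<omega>) \<le> norm (al T \<omega>)"
    using AE_C_bound by eventually_elim (use t in fastforce)
qed

text \<open>\<open>al_integral\<close> is passed to the limit along dyadic times decreasing to
  \<open>t\<close>: on the left \<open>al T\<close> dominates, on the right \<open>S\<close> is
  right-continuous in \<open>L\<^sup>1\<close> by \<open>stopped_tendsto_L1\<close> for constant
  times. Events of \<open>F t\<close> belong to all later algebras.\<close>

lemma C_integral:
  assumes t: "t \<in> {0..T}" and B: "B \<in> sets (F t)"
  shows "(\<integral>\<omega>. indicator B \<omega> * C t \<omega> \<partial>P) = (\<integral>\<omega>. indicator B \<omega> * (X \<omega> - S T \<omega> + S t \<omega>) \<partial>P)"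
proof (cases "t < T")
  case False
  then have "t = T" using t by simp
  then show ?thesis using al_integral[OF t B] unfolding C_def by simp
next
  case True
  then have t': "t \<in> {0..<T}" using t by simp
  let ?u = "\<lambda>k. grid_after k t"
  have u: "?u k \<in> {0..T}" for k by (rule dyadics_range[OF grid_after_dyadics])
  have BP[measurable]: "B \<in> sets P" using B sets_F t by blast
  have [measurable]: "C t \<in> borel_measurable P" by (rule measurable_F_P[OF C_measurable[OF t] t])
  have [measurable]: "al (?u k) \<in> borel_measurable P" for k by (rule measurable_F_P[OF al_measurable u])
  have 1: "(\<lambda>k. \<integral>\<omega>. indicator B \<omega> * al (?u k) \<omega> \<partial>P) \<longlonglongrightarrow> (\<integral>\<omega>. indicator B \<omega> * C t \<omega> \<partial>P)"
  proof (rule integral_dominated_convergence[where w="\<lambda>\<omega>. \<bar>al T \<omega>\<bar>"])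
    show "integrable P (\<lambda>\<omega>. \<bar>al T \<omega>\<bar>)" using al_integrable[OF T_range(1)] by simp
    show "AE \<omega> in P. norm (indicator B \<omega> * al (?u k) \<omega>) \<le> \<bar>al T \<omega>\<bar>" for k
      using AE_al_bound[OF grid_after_dyadics[of k t]] by eventually_elim (auto simp: indicator_def)
    show "AE \<omega> in P. (\<lambda>k. indicator B \<omega> * al (?u k) \<omega>) \<longlonglongrightarrow> indicator B \<omega> * C t \<omega>"
      using AE_monotone_limit
    proof eventually_elim
      case (elim \<omega>)
      interpret monotone_limit T dyadics "\<lambda>n t. approx n t \<omega>" "\<lambda>s. al s \<omega>" "\<lambda>t. C t \<omega>" by fact
      have "(\<lambda>k. al (?u k) \<omega>) \<longlonglongrightarrow> C t \<omega>"
        by (rule c_tendsto) (use t' grid_after_dyadics grid_after_greater[OF t'] grid_after_tendsto[OF t'] in auto)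
      then show ?case by (intro tendsto_intros)
    qed
  qed measurable
  have 2: "(\<integral>\<omega>. indicator B \<omega> * al (?u k) \<omega> \<partial>P) = (\<integral>\<omega>. indicator B \<omega> * (X \<omega> - S T \<omega> + S (?u k) \<omega>) \<partial>P)" for k
    by (rule al_integral[OF u])
       (use B sets_F_mono[OF t u, of k] less_imp_le[OF grid_after_greater[OF t', of k]] in blast)
  have "(\<lambda>k. \<integral>\<omega>. \<bar>S (?u k) \<omega> - S t \<omega>\<bar> \<partial>P) \<longlonglongrightarrow> 0"
    by (rule stopped_tendsto_L1[of "\<lambda>_. t" "\<lambda>k _. ?u k"])
       (use stopping_time_const t u grid_after_tendsto[OF t'] grid_after_greater[OF t'] in \<open>auto intro: less_imp_le\<close>)
  then have "(\<lambda>k. \<integral>\<omega>. \<bar>(X \<omega> - S T \<omega> + S (?u k) \<omega>) - (X \<omega> - S T \<omega> + S t \<omega>)\<bar> \<partial>P) \<longlonglongrightarrow> 0"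
    by simp
  then have 3: "(\<lambda>k. \<integral>\<omega>. indicator B \<omega> * (X \<omega> - S T \<omega> + S (?u k) \<omega>) \<partial>P) \<longlonglongrightarrow> (\<integral>\<omega>. indicator B \<omega> * (X \<omega> - S T \<omega> + S t \<omega>) \<partial>P)"
    by (rule tendsto_set_integral_L1[OF shifted_integrable[OF u] shifted_integrable[OF t] BP])
  show ?thesis by (rule LIMSEQ_unique[OF 1[unfolded 2] 3])
qed

end

section \<open>Convergence at stopping times, and the predictable version of the limit\<close>

context komlos_limit
begin

text \<open>All approximations start at \<open>0\<close>, hence so does \<open>al\<close> almost
  surely; comparing means at time \<open>0\<close> fixes the mean of \<open>X - S T\<close>.\<close>

lemma C_mean_constant: "(\<integral>\<omega>. X \<omega> \<partial>P) - (\<integral>\<omega>. S T \<omega> \<partial>P) = - (\<integral>\<omega>. S 0 \<omega> \<partial>P)"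
proof -
  have ae: "AE \<omega> in P. al 0 \<omega> = 0"
    using AE_monotone_limit by eventually_elim (rule monotone_limit.a_0)
  have B: "space P \<in> sets (F 0)" using sets.top[of "F 0"] space_F[OF T_range(2)] by simp
  have [measurable]: "al 0 \<in> borel_measurable P" by (rule measurable_F_P[OF al_measurable T_range(2)])
  have ind: "(\<integral>\<omega>. indicator (space P) \<omega> * f \<omega> \<partial>P) = (\<integral>\<omega>. f \<omega> \<partial>P)" for f :: "'a \<Rightarrow> real"
    by (rule Bochner_Integration.integral_cong) auto
  have "0 = (\<integral>\<omega>. al 0 \<omega> \<partial>P)" using integral_cong_AE[of "al 0" P "\<lambda>_. 0"] ae by simp
  also have "\<dots> = (\<integral>\<omega>. X \<omega> - S T \<omega> + S 0 \<omega> \<partial>P)" using al_integral[OF T_range(2) B] unfolding ind .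
  also have "\<dots> = (\<integral>\<omega>. X \<omega> \<partial>P) - (\<integral>\<omega>. S T \<omega> \<partial>P) + (\<integral>\<omega>. S 0 \<omega> \<partial>P)"
    using X S_integrable T_range by simp
  finally show ?thesis by simp
qed

context
  fixes \<tau> :: "'a \<Rightarrow> real"
  assumes \<tau>: "stopping_time_on P T F \<tau>"
begin

text \<open>Rounding up leaves finitely many values, so \<open>stopped_integral_eq\<close> applies,
  and it stays on the side of \<open>\<tau>\<close> from which \<open>S\<close> and \<open>C\<close>
  are continuous.\<close>

definition \<sigma> :: "nat \<Rightarrow> 'a \<Rightarrow> real" where "\<sigma> k \<omega> = grid k (ix k (\<tau> \<omega>))"

lemma \<tau>_range: "\<omega> \<in> space P \<Longrightarrow> \<tau> \<omega> \<in> {0..T}"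
  by (rule stopping_time_range[OF \<tau>])

lemma \<sigma>_stopping: "stopping_time_on P T F (\<sigma> k)"
  unfolding \<sigma>_def by (rule stopping_time_grid[OF grid_range grid_mono stopped_ix[OF \<tau>]])

lemma \<sigma>_ge: "\<omega> \<in> space P \<Longrightarrow> \<tau> \<omega> \<le> \<sigma> k \<omega>"
  unfolding \<sigma>_def by (rule le_grid_ix[OF \<tau>_range])

lemma \<sigma>_tendsto: "\<omega> \<in> space P \<Longrightarrow> (\<lambda>k. \<sigma> k \<omega>) \<longlonglongrightarrow> \<tau> \<omega>"
  unfolding \<sigma>_def by (rule grid_ix_tendsto[OF \<tau>_range])

lemma ix_\<tau>_le: "\<omega> \<in> space P \<Longrightarrow> ix k (\<tau> \<omega>) \<le> 2 ^ k"
  using ix_le[of "\<tau> \<omega>" k] \<tau>_range[of \<omega>] by simp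

lemma S_\<sigma>_tendsto: "(\<lambda>k. \<integral>\<omega>. S (\<sigma> k \<omega>) \<omega> \<partial>P) \<longlonglongrightarrow> (\<integral>\<omega>. S (\<tau> \<omega>) \<omega> \<partial>P)"
proof -
  have "(\<lambda>k. \<integral>\<omega>. indicator (space P) \<omega> * S (\<sigma> k \<omega>) \<omega> \<partial>P) \<longlonglongrightarrow> (\<integral>\<omega>. indicator (space P) \<omega> * S (\<tau> \<omega>) \<omega> \<partial>P)"
    by (rule tendsto_set_integral_L1[OF stopped_integrable[OF \<sigma>_stopping] stopped_integrable[OF \<tau>] sets.top
        stopped_tendsto_L1[OF \<tau> \<sigma>_stopping \<sigma>_ge \<sigma>_tendsto]])
  moreover have "(\<integral>\<omega>. indicator (space P) \<omega> * f \<omega> \<partial>P) = (\<integral>\<omega>. f \<omega> \<partial>P)" for f :: "'a \<Rightarrow> real"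
    by (rule Bochner_Integration.integral_cong) auto
  ultimately show ?thesis by simp
qed

lemma C_\<sigma>: "integrable P (\<lambda>\<omega>. C (\<sigma> k \<omega>) \<omega>)"
    "(\<integral>\<omega>. C (\<sigma> k \<omega>) \<omega> \<partial>P) = (\<integral>\<omega>. S (\<sigma> k \<omega>) \<omega> \<partial>P) - (\<integral>\<omega>. S 0 \<omega> \<partial>P)"
proof -
  note * = stopped_integral_eq[where t="grid k" and J="\<lambda>\<omega>. ix k (\<tau> \<omega>)" and N="2 ^ k" and Y="\<lambda>j. C (grid k j)"
      and Z="\<lambda>j \<omega>. X \<omega> - S T \<omega> + S (grid k j) \<omega>",
      OF grid_range grid_mono stopped_ix[OF \<tau>] ix_\<tau>_le C_integrable[OF grid_range] shifted_integrable[OF grid_range]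
        C_integral[OF grid_range]]
  show "integrable P (\<lambda>\<omega>. C (\<sigma> k \<omega>) \<omega>)" unfolding \<sigma>_def by (rule *(1))
  have "(\<integral>\<omega>. C (\<sigma> k \<omega>) \<omega> \<partial>P) = (\<integral>\<omega>. X \<omega> - S T \<omega> + S (\<sigma> k \<omega>) \<omega> \<partial>P)" unfolding \<sigma>_def by (rule *(2))
  also have "\<dots> = (\<integral>\<omega>. X \<omega> \<partial>P) - (\<integral>\<omega>. S T \<omega> \<partial>P) + (\<integral>\<omega>. S (\<sigma> k \<omega>) \<omega> \<partial>P)"
    using X S_integrable[OF T_range(1)] stopped_integrable[OF \<sigma>_stopping[of k]] by simp
  finally show "(\<integral>\<omega>. C (\<sigma> k \<omega>) \<omega> \<partial>P) = (\<integral>\<omega>. S (\<sigma> k \<omega>) \<omega> \<partial>P) - (\<integral>\<omega>. S 0 \<omega> \<partial>P)"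
    unfolding C_mean_constant by simp
qed

lemma C_\<sigma>_tendsto: "AE \<omega> in P. (\<lambda>k. C (\<sigma> k \<omega>) \<omega>) \<longlonglongrightarrow> C (\<tau> \<omega>) \<omega>"
  using AE_monotone_limit AE_space
proof eventually_elim
  case (elim \<omega>)
  interpret monotone_limit T dyadics "\<lambda>n t. approx n t \<omega>" "\<lambda>s. al s \<omega>" "\<lambda>t. C t \<omega>" by fact
  show ?case
  proof (rule cadlag_path_tendsto_right[OF cadlag_c \<tau>_range[OF elim(2)] _ \<sigma>_tendsto[OF elim(2)]])
    show "\<sigma> k \<omega> \<in> {\<tau> \<omega>..T}" for k
      using \<sigma>_ge[OF elim(2)] grid_range unfolding \<sigma>_def by auto
  qed
qed

text \<open>At a random time \<open>C\<close> is recognised as the almost sure limit of its values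
  at the rounded times, which are measurable; completeness of \<open>P\<close> covers the
  exceptional set.\<close>

lemma C_\<tau>_measurable: "(\<lambda>\<omega>. C (\<tau> \<omega>) \<omega>) \<in> borel_measurable P"
proof (rule measurable_cong_AE_null[OF refl])
  show "N' \<in> sets P" if "N \<in> null_sets P" "N' \<subseteq> N" for N N'
    using null_subset_F[OF T_range(1) that] sets_F[OF T_range(1)] by blast
  show "(\<lambda>\<omega>. lim (\<lambda>k. C (\<sigma> k \<omega>) \<omega>)) \<in> borel_measurable P"
    using C_\<sigma>(1) by (intro borel_measurable_lim_metric borel_measurable_integrable)
  show "AE \<omega> in P. lim (\<lambda>k. C (\<sigma> k \<omega>) \<omega>) = C (\<tau> \<omega>) \<omega>"
    using C_\<sigma>_tendsto by eventually_elim (rule limI)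
qed

lemma C_\<tau>_bound: "AE \<omega> in P. 0 \<le> C (\<tau> \<omega>) \<omega> \<and> C (\<tau> \<omega>) \<omega> \<le> al T \<omega>"
  using AE_C_bound AE_space by eventually_elim (use \<tau>_range in blast)

lemma C_\<tau>_integrable: "integrable P (\<lambda>\<omega>. C (\<tau> \<omega>) \<omega>)"
proof (rule Bochner_Integration.integrable_bound[OF al_integrable[OF T_range(1)] C_\<tau>_measurable])
  show "AE \<omega> in P. norm (C (\<tau> \<omega>) \<omega>) \<le> norm (al T \<omega>)"
    using C_\<tau>_bound by eventually_elim auto
qed

text \<open>Optional stopping for \<open>S - C\<close>, obtained from the rounded times:
  \<open>C\<close> is dominated by \<open>al T\<close>, and \<open>S\<close> converges in mean by
  class D.\<close>

lemma C_\<tau>_integral: "(\<integral>\<omega>. C (\<tau> \<omega>) \<omega> \<partial>P) = (\<integral>\<omega>. S (\<tau> \<omega>) \<omega> \<partial>P) - (\<integral>\<omega>. S 0 \<omega> \<partial>P)"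
proof -
  have "(\<lambda>k. \<integral>\<omega>. C (\<sigma> k \<omega>) \<omega> \<partial>P) \<longlonglongrightarrow> (\<integral>\<omega>. C (\<tau> \<omega>) \<omega> \<partial>P)"
  proof (rule integral_dominated_convergence[where w="\<lambda>\<omega>. \<bar>al T \<omega>\<bar>"])
    show "integrable P (\<lambda>\<omega>. \<bar>al T \<omega>\<bar>)" using al_integrable[OF T_range(1)] by simp
    show "AE \<omega> in P. norm (C (\<sigma> k \<omega>) \<omega>) \<le> \<bar>al T \<omega>\<bar>" for k
      using AE_C_bound
    proof eventually_elim
      case (elim \<omega>)
      then have "0 \<le> C (\<sigma> k \<omega>) \<omega> \<and> C (\<sigma> k \<omega>) \<omega> \<le> al T \<omega>" unfolding \<sigma>_def using grid_range by blast
      then show ?case by auto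
    qed
  qed (use C_\<sigma>_tendsto C_\<tau>_measurable C_\<sigma>(1) in auto)
  moreover have "(\<lambda>k. \<integral>\<omega>. C (\<sigma> k \<omega>) \<omega> \<partial>P) \<longlonglongrightarrow> (\<integral>\<omega>. S (\<tau> \<omega>) \<omega> \<partial>P) - (\<integral>\<omega>. S 0 \<omega> \<partial>P)"
    unfolding C_\<sigma>(2) by (intro tendsto_intros S_\<sigma>_tendsto)
  ultimately show ?thesis by (rule LIMSEQ_unique)
qed

lemmas comp_\<tau> = comp_stopped_integral[OF grid_range grid_mono stopped_ix[OF \<tau>] ix_\<tau>_le]

lemma approx_\<tau>_integrable: "integrable P (\<lambda>\<omega>. approx n (\<tau> \<omega>) \<omega>)"
  unfolding approx_def by (intro Bochner_Integration.integrable_sum integrable_mult_right comp_\<tau>(1))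

text \<open>Stopping the \<open>k\<close>-th compensator gives the mean increment of
  \<open>S\<close> from \<open>0\<close> to \<open>\<sigma> k\<close>. These means converge, and
  tail weights keep the limit, which \<open>C_\<tau>_integral\<close> identifies. So no mass is lost
  even if \<open>C\<close> jumps at \<open>\<tau>\<close>.\<close>

lemma approx_\<tau>_integral_tendsto:
  "(\<lambda>n. \<integral>\<omega>. approx n (\<tau> \<omega>) \<omega> \<partial>P) \<longlonglongrightarrow> (\<integral>\<omega>. C (\<tau> \<omega>) \<omega> \<partial>P)"
proof -
  have "(\<integral>\<omega>. approx n (\<tau> \<omega>) \<omega> \<partial>P) = (\<Sum>k\<le>N n. w n k * ((\<integral>\<omega>. S (\<sigma> k \<omega>) \<omega> \<partial>P) - (\<integral>\<omega>. S 0 \<omega> \<partial>P)))" for n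
  proof -
    have "(\<integral>\<omega>. approx n (\<tau> \<omega>) \<omega> \<partial>P) = (\<Sum>k\<le>N n. \<integral>\<omega>. w n k * comp (grid k) (ix k (\<tau> \<omega>)) \<omega> \<partial>P)"
      unfolding approx_def by (intro Bochner_Integration.integral_sum integrable_mult_right comp_\<tau>(1))
    also have "\<dots> = (\<Sum>k\<le>N n. w n k * (\<integral>\<omega>. comp (grid k) (ix k (\<tau> \<omega>)) \<omega> \<partial>P))" by simp
    finally show ?thesis by (simp only: comp_\<tau>(2) \<sigma>_def grid_0)
  qed
  moreover have "(\<lambda>n. \<Sum>k\<le>N n. w n k * ((\<integral>\<omega>. S (\<sigma> k \<omega>) \<omega> \<partial>P) - (\<integral>\<omega>. S 0 \<omega> \<partial>P)))
      \<longlonglongrightarrow> (\<integral>\<omega>. S (\<tau> \<omega>) \<omega> \<partial>P) - (\<integral>\<omega>. S 0 \<omega> \<partial>P)"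
    by (intro tail_weights_tendsto[OF weights] tendsto_intros S_\<sigma>_tendsto)
  ultimately show ?thesis unfolding C_\<tau>_integral by simp
qed

text \<open>The upper estimate and convergence of the means give \<open>L\<^sup>1\<close>
  convergence at \<open>\<tau>\<close>, the terminal values \<open>approx n T\<close> with limit
  \<open>X\<close> serving as majorants.\<close>

lemma AE_approx_\<tau>_frequently:
  "AE \<omega> in P. \<forall>e>0. frequently (\<lambda>n. C (\<tau> \<omega>) \<omega> - e < approx n (\<tau> \<omega>) \<omega>) sequentially"
proof (rule tendsto_L1_AE_frequently[OF approx_\<tau>_integrable C_\<tau>_integrable])
  show "(\<lambda>n. \<integral>\<omega>. \<bar>approx n (\<tau> \<omega>) \<omega> - C (\<tau> \<omega>) \<omega>\<bar> \<partial>P) \<longlonglongrightarrow> 0"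
  proof (rule tendsto_L1_of_upper_bound[OF approx_\<tau>_integrable C_\<tau>_integrable approx_integrable[of _ T] X])
    show "(\<lambda>n. \<integral>\<omega>. \<bar>approx n T \<omega> - X \<omega>\<bar> \<partial>P) \<longlonglongrightarrow> 0"
    proof (rule tendsto_sandwich[OF _ _ tendsto_const])
      show "(\<lambda>n. (1/2::real)^n) \<longlonglongrightarrow> 0" by (rule LIMSEQ_power_zero) simp
      show "eventually (\<lambda>n. (\<integral>\<omega>. \<bar>approx n T \<omega> - X \<omega>\<bar> \<partial>P) \<le> (1/2)^n) sequentially"
        using X_approx unfolding approx_T by simp
    qed simp
    show "AE \<omega> in P. 0 \<le> C (\<tau> \<omega>) \<omega>" using C_\<tau>_bound by eventually_elim simp
    show "AE \<omega> in P. approx n (\<tau> \<omega>) \<omega> \<le> approx n T \<omega>" for n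
      by (rule AE_I2, rule approx_mono) (use \<tau>_range in auto)
    show "AE \<omega> in P. \<forall>e>0. eventually (\<lambda>n. approx n (\<tau> \<omega>) \<omega> < C (\<tau> \<omega>) \<omega> + e) sequentially"
      using AE_monotone_limit AE_space
    proof eventually_elim
      case (elim \<omega>)
      interpret monotone_limit T dyadics "\<lambda>n t. approx n t \<omega>" "\<lambda>s. al s \<omega>" "\<lambda>t. C t \<omega>" by fact
      show ?case using upper[of "\<tau> \<omega>"] \<tau>_range[OF elim(2)] by auto
    qed
    show "(\<lambda>n. \<integral>\<omega>. approx n (\<tau> \<omega>) \<omega> \<partial>P) \<longlonglongrightarrow> (\<integral>\<omega>. C (\<tau> \<omega>) \<omega> \<partial>P)"
      by (rule approx_\<tau>_integral_tendsto)
  qed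
qed

end

text \<open>This is \<open>hit\<close> for the paths of \<open>C\<close>, written out for every
  scenario because \<open>monotone_limit\<close> is available only almost surely.\<close>

definition jump_time :: "real \<Rightarrow> 'a \<Rightarrow> real" where
  "jump_time q \<omega> = Inf ({t\<in>{0..T}. q \<le> C t \<omega>} \<union> {T})"

lemma jump_time_range: "jump_time q \<omega> \<in> {0..T}"
proof -
  have "bdd_below ({t\<in>{0..T}. q \<le> C t \<omega>} \<union> {T})" using T_pos by (intro bdd_belowI[of _ 0]) auto
  then have "jump_time q \<omega> \<le> T" unfolding jump_time_def by (intro cInf_lower) auto
  moreover have "0 \<le> jump_time q \<omega>" unfolding jump_time_def using T_pos by (intro cInf_greatest) auto
  ultimately show ?thesis by simp
qed

text \<open>For \<open>t < T\<close> the event \<open>jump_time q \<omega> \<le> t\<close> coincides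
  with \<open>q \<le> C t \<omega>\<close> up to a null set, which completeness puts into
  \<open>F t\<close>. Real-valued indicators are used since \<open>measurable_F_cong_AE\<close>
  speaks of real functions.\<close>

lemma jump_time_stopping: "stopping_time_on P T F (jump_time q)"
  unfolding stopping_time_on_def
proof (intro conjI ballI)
  show "jump_time q \<in> space P \<rightarrow> {0..T}" using jump_time_range by blast
  fix t assume t: "t \<in> {0..T}"
  show "Measurable.pred (F t) (\<lambda>\<omega>. jump_time q \<omega> \<le> t)"
  proof (cases "t < T")
    case False
    then have "jump_time q \<omega> \<le> t" for \<omega> using jump_time_range[of q \<omega>] t by simp
    then show ?thesis by simp
  next
    case True
    have [measurable]: "C t \<in> borel_measurable (F t)" by (rule C_measurable[OF t])
    have "(\<lambda>\<omega>. if q \<le> C t \<omega> then 1 else 0::real) \<in> borel_measurable (F t)" by measurable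
    moreover have "AE \<omega> in P. (if q \<le> C t \<omega> then 1 else 0::real) = (if jump_time q \<omega> \<le> t then 1 else 0)"
      using AE_monotone_limit
    proof eventually_elim
      case (elim \<omega>)
      interpret monotone_limit T dyadics "\<lambda>n t. approx n t \<omega>" "\<lambda>s. al s \<omega>" "\<lambda>t. C t \<omega>" by fact
      have "jump_time q \<omega> = hit q" by (simp add: jump_time_def hit_def)
      then show ?case using hit_le_iff[of t q] t True by simp
    qed
    ultimately have "(\<lambda>\<omega>. if jump_time q \<omega> \<le> t then 1 else 0::real) \<in> borel_measurable (F t)"
      by (rule measurable_F_cong_AE[OF t])
    then have "{\<omega>\<in>space (F t). 0 < (if jump_time q \<omega> \<le> t then 1 else 0::real)} \<in> sets (F t)"
      by (intro borel_measurable_less borel_measurable_const)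
    moreover have "{\<omega>\<in>space (F t). 0 < (if jump_time q \<omega> \<le> t then 1 else 0::real)} = {\<omega>\<in>space (F t). jump_time q \<omega> \<le> t}"
      by (rule Collect_cong) (simp split: if_split)
    ultimately show ?thesis unfolding pred_def by (simp only:)
  qed
qed

text \<open>A countable operation on predictable processes, carried out in every scenario. An
  infinite upper limit is mapped to \<open>0\<close>; by \<open>AE_A_eq_C\<close> this affects times
  in \<open>{0..T}\<close> only in a null set of scenarios.\<close>

definition A :: "real \<Rightarrow> 'a \<Rightarrow> real" where
  "A t \<omega> = real_of_ereal (limsup (\<lambda>n. ereal (approx n t \<omega>)))"

text \<open>Rational levels give countably many stopping times, so their exceptional sets unite to
  one null set; off it \<open>limsup_eq\<close> applies at all times at once.\<close>

lemma AE_A_eq_C: "AE \<omega> in P. \<forall>t\<in>{0..T}. A t \<omega> = C t \<omega>"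
proof -
  have "AE \<omega> in P. \<forall>q\<in>\<rat>. \<forall>e>0. frequently (\<lambda>n. C (jump_time q \<omega>) \<omega> - e < approx n (jump_time q \<omega>) \<omega>) sequentially"
    unfolding AE_ball_countable[OF countable_rat] using AE_approx_\<tau>_frequently[OF jump_time_stopping] by blast
  with AE_monotone_limit show ?thesis
  proof eventually_elim
    case (elim \<omega>)
    interpret monotone_limit T dyadics "\<lambda>n t. approx n t \<omega>" "\<lambda>s. al s \<omega>" "\<lambda>t. C t \<omega>" by fact
    have j: "jump_time q \<omega> = hit q" for q by (simp add: jump_time_def hit_def)
    show ?case
    proof
      fix t assume "t \<in> {0..T}"
      then have "limsup (\<lambda>n. ereal (approx n t \<omega>)) = ereal (C t \<omega>)"
        using elim(2) unfolding j by (intro limsup_eq) auto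
      then show "A t \<omega> = C t \<omega>" by (simp add: A_def)
    qed
  qed
qed

lemma A_measurable: "t \<in> {0..T} \<Longrightarrow> A t \<in> borel_measurable (F t)"
proof -
  assume t: "t \<in> {0..T}"
  have [measurable]: "approx n t \<in> borel_measurable (F t)" for n by (rule approx_adapted[OF t])
  show ?thesis unfolding A_def by measurable
qed

lemma A_predictable: "predictable_process P T F A"
proof -
  have [measurable]: "(\<lambda>(\<omega>, t). approx n t \<omega>) \<in> borel_measurable (predictable_algebra P T F)" for n
    by (rule approx_predictable)
  have "(\<lambda>p. real_of_ereal (limsup (\<lambda>n. ereal ((\<lambda>(\<omega>, t). approx n t \<omega>) p)))) \<in> borel_measurable (predictable_algebra P T F)"
    by measurable
  then show ?thesis unfolding predictable_process_def A_def by (simp add: case_prod_beta)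
qed

lemma doob_meyer_existence: "doob_meyer_decomposition P T F S (\<lambda>t \<omega>. S t \<omega> - A t \<omega>) A"
proof -
  have Aint: "integrable P (A t)" if t: "t \<in> {0..T}" for t
    by (rule integrable_cong_AE_imp[OF C_integrable[OF t] measurable_F_P[OF A_measurable[OF t] t]])
       (use AE_A_eq_C t in \<open>auto elim!: eventually_mono\<close>)
  \<comment> \<open>The right side does not depend on \<open>t\<close>: the process
    \<open>S - A\<close> is the martingale closed by \<open>S T - X\<close>.\<close>
  have Aeq: "(\<integral>\<omega>. indicator B \<omega> * (S t \<omega> - A t \<omega>) \<partial>P) = (\<integral>\<omega>. indicator B \<omega> * (S T \<omega> - X \<omega>) \<partial>P)"
    if t: "t \<in> {0..T}" and B: "B \<in> sets (F t)" for t B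
  proof -
    have BP[measurable]: "B \<in> sets P" using sets_F[OF t] B by blast
    have [measurable]: "A t \<in> borel_measurable P" "C t \<in> borel_measurable P"
      using Aint[OF t] C_integrable[OF t] by auto
    have "(\<integral>\<omega>. indicator B \<omega> * A t \<omega> \<partial>P) = (\<integral>\<omega>. indicator B \<omega> * C t \<omega> \<partial>P)"
      by (rule integral_cong_AE) (use AE_A_eq_C t in \<open>auto elim!: eventually_mono\<close>)
    also have "\<dots> = (\<integral>\<omega>. indicator B \<omega> * (X \<omega> - S T \<omega> + S t \<omega>) \<partial>P)" by (rule C_integral[OF t B])
    finally have 1: "(\<integral>\<omega>. indicator B \<omega> * A t \<omega> \<partial>P) = (\<integral>\<omega>. indicator B \<omega> * (X \<omega> - S T \<omega> + S t \<omega>) \<partial>P)" .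
    have i: "integrable P (\<lambda>\<omega>. indicator B \<omega> * A t \<omega>)" "integrable P (\<lambda>\<omega>. indicator B \<omega> * S t \<omega>)"
      "integrable P (\<lambda>\<omega>. indicator B \<omega> * (X \<omega> - S T \<omega> + S t \<omega>))"
      by (intro integrable_indicator_mult[OF BP] Aint S_integrable shifted_integrable t)+
    have "(\<integral>\<omega>. indicator B \<omega> * (S t \<omega> - A t \<omega>) \<partial>P) = (\<integral>\<omega>. indicator B \<omega> * S t \<omega> - indicator B \<omega> * A t \<omega> \<partial>P)"
      by (simp add: algebra_simps)
    also have "\<dots> = (\<integral>\<omega>. indicator B \<omega> * S t \<omega> \<partial>P) - (\<integral>\<omega>. indicator B \<omega> * (X \<omega> - S T \<omega> + S t \<omega>) \<partial>P)"
      using i by (simp add: 1)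
    also have "\<dots> = (\<integral>\<omega>. indicator B \<omega> * S t \<omega> - indicator B \<omega> * (X \<omega> - S T \<omega> + S t \<omega>) \<partial>P)"
      using i by simp
    also have "\<dots> = (\<integral>\<omega>. indicator B \<omega> * (S T \<omega> - X \<omega>) \<partial>P)"
      by (simp add: algebra_simps)
    finally show ?thesis .
  qed
  have Mi: "integrable P (\<lambda>\<omega>. S t \<omega> - A t \<omega>)" if "t \<in> {0..T}" for t
    using Aint S_integrable that by auto
  have Mm: "(\<lambda>\<omega>. S t \<omega> - A t \<omega>) \<in> borel_measurable (F t)" if "t \<in> {0..T}" for t
    by (intro borel_measurable_diff A_measurable S_measurable_F that)
  have "martingale P T F (\<lambda>t \<omega>. S t \<omega> - A t \<omega>)"
    unfolding martingale_def adapted_process_def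
  proof (intro conjI ballI impI Mi Mm)
    fix s t assume st: "s \<in> {0..T}" "t \<in> {0..T}" "s \<le> t"
    interpret sigma_finite_subalgebra P "F s" by (rule sigma_finite_subalgebra_F[OF st(1)])
    show "AE \<omega> in P. real_cond_exp P (F s) (\<lambda>\<omega>. S t \<omega> - A t \<omega>) \<omega> = S s \<omega> - A s \<omega>"
    proof (rule real_cond_exp_charact[OF _ Mi[OF st(2)] Mi[OF st(1)] Mm[OF st(1)]])
      fix B assume B: "B \<in> sets (F s)"
      then have "B \<in> sets (F t)" using sets_F_mono[OF st] by blast
      then show "(LINT \<omega>:B|P. S t \<omega> - A t \<omega>) = (LINT \<omega>:B|P. S s \<omega> - A s \<omega>)"
        using Aeq[OF st(2)] Aeq[OF st(1) B] by (simp add: set_lebesgue_integral_def)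
    qed
  qed
  moreover have "cadlag_process P T (\<lambda>t \<omega>. S t \<omega> - A t \<omega>)"
    unfolding cadlag_process_def
    using cadlag[unfolded cadlag_process_def] AE_monotone_limit AE_A_eq_C
  proof eventually_elim
    case (elim \<omega>)
    interpret monotone_limit T dyadics "\<lambda>n t. approx n t \<omega>" "\<lambda>s. al s \<omega>" "\<lambda>t. C t \<omega>" by fact
    have ev: "eventually (\<lambda>s. S s \<omega> - C s \<omega> = S s \<omega> - A s \<omega>) F'" if "eventually (\<lambda>s. s \<in> {0..T}) F'" for F'
      using that by eventually_elim (use elim(3) in simp)
    show "cadlag_path T (\<lambda>t. S t \<omega> - A t \<omega>)"
      unfolding cadlag_path_def
    proof (intro conjI ballI)
      fix t assume t: "t \<in> {0..<T}"
      have "((\<lambda>s. S s \<omega> - C s \<omega>) \<longlongrightarrow> S t \<omega> - C t \<omega>) (at_right t)"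
        using elim(1) cadlag_c t unfolding cadlag_path_def continuous_within by (intro tendsto_diff) auto
      moreover have "eventually (\<lambda>s. s \<in> {0..T}) (at_right t)"
        by (rule eventually_at_rightI[of t T]) (use t in auto)
      ultimately have "((\<lambda>s. S s \<omega> - A s \<omega>) \<longlongrightarrow> S t \<omega> - C t \<omega>) (at_right t)"
        using tendsto_cong[OF ev] by blast
      then show "continuous (at_right t) (\<lambda>t. S t \<omega> - A t \<omega>)"
        unfolding continuous_within using elim(3) t by simp
    next
      fix t assume t: "t \<in> {0<..T}"
      obtain l l' where l: "((\<lambda>t. S t \<omega>) \<longlongrightarrow> l) (at_left t)" "((\<lambda>t. C t \<omega>) \<longlongrightarrow> l') (at_left t)"
        using elim(1) cadlag_c t unfolding cadlag_path_def by blast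
      have "eventually (\<lambda>s. s \<in> {0..T}) (at_left t)"
        by (rule eventually_at_leftI[of 0 t]) (use t in auto)
      then have "((\<lambda>s. S s \<omega> - A s \<omega>) \<longlongrightarrow> l - l') (at_left t)"
        using tendsto_cong[OF ev] tendsto_diff[OF l] by blast
      then show "\<exists>l. ((\<lambda>t. S t \<omega> - A t \<omega>) \<longlongrightarrow> l) (at_left t)" by blast
    qed
  qed
  moreover have "increasing_process P T A"
    unfolding increasing_process_def using AE_monotone_limit AE_A_eq_C
  proof eventually_elim
    case (elim \<omega>)
    interpret monotone_limit T dyadics "\<lambda>n t. approx n t \<omega>" "\<lambda>s. al s \<omega>" "\<lambda>t. C t \<omega>" by fact
    show ?case unfolding mono_on_def using c_mono elim(2) by auto
  qed
  \<comment> \<open>The decomposition asks for the initial value in every scenario. It holds there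
    because each \<open>approx n\<close> is exactly \<open>0\<close> at time
    \<open>0\<close>.\<close>
  moreover have "A 0 \<omega> = 0" for \<omega>
    unfolding A_def approx_0 by (simp add: Limsup_const zero_ereal_def[symmetric])
  ultimately show ?thesis
    unfolding doob_meyer_decomposition_def using A_predictable by simp
qed

end

lemma (in class_D_submartingale) ex_doob_meyer_decomposition:
  "\<exists>M A. doob_meyer_decomposition P T F S M A"
proof -
  have Z: "integrable P (comp (grid k) (2 ^ k))" for k by (rule comp_integrable[OF grid_range grid_mono])
  have nn: "0 \<le> comp (grid k) (2 ^ k) \<omega>" for k \<omega> by (rule comp_nonneg[OF grid_range grid_mono])
  have ui: "\<exists>c\<ge>0. \<forall>k. (\<integral>\<omega>. max 0 (comp (grid k) (2 ^ k) \<omega> - c) \<partial>P) \<le> e" if e: "0 < e" for e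
  proof -
    obtain c where c: "0 \<le> c" "\<And>t N. (\<forall>j. t j \<in> {0..T}) \<Longrightarrow> mono t \<Longrightarrow> t 0 = 0 \<Longrightarrow> t N = T \<Longrightarrow>
           (\<integral>\<omega>. max 0 (comp t N \<omega> - c) \<partial>P) \<le> e"
      using comp_uniformly_integrable[OF e] by blast
    have "(\<integral>\<omega>. max 0 (comp (grid k) (2 ^ k) \<omega> - c) \<partial>P) \<le> e" for k
      by (rule c(2)) (use grid_range grid_mono in auto)
    then show ?thesis using c(1) by blast
  qed
  show ?thesis
  proof (rule komlos[OF Z nn ui])
    fix N w X
    assume "\<And>n. tail_weights n (N n) (w n)" "integrable P X"
      "\<And>n. (\<integral>\<omega>. \<bar>(\<Sum>k\<le>N n. w n k * comp (grid k) (2 ^ k) \<omega>) - X \<omega>\<bar> \<partial>P) \<le> (1/2)^n"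
    then interpret komlos_limit P T F S N w X by unfold_locales
    show ?thesis using doob_meyer_existence by blast
  qed
qed

section \<open>Integration by parts and the predictable algebra\<close>

lemma cdf_measurable: "finite_borel_measure \<mu> \<Longrightarrow> (\<lambda>t. measure \<mu> {..t}) \<in> borel_measurable borel"
  "finite_borel_measure \<mu> \<Longrightarrow> (\<lambda>t. measure \<mu> {..<t}) \<in> borel_measurable borel"
proof -
  assume "finite_borel_measure \<mu>"
  then interpret finite_borel_measure \<mu> .
  show "(\<lambda>t. measure \<mu> {..t}) \<in> borel_measurable borel" "(\<lambda>t. measure \<mu> {..<t}) \<in> borel_measurable borel"
    by (intro borel_measurable_mono monoI finite_measure_mono; auto)+
qed

text \<open>Fubini's theorem for the half plane \<open>fst p \<le> snd p\<close> and its complement.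
  The diagonal must be counted once, hence the closed half-line in one integral and the open one in
  the other.\<close>

lemma integral_cdf_by_parts:
  assumes "finite_borel_measure \<mu>" "finite_borel_measure \<nu>"
  shows "(\<integral>t. measure \<mu> {..t} \<partial>\<nu>) + (\<integral>s. measure \<nu> {..<s} \<partial>\<mu>) = measure \<mu> UNIV * measure \<nu> UNIV"
proof -
  interpret M: finite_borel_measure \<mu> by fact
  interpret N: finite_borel_measure \<nu> by fact
  interpret pair_sigma_finite \<mu> \<nu> ..
  note [simp] = M.M_is_borel N.M_is_borel M.borel_UNIV N.borel_UNIV
  note [measurable_cong] = M.M_is_borel N.M_is_borel
  let ?Q = "{p :: real \<times> real. fst p \<le> snd p}"
  have sp: "space (\<mu> \<Otimes>\<^sub>M \<nu>) = UNIV" by (simp add: space_pair_measure)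
  have "{p \<in> space (\<mu> \<Otimes>\<^sub>M \<nu>). fst p \<le> snd p} \<in> sets (\<mu> \<Otimes>\<^sub>M \<nu>)" by measurable
  then have Q: "?Q \<in> sets (\<mu> \<Otimes>\<^sub>M \<nu>)" by (simp add: sp)
  have Q': "- ?Q \<in> sets (\<mu> \<Otimes>\<^sub>M \<nu>)" using sets.compl_sets[OF Q] by (simp add: sp Compl_eq_Diff_UNIV)
  have m: "(\<lambda>t. measure \<mu> {..t}) \<in> borel_measurable \<nu>" "(\<lambda>t. measure \<nu> {..<t}) \<in> borel_measurable \<mu>"
    using cdf_measurable(1)[OF assms(1)] cdf_measurable(2)[OF assms(2)] by (auto cong: measurable_cong_sets)
  have i: "integrable \<nu> (\<lambda>t. measure \<mu> {..t})" "integrable \<mu> (\<lambda>t. measure \<nu> {..<t})"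
    by (rule N.integrable_const_bound[where B="measure \<mu> UNIV"], auto intro!: M.finite_measure_mono m)
       (rule M.integrable_const_bound[where B="measure \<nu> UNIV"], auto intro!: N.finite_measure_mono m)
  have "emeasure (\<mu> \<Otimes>\<^sub>M \<nu>) ?Q = (\<integral>\<^sup>+t. emeasure \<mu> {..t} \<partial>\<nu>)"
    unfolding emeasure_pair_measure_alt2[OF Q] by (simp add: vimage_def atMost_def)
  also have "\<dots> = ennreal (\<integral>t. measure \<mu> {..t} \<partial>\<nu>)"
    unfolding M.emeasure_eq_measure by (intro nn_integral_eq_integral i) auto
  finally have 1: "emeasure (\<mu> \<Otimes>\<^sub>M \<nu>) ?Q = ennreal (\<integral>t. measure \<mu> {..t} \<partial>\<nu>)" .
  have "emeasure (\<mu> \<Otimes>\<^sub>M \<nu>) (- ?Q) = (\<integral>\<^sup>+s. emeasure \<nu> {..<s} \<partial>\<mu>)"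
    unfolding N.emeasure_pair_measure_alt[OF Q'] by (simp add: vimage_def lessThan_def not_le)
  also have "\<dots> = ennreal (\<integral>s. measure \<nu> {..<s} \<partial>\<mu>)"
    unfolding N.emeasure_eq_measure by (intro nn_integral_eq_integral i) auto
  finally have 2: "emeasure (\<mu> \<Otimes>\<^sub>M \<nu>) (- ?Q) = ennreal (\<integral>s. measure \<nu> {..<s} \<partial>\<mu>)" .
  have "emeasure (\<mu> \<Otimes>\<^sub>M \<nu>) ?Q + emeasure (\<mu> \<Otimes>\<^sub>M \<nu>) (- ?Q) = emeasure (\<mu> \<Otimes>\<^sub>M \<nu>) (UNIV \<times> UNIV)"
    by (subst plus_emeasure[OF Q Q']) auto
  also have "\<dots> = emeasure \<mu> UNIV * emeasure \<nu> UNIV"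
    by (rule N.emeasure_pair_measure_Times) auto
  finally have "ennreal ((\<integral>t. measure \<mu> {..t} \<partial>\<nu>) + (\<integral>s. measure \<nu> {..<s} \<partial>\<mu>)) = ennreal (measure \<mu> UNIV * measure \<nu> UNIV)"
    unfolding 1 2 M.emeasure_eq_measure N.emeasure_eq_measure
    by (simp add: ennreal_plus ennreal_mult)
  then show ?thesis
    by (subst (asm) ennreal_inj) (auto intro!: add_nonneg_nonneg mult_nonneg_nonneg Bochner_Integration.integral_nonneg)
qed

text \<open>The identity \<open>N\<^sub>T\<^sup>2 = \<integral> (N\<^sub>s + N\<^sub>s\<^sub>-) dN\<^sub>s\<close> for \<open>N = \<nu> - \<mu>\<close>, localised to the initial segment on which
  the sum of both distribution functions is at most \<open>K\<close>.\<close>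

lemma integral_cdf_diff_square:
  fixes \<mu> \<nu> :: "real measure" and K :: real
  assumes "finite_borel_measure \<mu>" "finite_borel_measure \<nu>"
  defines "J \<equiv> {t. measure \<mu> {..t} + measure \<nu> {..t} \<le> K}"
  defines "f \<equiv> \<lambda>t. indicator J t * (measure \<nu> {..t} + measure \<nu> {..<t} - measure \<mu> {..t} - measure \<mu> {..<t})"
  shows "(\<integral>t. f t \<partial>\<nu>) - (\<integral>t. f t \<partial>\<mu>) = (measure \<nu> J - measure \<mu> J)\<^sup>2"
    "f \<in> borel_measurable borel" "J \<in> sets borel"
proof -
  interpret M: finite_borel_measure \<mu> by fact
  interpret N: finite_borel_measure \<nu> by fact
  have [measurable]: "(\<lambda>t. measure \<mu> {..t}) \<in> borel_measurable borel" "(\<lambda>t. measure \<mu> {..<t}) \<in> borel_measurable borel"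
      "(\<lambda>t. measure \<nu> {..t}) \<in> borel_measurable borel" "(\<lambda>t. measure \<nu> {..<t}) \<in> borel_measurable borel"
    using cdf_measurable assms(1,2) by blast+
  have "{t \<in> space borel. measure \<mu> {..t} + measure \<nu> {..t} \<le> K} \<in> sets borel" by measurable
  then show J[measurable]: "J \<in> sets borel" unfolding J_def by simp
  show f[measurable]: "f \<in> borel_measurable borel" unfolding f_def by measurable
  \<comment> \<open>\<open>J\<close> is an initial segment, so restricting both measures to it does
    not change their distribution functions at points of \<open>J\<close>. The restricted measures
    can then be treated without localisation.\<close>
  have down: "s \<in> J" if "t \<in> J" "s \<le> t" for s t
    using that M.cdf_nondecreasing[of s t] N.cdf_nondecreasing[of s t] unfolding J_def cdf_def by auto
  define \<alpha> \<beta> where "\<alpha> = density \<mu> (indicator J)" and "\<beta> = density \<nu> (indicator J)"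
  have em: "emeasure \<alpha> X = emeasure \<mu> (J \<inter> X)" "emeasure \<beta> X = emeasure \<nu> (J \<inter> X)" if "X \<in> sets borel" for X
    unfolding \<alpha>_def \<beta>_def using J that by (simp_all add: emeasure_restricted M.M_is_borel N.M_is_borel)
  then have me: "measure \<alpha> X = measure \<mu> (J \<inter> X)" "measure \<beta> X = measure \<nu> (J \<inter> X)" if "X \<in> sets borel" for X
    using that by (auto simp: measure_def)
  have s: "sets \<alpha> = sets borel" "sets \<beta> = sets borel" "space \<alpha> = UNIV" "space \<beta> = UNIV"
    unfolding \<alpha>_def \<beta>_def by (simp_all add: M.M_is_borel N.M_is_borel M.borel_UNIV N.borel_UNIV)
  have fin: "finite_borel_measure \<alpha>" "finite_borel_measure \<beta>"
    by (intro finite_borel_measure.intro finite_measureI finite_borel_measure_axioms.intro;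
        simp add: s em M.emeasure_eq_measure N.emeasure_eq_measure)+
  interpret A: finite_borel_measure \<alpha> by fact
  interpret B: finite_borel_measure \<beta> by fact
  define g where "g t = measure \<beta> {..t} + measure \<beta> {..<t} - measure \<alpha> {..t} - measure \<alpha> {..<t}" for t
  have fg: "f t = indicator J t * g t" for t
  proof (cases "t \<in> J")
    case True
    then have "J \<inter> {..t} = {..t}" "J \<inter> {..<t} = {..<t}" using down by auto
    then show ?thesis unfolding f_def g_def by (simp add: me)
  qed (simp add: f_def)
  have gm[measurable]: "g \<in> borel_measurable borel"
    unfolding g_def using cdf_measurable fin by (intro borel_measurable_add borel_measurable_diff) blast+
  have I: "(\<integral>t. f t \<partial>\<nu>) = (\<integral>t. g t \<partial>\<beta>)" "(\<integral>t. f t \<partial>\<mu>) = (\<integral>t. g t \<partial>\<alpha>)"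
  proof -
    have [measurable]: "g \<in> borel_measurable \<nu>" "g \<in> borel_measurable \<mu>" "J \<in> sets \<nu>" "J \<in> sets \<mu>"
      using gm J by (auto simp: M.M_is_borel N.M_is_borel cong: measurable_cong_sets)
    have "(\<integral>t. g t \<partial>density \<nu> (\<lambda>x. ennreal (indicator J x))) = (\<integral>t. indicator J t *\<^sub>R g t \<partial>\<nu>)"
      "(\<integral>t. g t \<partial>density \<mu> (\<lambda>x. ennreal (indicator J x))) = (\<integral>t. indicator J t *\<^sub>R g t \<partial>\<mu>)"
      by (rule integral_density; measurable; simp)+
    then show "(\<integral>t. f t \<partial>\<nu>) = (\<integral>t. g t \<partial>\<beta>)" "(\<integral>t. f t \<partial>\<mu>) = (\<integral>t. g t \<partial>\<alpha>)"
      unfolding \<alpha>_def \<beta>_def fg by (simp_all add: ennreal_indicator)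
  qed
  have ci: "integrable \<kappa> (\<lambda>t. measure \<rho> {..t})" "integrable \<kappa> (\<lambda>t. measure \<rho> {..<t})"
    if fk: "finite_borel_measure \<kappa>" "finite_borel_measure \<rho>" for \<kappa> \<rho>
  proof -
    interpret k: finite_borel_measure \<kappa> by fact
    interpret r: finite_borel_measure \<rho> by fact
    show "integrable \<kappa> (\<lambda>t. measure \<rho> {..t})" "integrable \<kappa> (\<lambda>t. measure \<rho> {..<t})"
      using cdf_measurable[OF fk(2)] k.M_is_borel
      by (intro k.integrable_const_bound[where B="measure \<rho> (space \<rho>)"];
          auto intro!: r.bounded_measure cong: measurable_cong_sets)+
  qed
  \<comment> \<open>Grouped so that every bracket is an instance of
    \<open>integral_cdf_by_parts\<close>; the four products of total masses form the square.\<close>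
  have "(\<integral>t. g t \<partial>\<beta>) - (\<integral>t. g t \<partial>\<alpha>)
    = ((\<integral>t. measure \<beta> {..t} \<partial>\<beta>) + (\<integral>t. measure \<beta> {..<t} \<partial>\<beta>))
    + ((\<integral>t. measure \<alpha> {..t} \<partial>\<alpha>) + (\<integral>t. measure \<alpha> {..<t} \<partial>\<alpha>))
    - ((\<integral>t. measure \<alpha> {..t} \<partial>\<beta>) + (\<integral>t. measure \<beta> {..<t} \<partial>\<alpha>))
    - ((\<integral>t. measure \<beta> {..t} \<partial>\<alpha>) + (\<integral>t. measure \<alpha> {..<t} \<partial>\<beta>))"
    unfolding g_def using fin by (simp add: ci)
  also have "\<dots> = (measure \<beta> UNIV - measure \<alpha> UNIV)\<^sup>2"
    unfolding integral_cdf_by_parts[OF fin(1) fin(2)] integral_cdf_by_parts[OF fin(2) fin(1)]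
      integral_cdf_by_parts[OF fin(1) fin(1)] integral_cdf_by_parts[OF fin(2) fin(2)]
    by (simp add: power2_eq_square algebra_simps)
  finally show "(\<integral>t. f t \<partial>\<nu>) - (\<integral>t. f t \<partial>\<mu>) = (measure \<nu> J - measure \<mu> J)\<^sup>2"
    unfolding I by (simp add: me)
qed

section \<open>Rectangles generating the predictable algebra\<close>

context usual_conditions
begin

text \<open>The left end of the cell of \<open>t\<close>, strictly before \<open>t\<close> when
  \<open>t > 0\<close>, so that limits along it are left limits. At \<open>t = 0\<close> the
  subtraction on naturals returns index \<open>0\<close>.\<close>

definition grid_before :: "nat \<Rightarrow> real \<Rightarrow> real" where
  "grid_before n t = grid n (ix n t - 1)"

lemma grid_eq: "j \<le> 2 ^ n \<Longrightarrow> grid n j = T * real j / 2 ^ n"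
proof -
  assume "j \<le> 2 ^ n"
  then have "real j / 2 ^ n \<le> 1" by simp
  then show ?thesis unfolding grid_def by (simp add: min_absorb2)
qed

lemma grid_before_range: "grid_before n t \<in> {0..T}"
  unfolding grid_before_def by (rule grid_range)

lemma grid_before_0 [simp]: "grid_before n 0 = 0" by (simp add: grid_before_def)

lemma ix_pos: "t \<in> {0<..T} \<Longrightarrow> \<exists>j. ix n t = Suc j"
  using ix_le_iff[of n t 0] by (cases "ix n t") auto

lemma grid_before_less: "t \<in> {0<..T} \<Longrightarrow> grid_before n t < t"
  using ix_pos[of t n] ix_eq_SucD(1)[of n t] by (auto simp: grid_before_def)

lemma grid_before_le: "t \<in> {0..T} \<Longrightarrow> grid_before n t \<le> t"
  using grid_before_less[of t n] by (cases "t = 0") auto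

lemma grid_before_ge: assumes "t \<in> {0<..T}" shows "t - T / 2 ^ n \<le> grid_before n t"
proof -
  obtain j where j: "ix n t = Suc j" using ix_pos[OF assms] by blast
  have "t \<le> T * real (Suc j) / 2 ^ n" using ix_le_iff[of n t "Suc j"] j by simp
  also have "\<dots> = T * real j / 2 ^ n + T / 2 ^ n" by (simp add: field_simps)
  finally show ?thesis using ix_eq_SucD(2)[OF j] assms j by (auto simp: grid_before_def)
qed

lemma grid_before_tendsto: assumes "t \<in> {0<..T}" shows "filterlim (\<lambda>n. grid_before n t) (at_left t) sequentially"
  unfolding filterlim_at
proof
  show "eventually (\<lambda>n. grid_before n t \<in> {..<t} \<and> grid_before n t \<noteq> t) sequentially"
    using grid_before_less[OF assms] by (auto intro!: always_eventually simp: less_imp_neq)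
  have "(\<lambda>n. t - T * (1/2) ^ n) \<longlonglongrightarrow> t - T * 0"
    by (intro tendsto_intros LIMSEQ_power_zero) auto
  then have "(\<lambda>n. t - T / 2 ^ n) \<longlonglongrightarrow> t" by (simp add: power_one_over)
  then show "(\<lambda>n. grid_before n t) \<longlonglongrightarrow> t"
    by (rule tendsto_sandwich[rotated 2, OF _ tendsto_const])
       (use grid_before_ge[OF assms] less_imp_le[OF grid_before_less[OF assms]] in auto)
qed

text \<open>Sampling at the left end of the cell makes any adapted process left-continuous and keeps
  it adapted. Left limits of paths thereby become limits of predictable processes.\<close>

lemma step_process_predictable:
  assumes "adapted_process T F X"
  shows "(\<lambda>(\<omega>, t). X (grid_before n t) \<omega>) \<in> borel_measurable (predictable_algebra P T F)"
proof (rule left_continuous_adapted_predictable)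
  show "adapted_process T F (\<lambda>t. X (grid_before n t))"
    unfolding adapted_process_def
  proof
    fix t assume t: "t \<in> {0..T}"
    have "X (grid_before n t) \<in> borel_measurable (F (grid_before n t))"
      using assms grid_before_range[of n t] unfolding adapted_process_def by blast
    then show "X (grid_before n t) \<in> borel_measurable (F t)"
      by (rule measurable_F_mono[OF _ grid_before_range t grid_before_le[OF t]])
  qed
  show "left_continuous_process P T (\<lambda>t. X (grid_before n t))"
    unfolding left_continuous_process_def continuous_within
  proof (intro ballI)
    fix \<omega> t assume t: "t \<in> {0<..T}"
    have "eventually (\<lambda>s. X (grid_before n s) \<omega> = X (grid_before n t) \<omega>) (at_left t)"
      using eventually_ix_const[OF t, of n] by eventually_elim (simp add: grid_before_def)
    then show "((\<lambda>s. X (grid_before n s) \<omega>) \<longlongrightarrow> X (grid_before n t) \<omega>) (at_left t)"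
      by (rule tendsto_eventually)
  qed
qed

text \<open>Intervals open on the left never contain \<open>0\<close>, so the slice at time
  \<open>0\<close> is listed separately. The common right end \<open>T\<close> makes the family
  stable under intersection.\<close>

definition rects :: "('a \<times> real) set set" where
  "rects = {B \<times> {0} |B. B \<in> sets (F 0)} \<union> {B \<times> {s<..T} |B s. s \<in> {0..T} \<and> B \<in> sets (F s)}"

lemma rects_subset: "rects \<subseteq> Pow (space P \<times> {0..T})"
proof -
  have "B \<subseteq> space P" if "B \<in> sets (F s)" "s \<in> {0..T}" for B s
    using sets.sets_into_space[OF that(1)] space_F[OF that(2)] by simp
  then show ?thesis unfolding rects_def using T_pos by fastforce
qed

lemma space_predictable: "space (predictable_algebra P T F) = space P \<times> {0..T}"
  unfolding predictable_algebra_def by (simp add: space_measure_of_conv)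

text \<open>The indicator of a rectangle is itself an adapted left-continuous process. The slice at
  \<open>0\<close> qualifies too, since left-continuity concerns positive times.\<close>

lemma rects_predictable: "rects \<subseteq> sets (predictable_algebra P T F)"
proof
  fix R assume "R \<in> rects"
  then consider B where "R = B \<times> {0}" "B \<in> sets (F 0)"
    | B s where "R = B \<times> {s<..T}" "s \<in> {0..T}" "B \<in> sets (F s)" unfolding rects_def by blast
  then show "R \<in> sets (predictable_algebra P T F)"
  proof cases
    case 1
    have Bs: "B \<subseteq> space P" using sets.sets_into_space[OF 1(2)] space_F[of 0] T_pos by simp
    let ?X = "\<lambda>t \<omega>. if t = 0 then indicator B \<omega> else 0 :: real"
    have "(\<lambda>(\<omega>, t). ?X t \<omega>) \<in> borel_measurable (predictable_algebra P T F)"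
    proof (rule left_continuous_adapted_predictable)
      show "adapted_process T F ?X"
        unfolding adapted_process_def
      proof
        fix t assume "t \<in> {0..T}"
        have "indicator B \<in> borel_measurable (F t)" if "t = 0"
          unfolding that by (rule borel_measurable_indicator[OF 1(2)])
        then show "?X t \<in> borel_measurable (F t)" by (cases "t = 0") simp_all
      qed
      show "left_continuous_process P T ?X"
        unfolding left_continuous_process_def continuous_within
      proof (intro ballI)
        fix \<omega> t assume t: "t \<in> {0<..T}"
        have "eventually (\<lambda>s. ?X s \<omega> = ?X t \<omega>) (at_left t)"
          by (rule eventually_at_leftI[of 0]) (use t in auto)
        then show "((\<lambda>s. ?X s \<omega>) \<longlongrightarrow> ?X t \<omega>) (at_left t)" by (rule tendsto_eventually)
      qed
    qed
    then have "(\<lambda>(\<omega>, t). ?X t \<omega>) -` {1} \<inter> space (predictable_algebra P T F) \<in> sets (predictable_algebra P T F)"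
      by (rule measurable_sets) simp
    moreover have "(\<lambda>(\<omega>, t). ?X t \<omega>) -` {1} \<inter> space (predictable_algebra P T F) = R"
      unfolding space_predictable 1(1) using Bs T_pos by (auto simp: indicator_def split: if_splits)
    ultimately show ?thesis by simp
  next
    case 2
    have Bs: "B \<subseteq> space P" using sets.sets_into_space[OF 2(3)] space_F[OF 2(2)] by simp
    let ?X = "\<lambda>t \<omega>. if s < t then indicator B \<omega> else 0 :: real"
    have "(\<lambda>(\<omega>, t). ?X t \<omega>) \<in> borel_measurable (predictable_algebra P T F)"
    proof (rule left_continuous_adapted_predictable)
      show "adapted_process T F ?X"
        unfolding adapted_process_def
      proof
        fix t assume t: "t \<in> {0..T}"
        have "(indicator B :: 'a \<Rightarrow> real) \<in> borel_measurable (F t)" if "s < t"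
          using 2 sets_F_mono[OF 2(2) t] that by (auto intro!: borel_measurable_indicator)
        then show "?X t \<in> borel_measurable (F t)" by (cases "s < t") simp_all
      qed
      show "left_continuous_process P T ?X"
        unfolding left_continuous_process_def continuous_within
      proof (intro ballI)
        fix \<omega> t assume t: "t \<in> {0<..T}"
        have "eventually (\<lambda>r. ?X r \<omega> = ?X t \<omega>) (at_left t)"
          by (rule eventually_at_leftI[of "if s < t then s else 0"]) (use t in auto)
        then show "((\<lambda>r. ?X r \<omega>) \<longlongrightarrow> ?X t \<omega>) (at_left t)" by (rule tendsto_eventually)
      qed
    qed
    then have "(\<lambda>(\<omega>, t). ?X t \<omega>) -` {1} \<inter> space (predictable_algebra P T F) \<in> sets (predictable_algebra P T F)"
      by (rule measurable_sets) simp
    moreover have "(\<lambda>(\<omega>, t). ?X t \<omega>) -` {1} \<inter> space (predictable_algebra P T F) = R"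
      unfolding space_predictable 2(1) using Bs 2(2) by (auto simp: indicator_def split: if_splits)
    ultimately show ?thesis by simp
  qed
qed

abbreviation "rect_algebra \<equiv> sigma (space P \<times> {0..T}) rects"

lemma space_rect [simp]: "space rect_algebra = space P \<times> {0..T}"
  by (simp add: space_measure_of_conv)

lemma sets_rect: "sets rect_algebra = sigma_sets (space P \<times> {0..T}) rects"
  by (rule sets_measure_of[OF rects_subset])

lemma rect_measurableI:
  fixes f :: "'a \<Rightarrow> real" and I :: "real set"
  assumes f: "f \<in> borel_measurable (F s)" and s: "s \<in> {0..T}" and I: "I \<subseteq> {0..T}"
    and R: "\<And>B. B \<in> sets (F s) \<Longrightarrow> B \<times> I \<in> rects"
  shows "(\<lambda>(\<omega>, t). f \<omega> * indicator I t) \<in> borel_measurable rect_algebra"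
proof (rule measurableI)
  fix V :: "real set" assume V: "V \<in> sets borel"
  have g: "(f -` U \<inter> space P) \<times> I \<in> sets rect_algebra" if "U \<in> sets borel" for U
    using R[of "f -` U \<inter> space P"] measurable_sets[OF f that] space_F[OF s] by (auto simp: sets_rect)
  show "(\<lambda>(\<omega>, t). f \<omega> * indicator I t) -` V \<inter> space rect_algebra \<in> sets rect_algebra"
  \<comment> \<open>Off \<open>I\<close> the function is \<open>0\<close>, so for
    \<open>0 \<in> V\<close> the preimage contains the complement of the strip and is described
    through its own complement.\<close>
  proof (cases "0 \<in> V")
    case False
    then have "f \<omega> * indicator I t \<in> V \<longleftrightarrow> f \<omega> \<in> V \<and> t \<in> I" for \<omega> t
      by (cases "t \<in> I") auto
    then have "(\<lambda>(\<omega>, t). f \<omega> * indicator I t) -` V \<inter> space rect_algebra = (f -` V \<inter> space P) \<times> I"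
      using I by auto
    then show ?thesis using g[OF V] by simp
  next
    case True
    then have "f \<omega> * indicator I t \<in> V \<longleftrightarrow> \<not> (f \<omega> \<notin> V \<and> t \<in> I)" for \<omega> t
      by (cases "t \<in> I") auto
    then have "(\<lambda>(\<omega>, t). f \<omega> * indicator I t) -` V \<inter> space rect_algebra = space rect_algebra - (f -` (- V) \<inter> space P) \<times> I"
      using I by auto
    then show ?thesis using g[of "- V"] V by auto
  qed
qed auto

text \<open>A left-continuous process is the pointwise limit of its samples at the left ends of
  dyadic cells, and each sample is a finite sum over rectangles.\<close>

lemma predictable_subset_rect: "sets (predictable_algebra P T F) \<subseteq> sets rect_algebra"
proof -
  have X: "(\<lambda>(\<omega>, t). X t \<omega>) \<in> borel_measurable rect_algebra"
    if ad: "adapted_process T F X" and lc: "left_continuous_process P T X" for X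
  proof (rule borel_measurable_LIMSEQ_real)
    \<comment> \<open>A single cell is obtained as the difference of two intervals ending at
      \<open>T\<close>, the kind available in \<open>rects\<close>; the value at time
      \<open>0\<close> has its own term.\<close>
    let ?Y = "\<lambda>n (\<omega>, t). X 0 \<omega> * indicator {0} t
        + (\<Sum>j<2 ^ n. X (grid n j) \<omega> * indicator {grid n j<..T} t - X (grid n j) \<omega> * indicator {grid n (Suc j)<..T} t)"
    have Xm: "X s \<in> borel_measurable (F s)" if "s \<in> {0..T}" for s using ad that by (simp add: adapted_process_def)
    have 1: "(\<lambda>(\<omega>, t). X 0 \<omega> * indicator {0} t) \<in> borel_measurable rect_algebra"
      by (rule rect_measurableI[OF Xm]) (use T_pos in \<open>auto simp: rects_def\<close>)
    have 2: "(\<lambda>(\<omega>, t). X (grid n j) \<omega> * indicator {grid n i<..T} t) \<in> borel_measurable rect_algebra" if "j \<le> i" for n i j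
    proof (rule rect_measurableI[OF measurable_F_mono[OF Xm[OF grid_range] grid_range grid_range monoD[OF grid_mono that]] grid_range])
      show "{grid n i<..T} \<subseteq> {0..T}" using grid_range[of n i] by auto
      show "B \<times> {grid n i<..T} \<in> rects" if "B \<in> sets (F (grid n i))" for B
        using that grid_range[of n i] unfolding rects_def by blast
    qed
    have "(\<lambda>p. (\<lambda>(\<omega>, t). X 0 \<omega> * indicator {0} t) p + (\<Sum>j<2 ^ n. (\<lambda>(\<omega>, t). X (grid n j) \<omega> * indicator {grid n j<..T} t) p
        - (\<lambda>(\<omega>, t). X (grid n j) \<omega> * indicator {grid n (Suc j)<..T} t) p)) \<in> borel_measurable rect_algebra" for n
      by (intro borel_measurable_add borel_measurable_sum borel_measurable_diff 1 2) auto
    then show "?Y n \<in> borel_measurable rect_algebra" for n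
      by (simp add: case_prod_beta)
    fix p assume "p \<in> space rect_algebra"
    then obtain \<omega> t where p: "p = (\<omega>, t)" "\<omega> \<in> space P" "t \<in> {0..T}" by auto
    show "(\<lambda>n. ?Y n p) \<longlonglongrightarrow> (case p of (\<omega>, t) \<Rightarrow> X t \<omega>)"
    proof (cases "t = 0")
      case True
      then have "\<not> grid n j < t" for n j using grid_range[of n j] by auto
      then have "?Y n p = X t \<omega>" for n using True by (simp add: p)
      then show ?thesis by (simp add: p)
    next
      case False
      then have t: "t \<in> {0<..T}" using p by auto
      have "?Y n p = X (grid_before n t) \<omega>" for n
      proof -
        obtain i where i: "ix n t = Suc i" using ix_pos[OF t] by blast
        then have i2: "i < 2 ^ n" using ix_le[of t n] t by simp
        have lt: "grid n j < t \<longleftrightarrow> j \<le> i" if "j \<le> 2 ^ n" for j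
          using ix_le_iff[of n t j] i unfolding grid_eq[OF that] by auto
        have "(\<Sum>j<2 ^ n. X (grid n j) \<omega> * indicator {grid n j<..T} t - X (grid n j) \<omega> * indicator {grid n (Suc j)<..T} t)
           = (\<Sum>j<2 ^ n. if j = i then X (grid n j) \<omega> else 0)"
        proof (rule sum.cong[OF refl])
          fix j assume "j \<in> {..<2 ^ n :: nat}"
          then have "grid n j < t \<longleftrightarrow> j \<le> i" "grid n (Suc j) < t \<longleftrightarrow> Suc j \<le> i" using lt[of j] lt[of "Suc j"] by auto
          then show "X (grid n j) \<omega> * indicator {grid n j<..T} t - X (grid n j) \<omega> * indicator {grid n (Suc j)<..T} t
             = (if j = i then X (grid n j) \<omega> else 0)" using t by (auto simp: indicator_def)
        qed
        also have "\<dots> = X (grid_before n t) \<omega>" using i i2 by (simp add: grid_before_def)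
        finally show ?thesis using False by (simp add: p)
      qed
      moreover have "((\<lambda>s. X s \<omega>) \<longlongrightarrow> X t \<omega>) (at_left t)"
        using lc t p(2) by (simp add: left_continuous_process_def continuous_within)
      then have "(\<lambda>n. X (grid_before n t) \<omega>) \<longlonglongrightarrow> X t \<omega>"
        by (rule filterlim_compose[OF _ grid_before_tendsto[OF t]])
      ultimately show ?thesis by (simp add: p)
    qed
  qed
  show ?thesis
  proof -
    let ?G = "{(\<lambda>(\<omega>, t). X t \<omega>) -` B \<inter> (space P \<times> {0..T}) | X (B :: real set).
          adapted_process T F X \<and> left_continuous_process P T X \<and> B \<in> sets borel}"
    have "?G \<subseteq> sets rect_algebra"
      using measurable_sets[OF X] by fastforce
    then have "sigma_sets (space rect_algebra) ?G \<subseteq> sets rect_algebra" by (rule sets.sigma_sets_subset)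
    moreover have "sets (predictable_algebra P T F) = sigma_sets (space P \<times> {0..T}) ?G"
      unfolding predictable_algebra_def by (rule sets_measure_of) auto
    ultimately show ?thesis by simp
  qed
qed

lemma sets_predictable: "sets (predictable_algebra P T F) = sigma_sets (space P \<times> {0..T}) rects"
proof
  show "sets (predictable_algebra P T F) \<subseteq> sigma_sets (space P \<times> {0..T}) rects"
    using predictable_subset_rect sets_rect by simp
  show "sigma_sets (space P \<times> {0..T}) rects \<subseteq> sets (predictable_algebra P T F)"
    using sets.sigma_sets_subset[OF rects_predictable] by (simp add: space_predictable)
qed

lemma Int_stable_rects: "Int_stable rects"
proof (rule Int_stableI)
  fix R R' assume "R \<in> rects" "R' \<in> rects"
  have e: "{} \<in> rects" unfolding rects_def by blast
  have T0: "0 \<in> {0..T}" using T_pos by simp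
  have z: "(B \<times> {0}) \<inter> (B' \<times> {s<..T}) = {}" "(B' \<times> {s<..T}) \<inter> (B \<times> {0}) = {}" if "s \<in> {0..T}" for B B' :: "'a set" and s
    using that by auto
  from \<open>R \<in> rects\<close> consider B where "R = B \<times> {0}" "B \<in> sets (F 0)"
    | B s where "R = B \<times> {s<..T}" "s \<in> {0..T}" "B \<in> sets (F s)" unfolding rects_def by blast
  then show "R \<inter> R' \<in> rects"
  proof cases
    case 1
    from \<open>R' \<in> rects\<close> consider B where "R' = B \<times> {0}" "B \<in> sets (F 0)"
      | B s where "R' = B \<times> {s<..T}" "s \<in> {0..T}" "B \<in> sets (F s)" unfolding rects_def by blast
    then show ?thesis
    proof cases
      case (1 B')
      have "R \<inter> R' = (B \<inter> B') \<times> {0}" using \<open>R = B \<times> {0}\<close> 1 by auto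
      moreover have "B \<inter> B' \<in> sets (F 0)" using \<open>B \<in> sets (F 0)\<close> 1 by auto
      ultimately show ?thesis unfolding rects_def by blast
    next
      case (2 B' s)
      then show ?thesis using z e 1 by simp
    qed
  next
    case (2 B s)
    note 2 = 2
    from \<open>R' \<in> rects\<close> consider B where "R' = B \<times> {0}" "B \<in> sets (F 0)"
      | B s where "R' = B \<times> {s<..T}" "s \<in> {0..T}" "B \<in> sets (F s)" unfolding rects_def by blast
    then show ?thesis
    proof cases
      case (1 B')
      then show ?thesis using z e 2 by simp
    next
      case (2 B' s')
      have "R \<inter> R' = (B \<inter> B') \<times> {max s s'<..T}" using \<open>R = B \<times> {s<..T}\<close> 2 by auto
      moreover have m: "max s s' \<in> {0..T}" using \<open>s \<in> {0..T}\<close> 2 by auto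
      moreover have "B \<inter> B' \<in> sets (F (max s s'))"
        using \<open>B \<in> sets (F s)\<close> 2 sets_F_mono[OF \<open>s \<in> {0..T}\<close> m] sets_F_mono[OF 2(2) m] by auto
      ultimately show ?thesis unfolding rects_def by blast
    qed
  qed
qed

end

section \<open>Uniqueness\<close>

text \<open>Path properties are demanded in every scenario, so that each path has a Stieltjes
  measure. \<open>doob_meyer_integrator\<close> reaches this by resetting the process to
  \<open>0\<close> on a null set.\<close>

locale increasing_integrator = usual_conditions P T F for P :: "'a measure" and T F +
  fixes a :: "real \<Rightarrow> 'a \<Rightarrow> real"
  assumes adapted: "adapted_process T F a"
    and predictable: "(\<lambda>(\<omega>, t). a t \<omega>) \<in> borel_measurable (predictable_algebra P T F)"
    and a_0: "\<And>\<omega>. \<omega> \<in> space P \<Longrightarrow> a 0 \<omega> = 0"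
    and a_mono: "\<And>\<omega> s t. \<omega> \<in> space P \<Longrightarrow> 0 \<le> s \<Longrightarrow> s \<le> t \<Longrightarrow> t \<le> T \<Longrightarrow> a s \<omega> \<le> a t \<omega>"
    and a_right: "\<And>\<omega> t. \<omega> \<in> space P \<Longrightarrow> 0 \<le> t \<Longrightarrow> t < T \<Longrightarrow> ((\<lambda>s. a s \<omega>) \<longlongrightarrow> a t \<omega>) (at_right t)"
    and a_integrable: "integrable P (a T)"
begin

lemma a_measurable_F: "t \<in> {0..T} \<Longrightarrow> a t \<in> borel_measurable (F t)"
  using adapted unfolding adapted_process_def by blast

lemma a_measurable: "t \<in> {0..T} \<Longrightarrow> a t \<in> borel_measurable P"
  using measurable_F_P[OF a_measurable_F] by blast

lemma a_nonneg: "\<omega> \<in> space P \<Longrightarrow> t \<in> {0..T} \<Longrightarrow> 0 \<le> a t \<omega>"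
  using a_mono[of \<omega> 0 t] a_0[of \<omega>] by simp

text \<open>The right-continuous inverse of the path of \<open>a\<close>. Pushing Lebesgue measure forward along it
  yields the Lebesgue-Stieltjes measure of the path, jointly measurably in the scenario.\<close>

definition clock :: "real \<Rightarrow> 'a \<Rightarrow> real" where
  "clock u \<omega> = Inf ({t\<in>{0..T}. u \<le> a t \<omega>} \<union> {T})"

lemma bdd_clock: "bdd_below ({t\<in>{0..T}. u \<le> a t \<omega>} \<union> {T})"
  using T_pos by (intro bdd_belowI[of _ 0]) auto

lemma clock_range: "clock u \<omega> \<in> {0..T}"
proof -
  have "clock u \<omega> \<le> T" unfolding clock_def using bdd_clock by (intro cInf_lower) auto
  moreover have "0 \<le> clock u \<omega>" unfolding clock_def using T_pos by (intro cInf_greatest) auto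
  ultimately show ?thesis by simp
qed

text \<open>If \<open>a t \<omega> < u\<close>, right-continuity keeps the path below
  \<open>u\<close> a little longer, so the infimum lies strictly after \<open>t\<close>. The time
  \<open>T\<close> is excluded because it is the default value of \<open>clock\<close>.\<close>

lemma clock_le_iff:
  assumes \<omega>: "\<omega> \<in> space P" and t: "0 \<le> t" "t < T"
  shows "clock u \<omega> \<le> t \<longleftrightarrow> u \<le> a t \<omega>"
proof
  assume "u \<le> a t \<omega>"
  then show "clock u \<omega> \<le> t" unfolding clock_def using t bdd_clock by (intro cInf_lower) auto
next
  assume c: "clock u \<omega> \<le> t"
  show "u \<le> a t \<omega>"
  proof (rule ccontr)
    assume "\<not> u \<le> a t \<omega>"
    then have lt: "a t \<omega> < u" by simp
    have "eventually (\<lambda>s. a s \<omega> < u) (at_right t)" by (rule order_tendstoD(2)[OF a_right[OF \<omega> t] lt])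
    then obtain b where b: "t < b" "\<And>s. t < s \<Longrightarrow> s < b \<Longrightarrow> a s \<omega> < u"
      unfolding eventually_at_right_field by blast
    have "min b T \<le> clock u \<omega>" unfolding clock_def
    proof (rule cInf_greatest)
      fix r assume r: "r \<in> {t\<in>{0..T}. u \<le> a t \<omega>} \<union> {T}"
      show "min b T \<le> r"
      proof (cases "r = T")
        case False
        then have r': "0 \<le> r" "r \<le> T" "u \<le> a r \<omega>" using r by auto
        then have "\<not> r \<le> t" using a_mono[OF \<omega> r'(1), of t] t lt by auto
        then have "\<not> r < b" using b(2)[of r] r' by auto
        then show ?thesis by simp
      qed simp
    qed simp
    then show False using c b(1) t by simp
  qed
qed

lemma clock_mono: "u \<le> v \<Longrightarrow> clock u \<omega> \<le> clock v \<omega>"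
  unfolding clock_def by (intro cInf_superset_mono bdd_clock) auto

lemma clock_borel [measurable]: "(\<lambda>u. clock u \<omega>) \<in> borel_measurable borel"
  by (rule borel_measurable_mono) (auto simp: mono_def clock_mono)

definition path_measure :: "'a \<Rightarrow> real measure" where
  "path_measure \<omega> = distr (density lborel (indicator {0<..a T \<omega>})) borel (\<lambda>u. clock u \<omega>)"

lemma emeasure_path:
  assumes "X \<in> sets borel"
  shows "emeasure (path_measure \<omega>) X = emeasure lborel ({0<..a T \<omega>} \<inter> {u. clock u \<omega> \<in> X})"
proof -
  have m: "(\<lambda>u. clock u \<omega>) \<in> measurable (density lborel (indicator {0<..a T \<omega>})) borel"
    using clock_borel[of \<omega>] by (simp cong: measurable_cong_sets)
  have "(\<lambda>u. clock u \<omega>) -` X \<inter> space borel \<in> sets borel" by (rule measurable_sets[OF clock_borel assms])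
  then have s: "{u. clock u \<omega> \<in> X} \<in> sets lborel" by (simp add: vimage_def)
  show ?thesis
    unfolding path_measure_def emeasure_distr[OF m assms]
    using emeasure_restricted[of "{0<..a T \<omega>}" lborel, OF _ s] by (simp add: vimage_def)
qed

lemma path_UNIV: "\<omega> \<in> space P \<Longrightarrow> emeasure (path_measure \<omega>) UNIV = ennreal (a T \<omega>)"
  using a_nonneg[of \<omega> T] T_pos by (simp add: emeasure_path)

lemma path_finite_borel: "\<omega> \<in> space P \<Longrightarrow> finite_borel_measure (path_measure \<omega>)"
proof (intro finite_borel_measure.intro finite_measureI finite_borel_measure_axioms.intro)
  show "sets (path_measure \<omega>) = sets borel" by (simp add: path_measure_def)
  have "space (path_measure \<omega>) = UNIV" by (simp add: path_measure_def)
  then show "emeasure (path_measure \<omega>) (space (path_measure \<omega>)) \<noteq> \<infinity>" if "\<omega> \<in> space P"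
    using path_UNIV[OF that] by simp
qed

lemma measure_path_UNIV: "\<omega> \<in> space P \<Longrightarrow> measure (path_measure \<omega>) UNIV = a T \<omega>"
  using path_UNIV[of \<omega>] a_nonneg[of \<omega> T] T_pos by (simp add: measure_def)

text \<open>The clock has not passed \<open>t\<close> exactly for levels up to
  \<open>a t \<omega>\<close>, an interval of length \<open>a t \<omega>\<close>. At
  \<open>t = T\<close> this holds because the clock never exceeds \<open>T\<close>.\<close>

lemma path_cdf:
  assumes \<omega>: "\<omega> \<in> space P" and t: "t \<in> {0..T}"
  shows "measure (path_measure \<omega>) {..t} = a t \<omega>"
proof -
  have "{0<..a T \<omega>} \<inter> {u. clock u \<omega> \<in> {..t}} = {0<..a t \<omega>}"
  proof (cases "t = T")
    case True
    then show ?thesis using clock_range[of _ \<omega>] by auto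
  next
    case False
    then have "clock u \<omega> \<le> t \<longleftrightarrow> u \<le> a t \<omega>" for u by (intro clock_le_iff[OF \<omega>]) (use t in auto)
    moreover have "a t \<omega> \<le> a T \<omega>" using a_mono[OF \<omega>, of t T] t by simp
    ultimately show ?thesis by (auto intro: order_trans)
  qed
  then have "emeasure (path_measure \<omega>) {..t} = ennreal (a t \<omega>)"
    using a_nonneg[OF \<omega> t] by (simp add: emeasure_path)
  then show ?thesis using a_nonneg[OF \<omega> t] by (simp add: measure_def)
qed

text \<open>Expresses the mass strictly before \<open>t\<close> through countably many values of the
  process, as required for measurability. At \<open>t = 0\<close> both sides are \<open>0\<close>,
  since the clock is never negative.\<close>

lemma path_left_limit:
  assumes \<omega>: "\<omega> \<in> space P" and t: "t \<in> {0..T}"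
  shows "(\<lambda>n. a (grid_before n t) \<omega>) \<longlonglongrightarrow> measure (path_measure \<omega>) {..<t}"
proof (cases "t = 0")
  case True
  have "{0<..a T \<omega>} \<inter> {u. clock u \<omega> \<in> {..<0}} = {}"
  proof (intro equals0I)
    fix u assume "u \<in> {0<..a T \<omega>} \<inter> {u. clock u \<omega> \<in> {..<0}}"
    then show False using clock_range[of u \<omega>] by simp
  qed
  then have "measure (path_measure \<omega>) {..<0} = 0" by (simp add: measure_def emeasure_path)
  then show ?thesis using True a_0[OF \<omega>] by simp
next
  case False
  then have t': "t \<in> {0<..T}" using t by auto
  interpret finite_borel_measure "path_measure \<omega>" by (rule path_finite_borel[OF \<omega>])
  have "(\<lambda>n. cdf (path_measure \<omega>) (grid_before n t)) \<longlonglongrightarrow> measure (path_measure \<omega>) {..<t}"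
    by (rule filterlim_compose[OF cdf_at_left grid_before_tendsto[OF t']])
  then show ?thesis unfolding cdf_def path_cdf[OF \<omega> grid_before_range] .
qed

section \<open>The Doleans measure on the predictable algebra\<close>

abbreviation "graph_map \<equiv> (\<lambda>(\<omega>, u). (\<omega>, clock u \<omega>))"

definition region :: "('a \<times> real) set" where
  "region = {z \<in> space (P \<Otimes>\<^sub>M lborel). 0 < snd z \<and> snd z \<le> a T (fst z)}"

lemma region_sets [measurable]: "region \<in> sets (P \<Otimes>\<^sub>M lborel)"
proof -
  have [measurable]: "a T \<in> borel_measurable P" using a_integrable by auto
  show ?thesis unfolding region_def by measurable
qed

lemma region_iff: "(\<omega>, u) \<in> region \<longleftrightarrow> \<omega> \<in> space P \<and> 0 < u \<and> u \<le> a T \<omega>"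
  by (simp add: region_def space_pair_measure)

text \<open>It is enough to treat the generating rectangles. For \<open>s < T\<close>,
  \<open>clock_le_iff\<close> turns the event that the clock is at most \<open>s\<close> into
  \<open>snd z \<le> a s (fst z)\<close>, which is jointly measurable.\<close>

lemma graph_map_measurable [measurable]: "graph_map \<in> measurable (P \<Otimes>\<^sub>M lborel) (predictable_algebra P T F)"
proof (rule measurable_sigma_sets[OF sets_predictable rects_subset])
  show "graph_map \<in> space (P \<Otimes>\<^sub>M lborel) \<rightarrow> space P \<times> {0..T}"
    using clock_range by (auto simp: space_pair_measure)
  have le: "{z \<in> space (P \<Otimes>\<^sub>M lborel). clock (snd z) (fst z) \<le> s} \<in> sets (P \<Otimes>\<^sub>M lborel)" if s: "s \<in> {0..T}" for s
  proof (cases "s = T")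
    case True
    then have "{z \<in> space (P \<Otimes>\<^sub>M lborel). clock (snd z) (fst z) \<le> s} = space (P \<Otimes>\<^sub>M lborel)" using clock_range by auto
    then show ?thesis by (simp only: sets.top)
  next
    case False
    have [measurable]: "a s \<in> borel_measurable P" by (rule a_measurable[OF s])
    have "{z \<in> space (P \<Otimes>\<^sub>M lborel). snd z \<le> a s (fst z)} \<in> sets (P \<Otimes>\<^sub>M lborel)" by measurable
    moreover have "{z \<in> space (P \<Otimes>\<^sub>M lborel). clock (snd z) (fst z) \<le> s} = {z \<in> space (P \<Otimes>\<^sub>M lborel). snd z \<le> a s (fst z)}"
      using clock_le_iff[of _ s] s False by (auto simp: space_pair_measure)
    ultimately show ?thesis by (simp only:)
  qed
  have cyl: "B \<times> UNIV \<in> sets (P \<Otimes>\<^sub>M lborel)" if "B \<in> sets P" for B using that by (intro pair_measureI) auto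
  fix R assume "R \<in> rects"
  then consider B where "R = B \<times> {0}" "B \<in> sets (F 0)"
    | B s where "R = B \<times> {s<..T}" "s \<in> {0..T}" "B \<in> sets (F s)" unfolding rects_def by blast
  then show "graph_map -` R \<inter> space (P \<Otimes>\<^sub>M lborel) \<in> sets (P \<Otimes>\<^sub>M lborel)"
  proof cases
    case 1
    have z: "0 \<in> {0..T}" using T_pos by simp
    have B: "B \<in> sets P" using 1(2) sets_F[OF z] by blast
    have "graph_map -` R \<inter> space (P \<Otimes>\<^sub>M lborel) = (B \<times> UNIV) \<inter> {z \<in> space (P \<Otimes>\<^sub>M lborel). clock (snd z) (fst z) \<le> 0}"
      unfolding 1(1) using clock_range by (auto intro!: antisym)
    then show ?thesis using sets.Int[OF cyl[OF B] le[OF z]] by (simp only:)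
  next
    case 2
    have B: "B \<in> sets P" using 2(3) sets_F[OF 2(2)] by blast
    have "graph_map -` R \<inter> space (P \<Otimes>\<^sub>M lborel) = (B \<times> UNIV) \<inter> (space (P \<Otimes>\<^sub>M lborel) - {z \<in> space (P \<Otimes>\<^sub>M lborel). clock (snd z) (fst z) \<le> s})"
      unfolding 2(1) using clock_range by (auto simp: not_le)
    then show ?thesis using sets.Int[OF cyl[OF B] sets.compl_sets[OF le[OF 2(2)]]] by (simp only:)
  qed
qed

text \<open>The measure \<open>R \<mapsto> E \<integral> 1_R da\<close>, written as a single image
  of a measure on the product space, so that measurability in the scenario is contained in that of
  \<open>graph_map\<close>.\<close>

definition doleans :: "('a \<times> real) measure" where
  "doleans = distr (density (P \<Otimes>\<^sub>M lborel) (indicator region)) (predictable_algebra P T F) graph_map"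

lemma sets_doleans [simp]: "sets doleans = sets (predictable_algebra P T F)"
  by (simp add: doleans_def)

lemma emeasure_doleans:
  assumes "R \<in> sets (predictable_algebra P T F)"
  shows "emeasure doleans R = (\<integral>\<^sup>+\<omega>. emeasure lborel {u. 0 < u \<and> u \<le> a T \<omega> \<and> (\<omega>, clock u \<omega>) \<in> R} \<partial>P)"
proof -
  have m: "graph_map \<in> measurable (density (P \<Otimes>\<^sub>M lborel) (indicator region)) (predictable_algebra P T F)"
    using graph_map_measurable by (simp cong: measurable_cong_sets)
  let ?V = "graph_map -` R \<inter> space (P \<Otimes>\<^sub>M lborel)"
  have V: "?V \<in> sets (P \<Otimes>\<^sub>M lborel)" by (rule measurable_sets[OF graph_map_measurable assms])
  have "emeasure doleans R = emeasure (P \<Otimes>\<^sub>M lborel) (region \<inter> ?V)"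
    unfolding doleans_def emeasure_distr[OF m assms] space_density by (rule emeasure_restricted[OF region_sets V])
  also have "\<dots> = (\<integral>\<^sup>+\<omega>. emeasure lborel (Pair \<omega> -` (region \<inter> ?V)) \<partial>P)"
    by (rule lborel.emeasure_pair_measure_alt[OF sets.Int[OF region_sets V]])
  also have "\<dots> = (\<integral>\<^sup>+\<omega>. emeasure lborel {u. 0 < u \<and> u \<le> a T \<omega> \<and> (\<omega>, clock u \<omega>) \<in> R} \<partial>P)"
    by (rule nn_integral_cong) (auto intro!: arg_cong[where f="emeasure lborel"] simp: region_iff space_pair_measure)
  finally show ?thesis .
qed

text \<open>Paths start at \<open>0\<close>, so every positive level is reached strictly after time
  \<open>0\<close>.\<close>

lemma doleans_rect_0:
  assumes "B \<in> sets (F 0)" shows "emeasure doleans (B \<times> {0}) = 0"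
proof -
  have "B \<times> {0} \<in> sets (predictable_algebra P T F)" using rects_predictable assms unfolding rects_def by blast
  then have "emeasure doleans (B \<times> {0}) = (\<integral>\<^sup>+\<omega>. emeasure lborel {u. 0 < u \<and> u \<le> a T \<omega> \<and> (\<omega>, clock u \<omega>) \<in> B \<times> {0}} \<partial>P)"
    by (rule emeasure_doleans)
  also have "\<dots> = (\<integral>\<^sup>+\<omega>. 0 \<partial>P)"
  proof (rule nn_integral_cong)
    fix \<omega> assume \<omega>: "\<omega> \<in> space P"
    have "{u. 0 < u \<and> u \<le> a T \<omega> \<and> (\<omega>, clock u \<omega>) \<in> B \<times> {0}} = {}"
    proof (intro equals0I)
      fix u assume "u \<in> {u. 0 < u \<and> u \<le> a T \<omega> \<and> (\<omega>, clock u \<omega>) \<in> B \<times> {0}}"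
      then have "0 < u" "clock u \<omega> \<le> 0" by auto
      then show False using clock_le_iff[OF \<omega>, of 0 u] a_0[OF \<omega>] T_pos by simp
    qed
    then show "emeasure lborel {u. 0 < u \<and> u \<le> a T \<omega> \<and> (\<omega>, clock u \<omega>) \<in> B \<times> {0}} = 0" by (simp only: emeasure_empty)
  qed
  finally show ?thesis by simp
qed

lemma a_t_integrable: assumes "t \<in> {0..T}" shows "integrable P (a t)"
proof (rule Bochner_Integration.integrable_bound[OF a_integrable a_measurable[OF assms]])
  show "AE \<omega> in P. norm (a t \<omega>) \<le> norm (a T \<omega>)"
  proof (rule AE_I2)
    fix \<omega> assume \<omega>: "\<omega> \<in> space P"
    show "norm (a t \<omega>) \<le> norm (a T \<omega>)"
      using a_nonneg[OF \<omega> assms] a_mono[OF \<omega>, of t T] assms by simp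
  qed
qed

lemma doleans_rect:
  assumes s: "s \<in> {0..T}" and B: "B \<in> sets (F s)"
  shows "emeasure doleans (B \<times> {s<..T}) = ennreal (\<integral>\<omega>. indicator B \<omega> * (a T \<omega> - a s \<omega>) \<partial>P)"
proof -
  have BP: "B \<in> sets P" using B sets_F[OF s] by blast
  have "B \<times> {s<..T} \<in> sets (predictable_algebra P T F)" using rects_predictable s B unfolding rects_def by blast
  then have "emeasure doleans (B \<times> {s<..T}) = (\<integral>\<^sup>+\<omega>. emeasure lborel {u. 0 < u \<and> u \<le> a T \<omega> \<and> (\<omega>, clock u \<omega>) \<in> B \<times> {s<..T}} \<partial>P)"
    by (rule emeasure_doleans)
  also have "\<dots> = (\<integral>\<^sup>+\<omega>. ennreal (indicator B \<omega> * (a T \<omega> - a s \<omega>)) \<partial>P)"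
  proof (rule nn_integral_cong)
    fix \<omega> assume \<omega>: "\<omega> \<in> space P"
    have le: "a s \<omega> \<le> a T \<omega>" using a_mono[OF \<omega>, of s T] s by simp
    show "emeasure lborel {u. 0 < u \<and> u \<le> a T \<omega> \<and> (\<omega>, clock u \<omega>) \<in> B \<times> {s<..T}} = ennreal (indicator B \<omega> * (a T \<omega> - a s \<omega>))"
    proof (cases "\<omega> \<in> B")
      case True
      have "{u. 0 < u \<and> u \<le> a T \<omega> \<and> (\<omega>, clock u \<omega>) \<in> B \<times> {s<..T}} = {a s \<omega><..a T \<omega>}"
      proof (cases "s = T")
        case sT: True
        then show ?thesis by auto
      next
        case False
        have "s < clock u \<omega> \<longleftrightarrow> a s \<omega> < u" for u using clock_le_iff[OF \<omega>, of s u] s False by auto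
        then show ?thesis using True clock_range[of _ \<omega>] a_nonneg[OF \<omega> s] by auto
      qed
      then show ?thesis using True le by simp
    qed simp
  qed
  also have "\<dots> = ennreal (\<integral>\<omega>. indicator B \<omega> * (a T \<omega> - a s \<omega>) \<partial>P)"
  proof (rule nn_integral_eq_integral)
    show "integrable P (\<lambda>\<omega>. indicator B \<omega> * (a T \<omega> - a s \<omega>))"
      by (intro integrable_indicator_mult[OF BP] Bochner_Integration.integrable_diff a_integrable a_t_integrable s)
    show "AE \<omega> in P. 0 \<le> indicator B \<omega> * (a T \<omega> - a s \<omega>)"
      using a_mono[of _ s T] s by (intro AE_I2) auto
  qed
  finally show ?thesis .
qed

text \<open>\<open>H\<close> is defined on the predictable space, while \<open>h \<omega>\<close> is
  a Borel function on the whole line that can be integrated against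
  \<open>path_measure \<omega>\<close>. They agree on \<open>{0..T}\<close>, where the clock takes
  its values, so Fubini's theorem on \<open>region\<close> connects the two integrals.\<close>

lemma doleans_integral:
  fixes H :: "'a \<times> real \<Rightarrow> real"
  assumes H[measurable]: "H \<in> borel_measurable (predictable_algebra P T F)"
    and bound: "\<And>z. z \<in> space P \<times> {0..T} \<Longrightarrow> \<bar>H z\<bar> \<le> c"
    and h: "\<And>\<omega>. \<omega> \<in> space P \<Longrightarrow> h \<omega> \<in> borel_measurable borel"
    and Hh: "\<And>\<omega> t. \<omega> \<in> space P \<Longrightarrow> t \<in> {0..T} \<Longrightarrow> H (\<omega>, t) = h \<omega> t"
  shows "integrable P (\<lambda>\<omega>. \<integral>t. h \<omega> t \<partial>path_measure \<omega>)"
    "(\<integral>z. H z \<partial>doleans) = (\<integral>\<omega>. (\<integral>t. h \<omega> t \<partial>path_measure \<omega>) \<partial>P)"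
proof -
  interpret pair_sigma_finite P lborel ..
  define G where "G z = indicator region z * H (graph_map z)" for z
  have Gm[measurable]: "G \<in> borel_measurable (P \<Otimes>\<^sub>M lborel)" unfolding G_def by measurable
  have T0: "T \<in> {0..T}" using T_pos by simp
  have "emeasure (P \<Otimes>\<^sub>M lborel) region = (\<integral>\<^sup>+\<omega>. emeasure lborel (Pair \<omega> -` region) \<partial>P)"
    by (rule lborel.emeasure_pair_measure_alt[OF region_sets])
  also have "\<dots> = (\<integral>\<^sup>+\<omega>. ennreal (a T \<omega>) \<partial>P)"
  proof (rule nn_integral_cong)
    fix \<omega> assume \<omega>: "\<omega> \<in> space P"
    then have "Pair \<omega> -` region = {0<..a T \<omega>}" by (auto simp: region_iff)
    then show "emeasure lborel (Pair \<omega> -` region) = ennreal (a T \<omega>)" using a_nonneg[OF \<omega> T0] by simp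
  qed
  also have "\<dots> = ennreal (\<integral>\<omega>. a T \<omega> \<partial>P)"
    by (rule nn_integral_eq_integral[OF a_integrable]) (use a_nonneg[OF _ T0] in auto)
  finally have fin: "emeasure (P \<Otimes>\<^sub>M lborel) region < \<infinity>" by simp
  have Gi: "integrable (P \<Otimes>\<^sub>M lborel) G"
  proof (rule Bochner_Integration.integrable_bound[OF _ Gm])
    show "integrable (P \<Otimes>\<^sub>M lborel) (\<lambda>z. c * indicator region z)"
      by (intro integrable_mult_right integrable_real_indicator region_sets fin)
    show "AE z in P \<Otimes>\<^sub>M lborel. norm (G z) \<le> norm (c * indicator region z)"
    proof (rule AE_I2)
      fix z :: "'a \<times> real" assume "z \<in> space (P \<Otimes>\<^sub>M lborel)"
      then have "\<bar>H (graph_map z)\<bar> \<le> c" using clock_range by (intro bound) (auto simp: space_pair_measure)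
      then show "norm (G z) \<le> norm (c * indicator region z)" by (auto simp: G_def indicator_def)
    qed
  qed
  have inner: "(\<integral>u. G (\<omega>, u) \<partial>lborel) = (\<integral>t. h \<omega> t \<partial>path_measure \<omega>)" if \<omega>: "\<omega> \<in> space P" for \<omega>
  proof -
    have hm[measurable]: "h \<omega> \<in> borel_measurable borel" by (rule h[OF \<omega>])
    have cm: "(\<lambda>u. clock u \<omega>) \<in> measurable (density lborel (indicator {0<..a T \<omega>})) borel"
      using clock_borel[of \<omega>] by (simp cong: measurable_cong_sets)
    have "(\<integral>t. h \<omega> t \<partial>path_measure \<omega>) = (\<integral>u. h \<omega> (clock u \<omega>) \<partial>density lborel (indicator {0<..a T \<omega>}))"
      unfolding path_measure_def by (rule integral_distr[OF cm hm])
    also have "\<dots> = (\<integral>u. h \<omega> (clock u \<omega>) \<partial>density lborel (\<lambda>u. ennreal (indicator {0<..a T \<omega>} u)))"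
      by (simp add: ennreal_indicator)
    also have "\<dots> = (\<integral>u. indicator {0<..a T \<omega>} u *\<^sub>R h \<omega> (clock u \<omega>) \<partial>lborel)"
      by (rule integral_density) auto
    also have "\<dots> = (\<integral>u. G (\<omega>, u) \<partial>lborel)"
      by (rule Bochner_Integration.integral_cong[OF refl])
         (use \<omega> Hh[OF \<omega> clock_range] in \<open>auto simp: G_def region_iff indicator_def\<close>)
    finally show ?thesis by simp
  qed
  show "integrable P (\<lambda>\<omega>. \<integral>t. h \<omega> t \<partial>path_measure \<omega>)"
    using integrable_fst'[OF Gi] by (subst (asm) Bochner_Integration.integrable_cong[OF refl inner]) auto
  have gm: "graph_map \<in> measurable (density (P \<Otimes>\<^sub>M lborel) (indicator region)) (predictable_algebra P T F)"
    using graph_map_measurable by (simp cong: measurable_cong_sets)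
  have "(\<integral>z. H z \<partial>doleans) = (\<integral>z. H (graph_map z) \<partial>density (P \<Otimes>\<^sub>M lborel) (indicator region))"
    unfolding doleans_def by (rule integral_distr[OF gm H])
  also have "\<dots> = (\<integral>z. H (graph_map z) \<partial>density (P \<Otimes>\<^sub>M lborel) (\<lambda>z. ennreal (indicator region z)))"
    by (simp add: ennreal_indicator)
  also have "\<dots> = (\<integral>z. indicator region z *\<^sub>R H (graph_map z) \<partial>(P \<Otimes>\<^sub>M lborel))"
    by (rule integral_density[OF measurable_compose[OF graph_map_measurable H] borel_measurable_indicator[OF region_sets]]) simp
  also have "\<dots> = (\<integral>z. G z \<partial>(P \<Otimes>\<^sub>M lborel))" by (simp add: G_def)
  also have "\<dots> = (\<integral>\<omega>. (\<integral>u. G (\<omega>, u) \<partial>lborel) \<partial>P)"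
    by (rule integral_fst'[OF Gi, symmetric])
  also have "\<dots> = (\<integral>\<omega>. (\<integral>t. h \<omega> t \<partial>path_measure \<omega>) \<partial>P)"
    by (rule Bochner_Integration.integral_cong[OF refl inner])
  finally show "(\<integral>z. H z \<partial>doleans) = (\<integral>\<omega>. (\<integral>t. h \<omega> t \<partial>path_measure \<omega>) \<partial>P)" .
qed

end

text \<open>The two Doleans measures agree on the generating rectangles, hence on the predictable algebra.
  Integrating the localised process \<open>N + N\<^sub>-\<close> for \<open>N = b - a\<close>, which is itself predictable, against
  both shows that the square in \<open>integral_cdf_diff_square\<close> has mean zero.\<close>

lemma increasing_integrators_terminal_eq:
  assumes "increasing_integrator P T F a" "increasing_integrator P T F b"
    and eq: "\<And>s B. s \<in> {0..T} \<Longrightarrow> B \<in> sets (F s) \<Longrightarrow>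
      (\<integral>\<omega>. indicator B \<omega> * (a T \<omega> - a s \<omega>) \<partial>P) = (\<integral>\<omega>. indicator B \<omega> * (b T \<omega> - b s \<omega>) \<partial>P)"
  shows "AE \<omega> in P. a T \<omega> = b T \<omega>"
proof -
  interpret A: increasing_integrator P T F a by fact
  interpret B: increasing_integrator P T F b by fact
  have T0: "T \<in> {0..T}" "0 \<in> {0..T}" using A.T_pos by auto
  have D: "A.doleans = B.doleans"
  proof (rule measure_eqI_generator_eq[OF A.Int_stable_rects A.rects_subset])
    show "sets A.doleans = sigma_sets (space P \<times> {0..T}) A.rects" "sets B.doleans = sigma_sets (space P \<times> {0..T}) A.rects"
      by (simp_all add: A.sets_predictable)
    fix R assume "R \<in> A.rects"
    then consider B where "R = B \<times> {0}" "B \<in> sets (F 0)"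
      | B s where "R = B \<times> {s<..T}" "s \<in> {0..T}" "B \<in> sets (F s)" unfolding A.rects_def by blast
    then show "emeasure A.doleans R = emeasure B.doleans R"
      by cases (simp_all add: A.doleans_rect_0 B.doleans_rect_0 A.doleans_rect B.doleans_rect eq)
  next
    \<comment> \<open>Two rectangles of finite mass, one of each kind, cover the space.\<close>
    let ?A = "\<lambda>i::nat. if i = 0 then space P \<times> {0::real} else space P \<times> {0<..T}"
    have sp: "space P \<in> sets (F 0)" using sets.top[of "F 0"] A.space_F[OF T0(2)] by simp
    then have "?A i \<in> A.rects" for i unfolding A.rects_def using T0 by (cases "i = 0") auto
    then show "range ?A \<subseteq> A.rects" by blast
    show "(\<Union>i. ?A i) = space P \<times> {0..T}"
    proof
      have "?A i \<subseteq> space P \<times> {0..T}" for i using A.T_pos by auto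
      then show "(\<Union>i. ?A i) \<subseteq> space P \<times> {0..T}" by blast
      have "space P \<times> {0..T} \<subseteq> ?A 0 \<union> ?A 1" by auto
      also have "\<dots> \<subseteq> (\<Union>i. ?A i)" by (intro Un_least UN_upper) auto
      finally show "space P \<times> {0..T} \<subseteq> (\<Union>i. ?A i)" .
    qed
    show "emeasure A.doleans (?A i) \<noteq> \<infinity>" for i
      using sp T0 by (simp add: A.doleans_rect_0 A.doleans_rect)
  qed
  define I where "I k \<omega> = {t. measure (A.path_measure \<omega>) {..t} + measure (B.path_measure \<omega>) {..t} \<le> real k}" for k \<omega>
  have K: "AE \<omega> in P. (measure (B.path_measure \<omega>) (I k \<omega>) - measure (A.path_measure \<omega>) (I k \<omega>))\<^sup>2 = 0" for k :: nat
  proof -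
    let ?K = "real k"
    define h where "h \<omega> t = indicator (I k \<omega>) t * (measure (B.path_measure \<omega>) {..t} + measure (B.path_measure \<omega>) {..<t}
      - measure (A.path_measure \<omega>) {..t} - measure (A.path_measure \<omega>) {..<t})" for \<omega> t
    have pw: "(\<integral>t. h \<omega> t \<partial>B.path_measure \<omega>) - (\<integral>t. h \<omega> t \<partial>A.path_measure \<omega>)
        = (measure (B.path_measure \<omega>) (I k \<omega>) - measure (A.path_measure \<omega>) (I k \<omega>))\<^sup>2"
      "h \<omega> \<in> borel_measurable borel" if "\<omega> \<in> space P" for \<omega>
      using integral_cdf_diff_square[OF A.path_finite_borel[OF that] B.path_finite_borel[OF that], of ?K]
      unfolding h_def[abs_def] I_def by blast+
    \<comment> \<open>The integrand \<open>h\<close> rewritten with the processes: distribution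
      functions become values of \<open>a\<close> and \<open>b\<close>, and their left limits become
      limits along \<open>grid_before\<close>. In this form it is predictable, because
      \<open>a\<close> and \<open>b\<close> are.\<close>
    define H where "H p = (if a (snd p) (fst p) + b (snd p) (fst p) \<le> ?K
      then b (snd p) (fst p) + lim (\<lambda>n. b (A.grid_before n (snd p)) (fst p))
        - a (snd p) (fst p) - lim (\<lambda>n. a (A.grid_before n (snd p)) (fst p)) else 0)" for p
    have [measurable]: "(\<lambda>p. a (snd p) (fst p)) \<in> borel_measurable (predictable_algebra P T F)"
      "(\<lambda>p. b (snd p) (fst p)) \<in> borel_measurable (predictable_algebra P T F)"
      using A.predictable B.predictable unfolding case_prod_beta' by blast+
    have [measurable]: "(\<lambda>p. a (A.grid_before n (snd p)) (fst p)) \<in> borel_measurable (predictable_algebra P T F)"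
      "(\<lambda>p. b (A.grid_before n (snd p)) (fst p)) \<in> borel_measurable (predictable_algebra P T F)" for n
      using A.step_process_predictable[OF A.adapted, of n] A.step_process_predictable[OF B.adapted, of n]
      unfolding case_prod_beta' by blast+
    have [measurable]: "(\<lambda>p. lim (\<lambda>n. a (A.grid_before n (snd p)) (fst p))) \<in> borel_measurable (predictable_algebra P T F)"
      "(\<lambda>p. lim (\<lambda>n. b (A.grid_before n (snd p)) (fst p))) \<in> borel_measurable (predictable_algebra P T F)"
      by (rule borel_measurable_lim_metric; measurable)+
    have Hm: "H \<in> borel_measurable (predictable_algebra P T F)" unfolding H_def by measurable
    have Hh: "H (\<omega>, t) = h \<omega> t" if "\<omega> \<in> space P" "t \<in> {0..T}" for \<omega> t
      unfolding H_def h_def I_def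
      using limI[OF A.path_left_limit[OF that]] limI[OF B.path_left_limit[OF that]] A.path_cdf[OF that] B.path_cdf[OF that]
      by simp
    have bound: "\<bar>H z\<bar> \<le> 2 * ?K" if z: "z \<in> space P \<times> {0..T}" for z
    proof -
      obtain \<omega> t where [simp]: "z = (\<omega>, t)" and \<omega>: "\<omega> \<in> space P" "t \<in> {0..T}" using z by auto
      interpret pa: finite_borel_measure "A.path_measure \<omega>" by (rule A.path_finite_borel[OF \<omega>(1)])
      interpret pb: finite_borel_measure "B.path_measure \<omega>" by (rule B.path_finite_borel[OF \<omega>(1)])
      have "measure (A.path_measure \<omega>) {..<t} \<le> measure (A.path_measure \<omega>) {..t}"
        "measure (B.path_measure \<omega>) {..<t} \<le> measure (B.path_measure \<omega>) {..t}"
        by (intro pa.finite_measure_mono pb.finite_measure_mono; auto simp: pa.M_is_borel pb.M_is_borel)+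
      moreover have "0 \<le> measure (A.path_measure \<omega>) {..<t}" "0 \<le> measure (B.path_measure \<omega>) {..<t}" by simp_all
      ultimately have "t \<in> I k \<omega> \<Longrightarrow> \<bar>measure (B.path_measure \<omega>) {..t} + measure (B.path_measure \<omega>) {..<t}
          - measure (A.path_measure \<omega>) {..t} - measure (A.path_measure \<omega>) {..<t}\<bar> \<le> 2 * ?K"
        unfolding I_def mem_Collect_eq by linarith
      then have "\<bar>h \<omega> t\<bar> \<le> 2 * ?K" by (cases "t \<in> I k \<omega>") (simp_all add: h_def)
      then show ?thesis using Hh[OF \<omega>] by simp
    qed
    note IA = A.doleans_integral[OF Hm bound pw(2) Hh] and IB = B.doleans_integral[OF Hm bound pw(2) Hh]
    have "(\<integral>\<omega>. (\<integral>t. h \<omega> t \<partial>B.path_measure \<omega>) - (\<integral>t. h \<omega> t \<partial>A.path_measure \<omega>) \<partial>P) = 0"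
      using IA IB D by simp
    moreover have "integrable P (\<lambda>\<omega>. (\<integral>t. h \<omega> t \<partial>B.path_measure \<omega>) - (\<integral>t. h \<omega> t \<partial>A.path_measure \<omega>))"
      using IA(1) IB(1) by simp
    moreover have "AE \<omega> in P. 0 \<le> (\<integral>t. h \<omega> t \<partial>B.path_measure \<omega>) - (\<integral>t. h \<omega> t \<partial>A.path_measure \<omega>)"
      by (rule AE_I2) (simp add: pw(1) del: diff_ge_0_iff_ge)
    ultimately have "AE \<omega> in P. (\<integral>t. h \<omega> t \<partial>B.path_measure \<omega>) - (\<integral>t. h \<omega> t \<partial>A.path_measure \<omega>) = 0"
      using integral_nonneg_eq_0_iff_AE by blast
    then show ?thesis
      using AE_space by eventually_elim (simp add: pw(1))
  qed
  then have "AE \<omega> in P. \<forall>k::nat. (measure (B.path_measure \<omega>) (I k \<omega>) - measure (A.path_measure \<omega>) (I k \<omega>))\<^sup>2 = 0"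
    by (simp only: AE_all_countable) blast
  then show ?thesis
    using AE_space
  proof eventually_elim
    case (elim \<omega>)
    interpret pa: finite_borel_measure "A.path_measure \<omega>" by (rule A.path_finite_borel[OF elim(2)])
    interpret pb: finite_borel_measure "B.path_measure \<omega>" by (rule B.path_finite_borel[OF elim(2)])
    \<comment> \<open>Once \<open>k\<close> exceeds both total masses together, the localising set
      is the whole line; this is chosen separately in each scenario.\<close>
    obtain k :: nat where k: "a T \<omega> + b T \<omega> \<le> real k" using real_arch_simple by blast
    have "measure (A.path_measure \<omega>) {..t} \<le> a T \<omega>" "measure (B.path_measure \<omega>) {..t} \<le> b T \<omega>" for t
      using pa.bounded_measure[of "{..t}"] pb.bounded_measure[of "{..t}"]
        A.measure_path_UNIV[OF elim(2)] B.measure_path_UNIV[OF elim(2)] pa.borel_UNIV pb.borel_UNIV by simp_all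
    then have "measure (A.path_measure \<omega>) {..t} + measure (B.path_measure \<omega>) {..t} \<le> real k" for t
      using k by (meson add_mono order_trans)
    then have "I k \<omega> = UNIV" by (simp add: I_def)
    then show ?case using elim(1)[rule_format, of k] A.measure_path_UNIV[OF elim(2)] B.measure_path_UNIV[OF elim(2)] by simp
  qed
qed

text \<open>Completeness puts \<open>Z\<close> into \<open>F 0\<close>, so \<open>Z\<close> times
  the time interval is a union of two rectangles and resetting there keeps predictability.
  Adaptedness and right-continuity are read off from \<open>S - M\<close>. In the integral identity
  the martingale cancels, leaving an expression in \<open>S\<close> alone that is common to all
  decompositions.\<close>

lemma (in usual_conditions) doob_meyer_integrator:
  assumes dm: "doob_meyer_decomposition P T F S M A"
    and S: "adapted_process T F S" "\<And>t. t \<in> {0..T} \<Longrightarrow> integrable P (S t)"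
    and Z: "Z \<in> null_sets P"
    and paths: "\<And>\<omega>. \<omega> \<in> space P - Z \<Longrightarrow> mono_on {0..T} (\<lambda>t. A t \<omega>) \<and> cadlag_path T (\<lambda>t. S t \<omega>) \<and> cadlag_path T (\<lambda>t. M t \<omega>)"
  defines "a \<equiv> \<lambda>t \<omega>. if \<omega> \<in> Z then 0 else A t \<omega>"
  shows "increasing_integrator P T F a"
    "\<And>s B. s \<in> {0..T} \<Longrightarrow> B \<in> sets (F s) \<Longrightarrow>
      (\<integral>\<omega>. indicator B \<omega> * (a T \<omega> - a s \<omega>) \<partial>P) = (\<integral>\<omega>. indicator B \<omega> * (S T \<omega> - S s \<omega>) \<partial>P)"
proof -
  have T0: "0 \<in> {0..T}" "T \<in> {0..T}" using T_pos by auto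
  have mart: "martingale P T F M" and pred: "predictable_process P T F A"
    and A0: "\<And>\<omega>. \<omega> \<in> space P \<Longrightarrow> A 0 \<omega> = 0"
    and dec: "\<And>t \<omega>. t \<in> {0..T} \<Longrightarrow> \<omega> \<in> space P \<Longrightarrow> S t \<omega> = M t \<omega> + A t \<omega>"
    using dm unfolding doob_meyer_decomposition_def by blast+
  have Mm: "M t \<in> borel_measurable (F t)" "integrable P (M t)" if "t \<in> {0..T}" for t
    using mart that unfolding martingale_def adapted_process_def by blast+
  have Sm: "S t \<in> borel_measurable (F t)" if "t \<in> {0..T}" for t
    using S(1) that unfolding adapted_process_def by blast
  have notZ: "AE \<omega> in P. \<omega> \<notin> Z" by (rule AE_not_in[OF Z])
  have aSM: "AE \<omega> in P. S t \<omega> - M t \<omega> = a t \<omega>" if "t \<in> {0..T}" for t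
    using notZ AE_space by eventually_elim (simp add: a_def dec[OF that])
  have am: "a t \<in> borel_measurable (F t)" if "t \<in> {0..T}" for t
    by (rule measurable_F_cong_AE[OF that borel_measurable_diff[OF Sm[OF that] Mm(1)[OF that]] aSM[OF that]])
  show "increasing_integrator P T F a"
  proof (unfold_locales)
    show "adapted_process T F a" using am unfolding adapted_process_def by blast
    have Z0: "Z \<in> sets (F 0)" by (rule null_sets_F[OF T0(1) Z])
    then have "Z \<times> {0} \<in> rects" "Z \<times> {0<..T} \<in> rects" unfolding rects_def using T0 by blast+
    then have "Z \<times> {0} \<union> Z \<times> {0<..T} \<in> sets (predictable_algebra P T F)" using rects_predictable by blast
    moreover have "{z \<in> space (predictable_algebra P T F). fst z \<in> Z} = Z \<times> {0} \<union> Z \<times> {0<..T}"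
      unfolding space_predictable using sets.sets_into_space[OF Z0] space_F[OF T0(1)] T_pos by auto
    ultimately have "{z \<in> space (predictable_algebra P T F). fst z \<in> Z} \<in> sets (predictable_algebra P T F)" by (simp only:)
    moreover have "(\<lambda>z. A (snd z) (fst z)) \<in> borel_measurable (predictable_algebra P T F)"
      using pred unfolding predictable_process_def case_prod_beta' .
    ultimately have "(\<lambda>z. if fst z \<in> Z then 0 else A (snd z) (fst z)) \<in> borel_measurable (predictable_algebra P T F)"
      by (intro measurable_If borel_measurable_const)
    then show "(\<lambda>(\<omega>, t). a t \<omega>) \<in> borel_measurable (predictable_algebra P T F)"
      unfolding case_prod_beta' a_def .
    show "a 0 \<omega> = 0" if "\<omega> \<in> space P" for \<omega> using A0[OF that] by (simp add: a_def)
    show "a s \<omega> \<le> a t \<omega>" if "\<omega> \<in> space P" "0 \<le> s" "s \<le> t" "t \<le> T" for \<omega> s t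
      using paths[of \<omega>] that by (auto simp: a_def mono_on_def)
    show "((\<lambda>s. a s \<omega>) \<longlongrightarrow> a t \<omega>) (at_right t)" if \<omega>: "\<omega> \<in> space P" and t: "0 \<le> t" "t < T" for \<omega> t
    proof (cases "\<omega> \<in> Z")
      case False
      then have "((\<lambda>s. S s \<omega> - M s \<omega>) \<longlongrightarrow> S t \<omega> - M t \<omega>) (at_right t)"
        using paths[of \<omega>] \<omega> t unfolding cadlag_path_def continuous_within by (intro tendsto_diff) auto
      moreover have "eventually (\<lambda>s. S s \<omega> - M s \<omega> = a s \<omega>) (at_right t)"
        by (rule eventually_at_rightI[OF _ t(2)]) (use t dec[OF _ \<omega>] False in \<open>auto simp: a_def\<close>)
      ultimately have "((\<lambda>s. a s \<omega>) \<longlongrightarrow> S t \<omega> - M t \<omega>) (at_right t)"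
        by (rule Lim_transform_eventually)
      then show ?thesis using dec[OF _ \<omega>, of t] t False by (simp add: a_def)
    qed (simp add: a_def)
    show "integrable P (a T)"
      by (rule integrable_cong_AE_imp[OF Bochner_Integration.integrable_diff[OF S(2)[OF T0(2)] Mm(2)[OF T0(2)]]
            measurable_F_P[OF am[OF T0(2)] T0(2)] aSM[OF T0(2)]])
  qed
  fix s B assume s: "s \<in> {0..T}" and B: "B \<in> sets (F s)"
  have BP[measurable]: "B \<in> sets P" using B sets_F[OF s] by blast
  have [measurable]: "a T \<in> borel_measurable P" "a s \<in> borel_measurable P" "M T \<in> borel_measurable P" "M s \<in> borel_measurable P"
      "S T \<in> borel_measurable P" "S s \<in> borel_measurable P"
    using measurable_F_P[OF am] measurable_F_P[OF Mm(1)] measurable_F_P[OF Sm] s T0 by blast+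
  interpret sigma_finite_subalgebra P "F s" by (rule sigma_finite_subalgebra_F[OF s])
  have i: "integrable P (\<lambda>\<omega>. indicator B \<omega> * (S T \<omega> - S s \<omega>))" "integrable P (\<lambda>\<omega>. indicator B \<omega> * M T \<omega>)"
    "integrable P (\<lambda>\<omega>. indicator B \<omega> * M s \<omega>)"
    by (intro integrable_indicator_mult[OF BP] Bochner_Integration.integrable_diff S(2) Mm(2) T0 s)+
  have "AE \<omega> in P. real_cond_exp P (F s) (M T) \<omega> = M s \<omega>"
    using mart s T0 unfolding martingale_def by auto
  then have "(\<integral>\<omega>. indicator B \<omega> * real_cond_exp P (F s) (M T) \<omega> \<partial>P) = (\<integral>\<omega>. indicator B \<omega> * M s \<omega> \<partial>P)"
    by (intro integral_cong_AE) auto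
  then have M: "(\<integral>\<omega>. indicator B \<omega> * M T \<omega> \<partial>P) = (\<integral>\<omega>. indicator B \<omega> * M s \<omega> \<partial>P)"
    using real_cond_exp_intA[OF Mm(2)[OF T0(2)] B] by (simp add: set_lebesgue_integral_def)
  have "(\<integral>\<omega>. indicator B \<omega> * (a T \<omega> - a s \<omega>) \<partial>P)
      = (\<integral>\<omega>. indicator B \<omega> * (S T \<omega> - S s \<omega>) - indicator B \<omega> * M T \<omega> + indicator B \<omega> * M s \<omega> \<partial>P)"
  proof (rule integral_cong_AE)
    show "AE \<omega> in P. indicator B \<omega> * (a T \<omega> - a s \<omega>)
        = indicator B \<omega> * (S T \<omega> - S s \<omega>) - indicator B \<omega> * M T \<omega> + indicator B \<omega> * M s \<omega>"
      using aSM[OF T0(2)] aSM[OF s]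
    proof eventually_elim
      case (elim \<omega>)
      show ?case unfolding elim[symmetric] by (simp add: algebra_simps)
    qed
  qed measurable
  also have "\<dots> = (\<integral>\<omega>. indicator B \<omega> * (S T \<omega> - S s \<omega>) \<partial>P)"
    using i by (simp add: M)
  finally show "(\<integral>\<omega>. indicator B \<omega> * (a T \<omega> - a s \<omega>) \<partial>P) = (\<integral>\<omega>. indicator B \<omega> * (S T \<omega> - S s \<omega>) \<partial>P)" .
qed

text \<open>Equal terminal values of the increasing parts mean equal terminal values of the
  martingales, and these determine the martingales by conditioning. One null set \<open>Z\<close>
  serves both decompositions.\<close>

lemma (in class_D_submartingale) doob_meyer_unique:
  assumes dm: "doob_meyer_decomposition P T F S M A" and dm': "doob_meyer_decomposition P T F S M' A'"
  shows "indistinguishable P T M' M" "indistinguishable P T A' A"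
proof -
  have T0: "0 \<in> {0..T}" "T \<in> {0..T}" using T_pos by auto
  have mart: "martingale P T F M" "martingale P T F M'"
    and cad: "cadlag_process P T M" "cadlag_process P T M'"
    and inc: "increasing_process P T A" "increasing_process P T A'"
    and dec: "\<And>t \<omega>. t \<in> {0..T} \<Longrightarrow> \<omega> \<in> space P \<Longrightarrow> S t \<omega> = M t \<omega> + A t \<omega>"
      "\<And>t \<omega>. t \<in> {0..T} \<Longrightarrow> \<omega> \<in> space P \<Longrightarrow> S t \<omega> = M' t \<omega> + A' t \<omega>"
    using dm dm' unfolding doob_meyer_decomposition_def by blast+
  have ad: "adapted_process T F S" using submartingale by (simp add: submartingale_def)
  have good: "AE \<omega> in P. (mono_on {0..T} (\<lambda>t. A t \<omega>) \<and> cadlag_path T (\<lambda>t. S t \<omega>) \<and> cadlag_path T (\<lambda>t. M t \<omega>))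
      \<and> (mono_on {0..T} (\<lambda>t. A' t \<omega>) \<and> cadlag_path T (\<lambda>t. S t \<omega>) \<and> cadlag_path T (\<lambda>t. M' t \<omega>))"
    using cad[unfolded cadlag_process_def] inc[unfolded increasing_process_def] cadlag[unfolded cadlag_process_def]
    by eventually_elim simp
  obtain Z where Z: "Z \<in> null_sets P" and
    Zp: "\<And>\<omega>. \<omega> \<in> space P - Z \<Longrightarrow> (mono_on {0..T} (\<lambda>t. A t \<omega>) \<and> cadlag_path T (\<lambda>t. S t \<omega>) \<and> cadlag_path T (\<lambda>t. M t \<omega>))
      \<and> (mono_on {0..T} (\<lambda>t. A' t \<omega>) \<and> cadlag_path T (\<lambda>t. S t \<omega>) \<and> cadlag_path T (\<lambda>t. M' t \<omega>))"
    by (rule AE_E3[OF good]) blast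
  let ?a = "\<lambda>t \<omega>. if \<omega> \<in> Z then 0 else A t \<omega>" and ?b = "\<lambda>t \<omega>. if \<omega> \<in> Z then 0 else A' t \<omega>"
  note a = doob_meyer_integrator[OF dm ad S_integrable Z conjunct1[OF Zp]]
  note b = doob_meyer_integrator[OF dm' ad S_integrable Z conjunct2[OF Zp]]
  have "AE \<omega> in P. ?a T \<omega> = ?b T \<omega>"
  proof (rule increasing_integrators_terminal_eq[OF a(1) b(1)])
    fix s B assume sB: "s \<in> {0..T}" "B \<in> sets (F s)"
    show "(\<integral>\<omega>. indicator B \<omega> * (?a T \<omega> - ?a s \<omega>) \<partial>P) = (\<integral>\<omega>. indicator B \<omega> * (?b T \<omega> - ?b s \<omega>) \<partial>P)"
      by (rule trans[OF a(2) b(2)[symmetric]]) (use sB in blast)+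
  qed
  then have "AE \<omega> in P. M T \<omega> = M' T \<omega>"
    using AE_not_in[OF Z] AE_space
  proof eventually_elim
    case (elim \<omega>)
    then show ?case using dec[OF T0(2) elim(3)] by simp
  qed
  note MT = this
  have Mt: "AE \<omega> in P. M t \<omega> = M' t \<omega>" if t: "t \<in> {0..T}" for t
  proof -
    interpret sigma_finite_subalgebra P "F t" by (rule sigma_finite_subalgebra_F[OF t])
    have "integrable P (M T)" "integrable P (M' T)" using mart T0 unfolding martingale_def by blast+
    then have "AE \<omega> in P. real_cond_exp P (F t) (M T) \<omega> = real_cond_exp P (F t) (M' T) \<omega>"
      by (intro real_cond_exp_cong MT) auto
    moreover have "AE \<omega> in P. real_cond_exp P (F t) (M T) \<omega> = M t \<omega>" "AE \<omega> in P. real_cond_exp P (F t) (M' T) \<omega> = M' t \<omega>"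
      using mart t T0 unfolding martingale_def by auto
    ultimately show ?thesis by eventually_elim simp
  qed
  \<comment> \<open>Equality at fixed times is gathered over countably many times only;
    right-continuity of both martingales extends it to all others, with \<open>T\<close> itself
    dyadic.\<close>
  have "AE \<omega> in P. \<forall>s\<in>dyadics. M s \<omega> = M' s \<omega>"
    unfolding AE_ball_countable[OF countable_dyadics] using Mt dyadics_range by blast
  then have all: "AE \<omega> in P. \<forall>t\<in>{0..T}. M t \<omega> = M' t \<omega>"
    using cad[unfolded cadlag_process_def]
  proof eventually_elim
    case (elim \<omega>)
    show ?case
    proof
      fix t assume t: "t \<in> {0..T}"
      show "M t \<omega> = M' t \<omega>"
      proof (cases "t = T")
        case True then show ?thesis using elim(1) dyadics_T by blast
      next
        case False
        then have t': "t \<in> {0..<T}" using t by simp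
        have r: "grid_after k t \<in> {t..T}" for k
          using grid_after_greater[OF t', of k] dyadics_range[OF grid_after_dyadics[of k t]] by simp
        have "(\<lambda>k. M (grid_after k t) \<omega>) \<longlonglongrightarrow> M t \<omega>" "(\<lambda>k. M' (grid_after k t) \<omega>) \<longlonglongrightarrow> M' t \<omega>"
          using cadlag_path_tendsto_right[OF elim(2) t r grid_after_tendsto[OF t']]
            cadlag_path_tendsto_right[OF elim(3) t r grid_after_tendsto[OF t']] by blast+
        moreover have "M (grid_after k t) \<omega> = M' (grid_after k t) \<omega>" for k
          using elim(1) grid_after_dyadics by blast
        ultimately show ?thesis using LIMSEQ_unique by simp
      qed
    qed
  qed
  then show "indistinguishable P T M' M" unfolding indistinguishable_def by eventually_elim simp
  show "indistinguishable P T A' A" unfolding indistinguishable_def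
    using all AE_space
  proof eventually_elim
    case (elim \<omega>)
    show ?case
    proof
      fix t assume t: "t \<in> {0..T}"
      then show "A' t \<omega> = A t \<omega>" using dec(1)[OF t elim(2)] dec(2)[OF t elim(2)] elim(1) by fastforce
    qed
  qed
qed

theorem theorem1p1:
  fixes P :: "'a measure" and T :: real
    and F :: "real \<Rightarrow> 'a measure" and S :: "real \<Rightarrow> 'a \<Rightarrow> real"
  assumes "prob_space P" and "0 < T"
    and "filtration_on P T F"
    and "right_continuous_filtration T F"
    and "complete_filtration P F"
    and "submartingale P T F S"
    and "cadlag_process P T S"
    and "class_D P T F S"
  shows "\<exists>M A. doob_meyer_decomposition P T F S M A \<and>
           (\<forall>M' A'. doob_meyer_decomposition P T F S M' A' \<longrightarrow>
              indistinguishable P T M' M \<and> indistinguishable P T A' A)"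
proof -
  interpret prob_space P by fact
  interpret class_D_submartingale P T F S
    by unfold_locales (fact assms)+
  show ?thesis using ex_doob_meyer_decomposition doob_meyer_unique by blast
qed

end
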